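(* MaxEDP is $\mathsf{NP}$-hard on unit-capacity graphs with feedback vertex set number $r=1$, and EDP is $\mathsf{NP}$-hard on unit-capacity graphs with feedback vertex set number $r=2$. *)

theory Defs
  imports Complex_Main "HOL-Computational_Algebra.Polynomial"
begin

section \<open>Multi-tape Turing machines\<close>

text \<open>
  States are \<open>0, \<dots>, states - 1\<close> and tape symbols are \<open>0, \<dots>, symbols - 1\<close>; symbol 0 is the blank,
  and the input/output bits are represented by the symbols 1 (for False) and 2 (for True).
  The transition function is nondeterministic. Given the current state and the scanned symbols
  (one per tape), it returns a set of pairs of a new state and, for every tape,
  the symbol to be written and the head movement. The machine halts when this set is empty.
\<close>

record tm =
  tapes :: nat
  symbols :: nat
  states :: nat
  start :: nat
  accept :: nat
  trans :: "nat \<Rightarrow> nat list \<Rightarrow> (nat \<times> (nat \<times> int) list) set"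

definition wf_tm :: "tm \<Rightarrow> bool" where
  "wf_tm M \<longleftrightarrow>
     1 \<le> tapes M \<and> 3 \<le> symbols M \<and> start M < states M \<and> accept M < states M \<and>
     (\<forall>q ss q' as. q < states M \<longrightarrow> length ss = tapes M \<longrightarrow> set ss \<subseteq> {..<symbols M} \<longrightarrow>
        (q', as) \<in> trans M q ss \<longrightarrow>
        q' < states M \<and> length as = tapes M \<and> set as \<subseteq> {..<symbols M} \<times> {-1, 0, 1})"

definition deterministic :: "tm \<Rightarrow> bool" where
  "deterministic M \<longleftrightarrow> (\<forall>q ss. \<forall>a \<in> trans M q ss. \<forall>b \<in> trans M q ss. a = b)"

text \<open>A tape is two-way infinite and consists of its content and the head position.\<close>

type_synonym tape = "(int \<Rightarrow> nat) \<times> int"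
type_synonym config = "nat \<times> tape list"

definition scan :: "tape \<Rightarrow> nat" where
  "scan t = fst t (snd t)"

definition act :: "nat \<times> int \<Rightarrow> tape \<Rightarrow> tape" where
  "act a t = ((fst t)(snd t := fst a), snd t + snd a)"

definition step :: "tm \<Rightarrow> config \<Rightarrow> config \<Rightarrow> bool" where
  "step M c c' \<longleftrightarrow>
     (\<exists>q' as. (q', as) \<in> trans M (fst c) (map scan (snd c)) \<and> c' = (q', map2 act as (snd c)))"

definition halted :: "tm \<Rightarrow> config \<Rightarrow> bool" where
  "halted M c \<longleftrightarrow> (\<nexists>c'. step M c c')"

definition string_content :: "bool list \<Rightarrow> int \<Rightarrow> nat" where
  "string_content x i =
     (if 0 \<le> i \<and> i < int (length x) then (if x ! nat i then 2 else 1) else 0)"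

definition init_config :: "tm \<Rightarrow> bool list \<Rightarrow> config" where
  "init_config M x = (start M, (string_content x, 0) # replicate (tapes M - 1) (string_content [], 0))"

section \<open>Polynomial-time reductions, NP, and NP-hardness\<close>

text \<open>The output is the content of the last tape.\<close>

definition poly_time_computable :: "(bool list \<Rightarrow> bool list) \<Rightarrow> bool" where
  "poly_time_computable f \<longleftrightarrow>
     (\<exists>M (p :: nat poly). wf_tm M \<and> deterministic M \<and>
        (\<forall>x. \<exists>t c. t \<le> poly p (length x) \<and> (step M ^^ t) (init_config M x) c \<and> halted M c \<and>
                   fst (last (snd c)) = string_content (f x)))"

definition NP :: "bool list set set" where
  "NP = {L. \<exists>M (p :: nat poly). wf_tm M \<and>
        (\<forall>x. (\<forall>t c. (step M ^^ t) (init_config M x) c \<longrightarrow> t \<le> poly p (length x)) \<and>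
             (x \<in> L \<longleftrightarrow> (\<exists>t c. (step M ^^ t) (init_config M x) c \<and> halted M c \<and> fst c = accept M)))}"

text \<open>
  \<open>NP_hard_on enc Inst Yes\<close>: the problem of deciding \<open>Yes\<close> on instances encoded by \<open>enc\<close>
  is NP-hard (under polynomial-time many-one reductions) even when restricted to
  instances from \<open>Inst\<close>; all images of a reduction are encodings of such instances.
\<close>

definition NP_hard_on :: "('i \<Rightarrow> bool list) \<Rightarrow> 'i set \<Rightarrow> ('i \<Rightarrow> bool) \<Rightarrow> bool" where
  "NP_hard_on enc Inst Yes \<longleftrightarrow>
     (\<forall>L \<in> NP. \<exists>f. poly_time_computable f \<and>
        (\<forall>x. \<exists>i \<in> Inst. f x = enc i \<and> (x \<in> L \<longleftrightarrow> Yes i)))"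

section \<open>Paths, feedback vertex sets, and routings in undirected graphs\<close>

definition path_edges :: "'a list \<Rightarrow> 'a set set" where
  "path_edges p = {{p ! i, p ! Suc i} | i. Suc i < length p}"

definition is_path :: "'a set \<Rightarrow> 'a set set \<Rightarrow> 'a \<Rightarrow> 'a \<Rightarrow> 'a list \<Rightarrow> bool" where
  "is_path V E s t p \<longleftrightarrow>
     p \<noteq> [] \<and> hd p = s \<and> last p = t \<and> distinct p \<and> set p \<subseteq> V \<and> path_edges p \<subseteq> E"

definition is_cycle :: "'a set \<Rightarrow> 'a set set \<Rightarrow> 'a list \<Rightarrow> bool" where
  "is_cycle V E p \<longleftrightarrow>
     3 \<le> length p \<and> distinct p \<and> set p \<subseteq> V \<and> path_edges p \<subseteq> E \<and> {last p, hd p} \<in> E"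

definition feedback_vertex_set :: "'a set \<Rightarrow> 'a set set \<Rightarrow> 'a set \<Rightarrow> bool" where
  "feedback_vertex_set V E R \<longleftrightarrow> R \<subseteq> V \<and> (\<nexists>p. is_cycle (V - R) E p)"

definition fvs_number :: "'a set \<Rightarrow> 'a set set \<Rightarrow> nat" where
  "fvs_number V E = (LEAST r. \<exists>R. feedback_vertex_set V E R \<and> card R = r)"

definition routable ::
  "'a set \<Rightarrow> 'a set set \<Rightarrow> ('a set \<Rightarrow> nat) \<Rightarrow> ('a \<times> 'a) set \<Rightarrow> bool" where
  "routable V E cap M \<longleftrightarrow>
     (\<exists>P. (\<forall>(s, t) \<in> M. is_path V E s t (P (s, t))) \<and>
          (\<forall>e \<in> E. card {m \<in> M. e \<in> path_edges (P m)} \<le> cap e))"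

definition max_routable ::
  "'a set \<Rightarrow> 'a set set \<Rightarrow> ('a set \<Rightarrow> nat) \<Rightarrow> ('a \<times> 'a) set \<Rightarrow> nat" where
  "max_routable V E cap M = Max {card M' | M'. M' \<subseteq> M \<and> routable V E cap M'}"

section \<open>The problems EDP and MaxEDP\<close>

text \<open>
  An instance is a simple graph on the vertices \<open>0, \<dots>, order - 1\<close> given by the list of its edges
  \<open>(u, v, c)\<close> with \<open>u < v\<close> and capacity \<open>c\<close>, together with a list of terminal pairs.
\<close>

record edp_instance =
  order :: nat
  edge_list :: "(nat \<times> nat \<times> nat) list"
  pair_list :: "(nat \<times> nat) list"

definition valid_instance :: "edp_instance \<Rightarrow> bool" where
  "valid_instance I \<longleftrightarrow>
     (\<forall>(u, v, c) \<in> set (edge_list I). u < v \<and> v < order I \<and> 1 \<le> c) \<and>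
     distinct (map (\<lambda>(u, v, c). (u, v)) (edge_list I)) \<and>
     (\<forall>(s, t) \<in> set (pair_list I). s < order I \<and> t < order I) \<and>
     distinct (pair_list I)"

definition verts :: "edp_instance \<Rightarrow> nat set" where
  "verts I = {..<order I}"

definition edges :: "edp_instance \<Rightarrow> nat set set" where
  "edges I = (\<lambda>(u, v, c). {u, v}) ` set (edge_list I)"

definition capacity :: "edp_instance \<Rightarrow> nat set \<Rightarrow> nat" where
  "capacity I e = the (map_of (map (\<lambda>(u, v, c). ({u, v}, c)) (edge_list I)) e)"

definition pairs :: "edp_instance \<Rightarrow> (nat \<times> nat) set" where
  "pairs I = set (pair_list I)"

definition unit_capacity :: "edp_instance \<Rightarrow> bool" where
  "unit_capacity I \<longleftrightarrow> (\<forall>e \<in> edges I. capacity I e = 1)"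

definition unit_capacity_fvs :: "nat \<Rightarrow> edp_instance set" where
  "unit_capacity_fvs r =
     {I. valid_instance I \<and> unit_capacity I \<and> fvs_number (verts I) (edges I) = r}"

definition EDP :: "edp_instance \<Rightarrow> bool" where
  "EDP I \<longleftrightarrow> routable (verts I) (edges I) (capacity I) (pairs I)"

text \<open>The decision version of MaxEDP: can at least \<open>k\<close> of the terminal pairs be routed?\<close>

definition MaxEDP :: "edp_instance \<times> nat \<Rightarrow> bool" where
  "MaxEDP = (\<lambda>(I, k). k \<le> max_routable (verts I) (edges I) (capacity I) (pairs I))"

text \<open>
  Numbers are encoded in unary. For vertex names this is polynomially equivalent to binary,
  as the size of a graph is at least its number of vertices. A threshold exceeding the number
  of terminal pairs is trivial, and the capacities considered are 1.
\<close>

definition encode_nats :: "nat list \<Rightarrow> bool list" where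
  "encode_nats ns = concat (map (\<lambda>n. replicate n True @ [False]) ns)"

definition nats_of_instance :: "edp_instance \<Rightarrow> nat list" where
  "nats_of_instance I =
     order I # length (edge_list I) #
     concat (map (\<lambda>(u, v, c). [u, v, c]) (edge_list I)) @
     concat (map (\<lambda>(s, t). [s, t]) (pair_list I))"

definition encode_EDP :: "edp_instance \<Rightarrow> bool list" where
  "encode_EDP I = encode_nats (nats_of_instance I)"

definition encode_MaxEDP :: "edp_instance \<times> nat \<Rightarrow> bool list" where
  "encode_MaxEDP = (\<lambda>(I, k). encode_nats (k # nats_of_instance I))"

lemma replicate_True_False_inj:
  "replicate m True @ False # xs = replicate n True @ False # ys \<Longrightarrow> m = n \<and> xs = ys"
proof (induction m arbitrary: n)
  case 0
  then show ?case by (cases n) auto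
next
  case (Suc m)
  then show ?case by (cases n) auto
qed

lemma encode_nats_inj: "encode_nats ms = encode_nats ns \<Longrightarrow> ms = ns"
proof (induction ms arbitrary: ns)
  case Nil
  then show ?case by (cases ns) (auto simp: encode_nats_def)
next
  case (Cons m ms)
  then show ?case
    by (cases ns) (auto simp: encode_nats_def dest!: replicate_True_False_inj)
qed

lemma concat_triples_inj:
  "length es = length es' \<Longrightarrow>
   concat (map (\<lambda>(u, v, c). [u, v, c]) es) @ xs = concat (map (\<lambda>(u, v, c). [u, v, c]) es') @ ys \<Longrightarrow>
   es = es' \<and> xs = ys"
  by (induction es es' rule: list_induct2) auto

lemma concat_pairs_inj:
  "concat (map (\<lambda>(s, t). [s, t]) ps) = concat (map (\<lambda>(s, t). [s, t]) ps') \<Longrightarrow> ps = ps'"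
proof (induction ps arbitrary: ps')
  case Nil
  then show ?case by (cases ps') auto
next
  case (Cons p ps)
  then show ?case by (cases p; cases ps') auto
qed

lemma nats_of_instance_inj:
  "nats_of_instance I = nats_of_instance J \<Longrightarrow> I = (J :: edp_instance)"
  by (cases I; cases J) (auto simp: nats_of_instance_def dest!: concat_triples_inj concat_pairs_inj)

lemma inj_encode_EDP: "inj encode_EDP"
  by (auto intro!: injI dest!: encode_nats_inj nats_of_instance_inj simp: encode_EDP_def)

lemma inj_encode_MaxEDP: "inj encode_MaxEDP"
  by (auto intro!: injI dest!: encode_nats_inj nats_of_instance_inj simp: encode_MaxEDP_def)

end

theory Submission imports Defs begin

text \<open>
  An accepting run of a nondeterministic machine is a tiling of a space-time grid by finitely many tiles
  subject to local constraints. The grid is turned into a 3-colouring problem for a family of demands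
  between leaves in which every leaf meets exactly three demands or stubs (demands with a prescribed colour).
  The colouring becomes a routing problem in the complete bipartite graph between \<open>r\<close> hubs and the leaves,
  whose feedback vertex set number is \<open>r - 1\<close>: a demand of colour \<open>c\<close> is routed through hub \<open>c\<close>. Counting edges
  shows that no route can make a detour. With three hubs all demands have to be routed (EDP); with two
  hubs the third colour stands for not being routed (MaxEDP). The terminal pairs are listed by nested
  loops with polynomial bounds, which a machine with unary counters executes in polynomial time.
\<close>

text \<open>The exact number three of items at every leaf drives the construction. With three hubs
  the demands and stubs then have as many leaf ends as the graph has edges, so every edge is the
  first or last edge of some route and none is left for passing through a leaf. With two hubs the
  threshold can only be met by using up all edges in this way, which leaves out at most one item per
  leaf.

  Polynomial time has to be established for concrete Turing machines. This shapes the instance: it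
  must be printable by loops that neither compare numbers nor store data. Therefore the cells of the
  grid form one cyclic sequence, row after row, in which every neighbour relation is the addition of
  a fixed offset, with a border column cutting the wrap-around between rows. Cells subject to the
  same constraint form rectangles, and only the cells below the input word depend on its bits.
  Distinctness of the listed pairs is obtained by counting cells instead of comparing
  regions.\<close>

section \<open>Counter programs and their simulation by Turing machines\<close>

datatype com =
  Inc nat | Dec nat | Out bool | MvR | MvL | Seq com com | While nat com | WhileIn com | IfIn com com

type_synonym mstate = "(nat \<Rightarrow> nat) \<times> int \<times> bool list"

text \<open>The list of commands is the stack of what remains to be run. The empty stack is a fixed
  point, so the step function is total and idles after the end.\<close>

fun cstep :: "bool list \<Rightarrow> com list \<times> mstate \<Rightarrow> com list \<times> mstate" where
  "cstep x ([], s) = ([], s)"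
| "cstep x (Inc r # K, (\<rho>, i, out)) = (K, (\<rho>(r := Suc (\<rho> r)), i, out))"
| "cstep x (Dec r # K, (\<rho>, i, out)) = (K, (\<rho>(r := \<rho> r - 1), i, out))"
| "cstep x (Out b # K, (\<rho>, i, out)) = (K, (\<rho>, i, out @ [b]))"
| "cstep x (MvR # K, (\<rho>, i, out)) = (K, (\<rho>, i + 1, out))"
| "cstep x (MvL # K, (\<rho>, i, out)) = (K, (\<rho>, i - 1, out))"
| "cstep x (Seq a b # K, s) = (a # b # K, s)"
| "cstep x (While r c # K, (\<rho>, i, out)) = (if \<rho> r = 0 then K else c # While r c # K, (\<rho>, i, out))"
| "cstep x (WhileIn c # K, (\<rho>, i, out)) =
     (if string_content x i = 0 then K else c # WhileIn c # K, (\<rho>, i, out))"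
| "cstep x (IfIn a b # K, (\<rho>, i, out)) =
     ((if string_content x i = 2 then a else b) # K, (\<rho>, i, out))"

abbreviation stays :: "nat list \<Rightarrow> (nat \<times> int) list" where
  "stays ss \<equiv> map (\<lambda>s. (s, 0)) ss"

text \<open>The same step as seen by a machine with \<open>R + 2\<close> tapes: tape 0 is the input,
  tape \<open>Suc r\<close> is register \<open>r\<close>, and tape \<open>Suc R\<close> is the
  output. A register is zero iff its tape shows the symbol 1.\<close>

fun delta :: "nat \<Rightarrow> com list \<Rightarrow> nat list \<Rightarrow> com list \<times> (nat \<times> int) list" where
  "delta R [] ss = ([], stays ss)"
| "delta R (Inc r # K) ss = (K, (stays ss)[Suc r := (ss ! Suc r, 1)])"
| "delta R (Dec r # K) ss =
     (K, (stays ss)[Suc r := (ss ! Suc r, if ss ! Suc r = 1 then 0 else -1)])"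
| "delta R (Out b # K) ss = (K, (stays ss)[Suc R := (if b then 2 else 1, 1)])"
| "delta R (MvR # K) ss = (K, (stays ss)[0 := (ss ! 0, 1)])"
| "delta R (MvL # K) ss = (K, (stays ss)[0 := (ss ! 0, -1)])"
| "delta R (Seq a b # K) ss = (a # b # K, stays ss)"
| "delta R (While r c # K) ss =
     (if ss ! Suc r = 1 then K else c # While r c # K, stays ss)"
| "delta R (WhileIn c # K) ss = (if ss ! 0 = 0 then K else c # WhileIn c # K, stays ss)"
| "delta R (IfIn a b # K) ss = ((if ss ! 0 = 2 then a else b) # K, stays ss)"

text \<open>The stacks that can arise while the command runs on top of \<open>K\<close>. There are
  only finitely many, because a loop puts back the very command it was started from; so they can be
  the states of a machine.\<close>

fun conts :: "com \<Rightarrow> com list \<Rightarrow> com list set" where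
  "conts (Seq a b) K = {Seq a b # K} \<union> conts a (b # K) \<union> conts b K"
| "conts (While r c) K = {While r c # K, K} \<union> conts c (While r c # K)"
| "conts (WhileIn c) K = {WhileIn c # K, K} \<union> conts c (WhileIn c # K)"
| "conts (IfIn a b) K = {IfIn a b # K} \<union> conts a K \<union> conts b K"
| "conts c K = {c # K, K}"

fun regs :: "com \<Rightarrow> nat set" where
  "regs (Inc r) = {r}"
| "regs (Dec r) = {r}"
| "regs (Seq a b) = regs a \<union> regs b"
| "regs (While r c) = insert r (regs c)"
| "regs (WhileIn c) = regs c"
| "regs (IfIn a b) = regs a \<union> regs b"
| "regs c = {}"

lemma finite_regs: "finite (regs c)"
  by (induction c) auto

lemma finite_conts: "finite (conts c K)"
  by (induction c arbitrary: K) auto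

lemma in_conts: "c # K \<in> conts c K" "K \<in> conts c K"
  by (induction c arbitrary: K) auto

text \<open>Closure of the state set under transitions. A sub-command ends in the stack that was
  handed to it, which is where the next one begins, and \<open>in_conts\<close> puts both into the
  set. The final stack \<open>K\<close> is excluded, since a step from it belongs to the
  context.\<close>

lemma delta_conts: "K' \<in> conts c K \<Longrightarrow> K' \<noteq> K \<Longrightarrow> fst (delta R K' ss) \<in> conts c K"
proof (induction c arbitrary: K)
  case (Seq a b)
  show ?case
  proof (cases "K' \<in> conts a (b # K) \<and> K' \<noteq> b # K")
    case True
    then show ?thesis using Seq.IH(1) by auto
  next
    case False
    then consider "K' = Seq a b # K" | "K' = b # K" | "K' \<in> conts b K"
      using Seq.prems by auto
    then show ?thesis
      using Seq.IH(2)[of K] Seq.prems(2) in_conts by cases auto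
  qed
next
  case (While r c)
  show ?case
  proof (cases "K' \<in> conts c (While r c # K) \<and> K' \<noteq> While r c # K")
    case True
    then show ?thesis using While.IH by auto
  next
    case False
    then have "K' = While r c # K" using While.prems by auto
    then show ?thesis using in_conts(1)[of c "While r c # K"] by simp
  qed
next
  case (WhileIn c)
  show ?case
  proof (cases "K' \<in> conts c (WhileIn c # K) \<and> K' \<noteq> WhileIn c # K")
    case True
    then show ?thesis using WhileIn.IH by auto
  next
    case False
    then have "K' = WhileIn c # K" using WhileIn.prems by auto
    then show ?thesis using in_conts(1)[of c "WhileIn c # K"] by simp
  qed
next
  case (IfIn a b)
  then show ?case using in_conts by auto
qed auto

lemma conts_regs: "K' \<in> conts c K \<Longrightarrow> \<Union>(regs ` set K') \<subseteq> regs c \<union> \<Union>(regs ` set K)"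
proof (induction c arbitrary: K)
  case (Seq a b)
  then show ?case using Seq.IH(1)[of "b # K"] Seq.IH(2)[of K] by auto
next
  case (While r c)
  then show ?case using While.IH[of "While r c # K"] by auto
next
  case (WhileIn c)
  then show ?case using WhileIn.IH[of "WhileIn c # K"] by auto
next
  case (IfIn a b)
  then show ?case using IfIn.IH(1)[of K] IfIn.IH(2)[of K] by auto
qed auto

lemma delta_wf:
  assumes "length ss = k" "set ss \<subseteq> {..<3}"
  shows "length (snd (delta R K ss)) = k \<and> set (snd (delta R K ss)) \<subseteq> {..<3} \<times> {-1, 0, 1}"
proof -
  have upd: "set ((stays ss)[i := a]) \<subseteq> {..<3} \<times> {-1, 0, 1}"
    if "i < length ss \<Longrightarrow> a \<in> {..<3} \<times> {-1, 0, 1}" for i a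
  proof (cases "i < length ss")
    case True
    then show ?thesis using that assms(2) set_update_subset_insert[of "stays ss" i a] by fastforce
  next
    case False
    then show ?thesis using assms(2) by (auto simp: list_update_beyond)
  qed
  have st: "set (stays ss) \<subseteq> {..<3} \<times> {-1, 0, 1}"
    using assms(2) by auto
  have nth: "i < length ss \<Longrightarrow> ss ! i < 3" for i
    using assms(2) nth_mem by blast
  show ?thesis
    using assms(1) nth st
    by (cases "(R, K, ss)" rule: delta.cases) (simp_all only: delta.simps snd_conv length_list_update length_map, simp_all add: upd)
qed

text \<open>A register is a tape whose cell 0 carries a marker; its value is the head position.\<close>

definition reg_tape :: "nat \<Rightarrow> tape" where
  "reg_tape v = ((\<lambda>i. if i = 0 then 1 else 0), int v)"

fun mtape :: "nat \<Rightarrow> bool list \<Rightarrow> mstate \<Rightarrow> nat \<Rightarrow> tape" where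
  "mtape R x (\<rho>, i, out) k =
     (if k = 0 then (string_content x, i)
      else if k \<le> R then reg_tape (\<rho> (k - 1))
      else (string_content out, int (length out)))"

definition mtapes :: "nat \<Rightarrow> bool list \<Rightarrow> mstate \<Rightarrow> tape list" where
  "mtapes R x s = map (mtape R x s) [0..<R + 2]"

lemma act_stay: "act (scan t, 0) t = t"
  by (cases t) (simp add: act_def scan_def)

lemma act_scan: "act (scan t, d) t = (fst t, snd t + d)"
  by (cases t) (simp add: act_def scan_def)

lemma string_content_snoc:
  "(string_content out)(int (length out) := if b then 2 else 1) = string_content (out @ [b])"
  by (auto simp: string_content_def fun_eq_iff nth_append nat_eq_iff)

lemma scan_reg_tape: "scan (reg_tape v) = (if v = 0 then 1 else 0)"
  by (simp add: scan_def reg_tape_def)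

text \<open>At value 0 the head scans the marker and stays, which matches truncated
  subtraction.\<close>

lemma act_dec_reg_tape:
  "scan (reg_tape v) = Suc 0 \<Longrightarrow> act (Suc 0, 0) (reg_tape v) = reg_tape (v - Suc 0)"
  "scan (reg_tape v) \<noteq> Suc 0 \<Longrightarrow> act (scan (reg_tape v), -1) (reg_tape v) = reg_tape (v - Suc 0)"
proof -
  assume *: "scan (reg_tape v) = Suc 0"
  then have "v = 0" by (simp add: scan_reg_tape split: if_splits)
  then show "act (Suc 0, 0) (reg_tape v) = reg_tape (v - Suc 0)"
    using act_stay[of "reg_tape v"] * by simp
next
  assume "scan (reg_tape v) \<noteq> Suc 0"
  then have "v > 0" by (simp add: scan_reg_tape split: if_splits)
  then show "act (scan (reg_tape v), -1) (reg_tape v) = reg_tape (v - Suc 0)"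
    by (simp add: act_scan) (simp add: reg_tape_def of_nat_diff)
qed

lemma map2_act_eqI:
  assumes "length as = R + 2"
    "\<And>k. k < R + 2 \<Longrightarrow> act (as ! k) (mtape R x s k) = mtape R x s' k"
  shows "map2 act as (mtapes R x s) = mtapes R x s'"
  by (rule nth_equalityI) (use assms in \<open>auto simp: mtapes_def simp del: upt_Suc\<close>)

text \<open>A command touches at most one tape; all others receive the action that rewrites the
  scanned symbol and are fixed by \<open>act_stay\<close>.\<close>

lemma delta_cstep:
  assumes "K \<noteq> []" "\<Union>(regs ` set K) \<subseteq> {..<R}"
  shows "fst (delta R K (map scan (mtapes R x s))) = fst (cstep x (K, s)) \<and>
    map2 act (snd (delta R K (map scan (mtapes R x s)))) (mtapes R x s)
      = mtapes R x (snd (cstep x (K, s)))"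
proof -
  obtain \<rho> i out where s: "s = (\<rho>, i, out)" by (cases s)
  let ?t = "mtape R x (\<rho>, i, out)"
  have ss: "map scan (mtapes R x s) = map (\<lambda>k. scan (?t k)) [0..<R + 2]"
    by (simp add: mtapes_def s)
  have stays: "map2 act (stays (map scan (mtapes R x s))) (mtapes R x s) = mtapes R x s"
    by (rule map2_act_eqI) (auto simp: s mtapes_def act_stay simp del: upt_Suc mtape.simps)
  have len: "length (map scan (mtapes R x s)) = R + 2" by (simp add: mtapes_def)
  have nth: "map scan (mtapes R x s) ! k = scan (?t k)" if "k < R + 2" for k
    using that by (simp add: ss del: upt_Suc mtape.simps)
  obtain c K' where K: "K = c # K'" using assms(1) by (cases K) auto
  show ?thesis
  proof (cases c)
    case (Inc r)
    then have "r < R" using assms K by auto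
    then show ?thesis unfolding K Inc
      by (auto simp: s intro!: map2_act_eqI)
         (auto simp: mtapes_def nth_list_update act_stay act_scan reg_tape_def simp del: upt_Suc)
  next
    case (Dec r)
    then have "r < R" using assms K by auto
    then show ?thesis unfolding K Dec
      by (auto simp: s intro!: map2_act_eqI)
         (auto simp: mtapes_def nth_list_update act_stay act_dec_reg_tape simp del: upt_Suc)
  next
    case (Out b)
    have "act (if b then 2 else 1, 1) (string_content out, int (length out))
      = (string_content (out @ [b]), int (length (out @ [b])))"
      using string_content_snoc[of out b] by (simp add: act_def)
    then show ?thesis unfolding K Out
      by (auto simp: s intro!: map2_act_eqI)
         (auto simp: mtapes_def nth_list_update act_stay simp del: upt_Suc split: if_splits)
  next
    case MvR
    show ?thesis unfolding K MvR
      by (auto simp: s intro!: map2_act_eqI)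
         (auto simp: mtapes_def nth_list_update act_stay act_scan simp del: upt_Suc)
  next
    case MvL
    show ?thesis unfolding K MvL
      by (auto simp: s intro!: map2_act_eqI)
         (auto simp: mtapes_def nth_list_update act_stay act_scan simp del: upt_Suc)
  next
    case (Seq a b)
    then show ?thesis using stays by (simp add: K s)
  next
    case (While r c')
    then have "r < R" using assms K by auto
    then have "map scan (mtapes R x s) ! Suc r = scan (reg_tape (\<rho> r))"
      by (subst nth) auto
    then show ?thesis using stays While by (simp add: K s scan_reg_tape)
  next
    case (WhileIn c')
    have "map scan (mtapes R x s) ! 0 = string_content x i"
      by (subst nth) (auto simp: scan_def)
    then show ?thesis using stays WhileIn by (simp add: K s)
  next
    case (IfIn a b)
    have "map scan (mtapes R x s) ! 0 = string_content x i"
      by (subst nth) (auto simp: scan_def)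
    then show ?thesis using stays IfIn by (simp add: K s)
  qed
qed

text \<open>Stacks are numbered by \<open>idx\<close>. The extra state
  \<open>card (conts c [])\<close> is the start state: its single step writes the marker into cell 0
  of every register tape, since these tapes are blank at first. The empty stack has no transition,
  which makes the machine halt there.\<close>

definition com_tm :: "nat \<Rightarrow> com \<Rightarrow> (com list \<Rightarrow> nat) \<Rightarrow> tm" where
  "com_tm R c idx =
     \<lparr>tapes = R + 2, symbols = 3, states = Suc (card (conts c [])), start = card (conts c []),
      accept = 0,
      trans = (\<lambda>q ss.
        if q = card (conts c [])
        then {(idx [c], (ss ! 0, 0) # replicate R (1, 0) @ [(ss ! Suc R, 0)])}
        else if q < card (conts c []) \<and> inv_into (conts c []) idx q \<noteq> []
        then {(idx (fst (delta R (inv_into (conts c []) idx q) ss)),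
               snd (delta R (inv_into (conts c []) idx q) ss))}
        else {})\<rparr>"

lemma wf_com_tm:
  assumes "bij_betw idx (conts c []) {..<card (conts c [])}"
  shows "wf_tm (com_tm R c idx)"
proof -
  let ?S = "conts c []" and ?n = "card (conts c [])"
  have idx: "K \<in> ?S \<Longrightarrow> idx K < ?n" for K
    using assms by (auto simp: bij_betw_def)
  have inv: "q < ?n \<Longrightarrow> inv_into ?S idx q \<in> ?S" for q
    using assms by (intro inv_into_into) (auto simp: bij_betw_def)
  have "q' < Suc ?n \<and> length as = R + 2 \<and> set as \<subseteq> {..<3} \<times> {-1, 0, 1}"
    if len: "length ss = R + 2" and ss: "set ss \<subseteq> {..<3}"
      and tr: "(q', as) \<in> trans (com_tm R c idx) q ss" for q ss q' as
  proof (cases "q = ?n")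
    case True
    have "ss ! 0 < 3" "ss ! Suc R < 3" using ss len nth_mem by (metis One_nat_def add_2_eq_Suc' lessI lessThan_iff subsetD zero_less_Suc)+
    then show ?thesis using tr True in_conts idx[of "[c]"]
      by (auto simp: com_tm_def)
  next
    case False
    let ?K = "inv_into ?S idx q"
    have K: "q < ?n" "?K \<noteq> []" and eq: "q' = idx (fst (delta R ?K ss))" "as = snd (delta R ?K ss)"
      using tr False by (auto simp: com_tm_def split: if_splits)
    have "q' < ?n" unfolding eq by (intro idx delta_conts inv K)
    then show ?thesis using delta_wf[OF len ss, of R ?K] eq by auto
  qed
  then show ?thesis by (auto simp: wf_tm_def com_tm_def)
qed

lemma deterministic_com_tm: "deterministic (com_tm R c idx)"
  by (auto simp: deterministic_def com_tm_def)

lemma com_tm_step: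
  assumes bij: "bij_betw idx (conts c []) {..<card (conts c [])}"
    and K: "K \<in> conts c []" and R: "regs c \<subseteq> {..<R}" and ne: "K \<noteq> []"
  shows "fst (cstep x (K, s)) \<in> conts c [] \<and>
    step (com_tm R c idx) (idx K, mtapes R x s)
      (idx (fst (cstep x (K, s))), mtapes R x (snd (cstep x (K, s))))"
proof -
  let ?S = "conts c []" and ?n = "card (conts c [])" and ?ss = "map scan (mtapes R x s)"
  have idx: "idx K < ?n" and inv: "inv_into ?S idx (idx K) = K"
    using bij K by (auto simp: bij_betw_def)
  have "\<Union>(regs ` set K) \<subseteq> {..<R}" using conts_regs[OF K] R by auto
  note d = delta_cstep[OF ne this, of x s]
  have "trans (com_tm R c idx) (idx K) ?ss = {(idx (fst (delta R K ?ss)), snd (delta R K ?ss))}"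
    using idx inv ne by (simp add: com_tm_def)
  then have "step (com_tm R c idx) (idx K, mtapes R x s)
      (idx (fst (cstep x (K, s))), mtapes R x (snd (cstep x (K, s))))"
    using d by (auto simp: step_def)
  then show ?thesis using delta_conts[OF K ne, of R ?ss] d by simp
qed

lemma com_tm_halted:
  assumes bij: "bij_betw idx (conts c []) {..<card (conts c [])}"
  shows "halted (com_tm R c idx) (idx [], ts)"
proof -
  have "idx [] < card (conts c [])" "inv_into (conts c []) idx (idx []) = []"
    using bij in_conts(2)[of "[]" c] by (auto simp: bij_betw_def)
  then show ?thesis by (auto simp: halted_def step_def com_tm_def)
qed

text \<open>The machine may take fewer than \<open>t\<close> steps, because \<open>cstep\<close>
  idles on the empty stack whereas the machine halts.\<close>

lemma com_tm_steps:
  assumes bij: "bij_betw idx (conts c []) {..<card (conts c [])}"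
    and R: "regs c \<subseteq> {..<R}"
    and "K \<in> conts c []" "(cstep x ^^ t) (K, s) = ([], s')"
  shows "\<exists>t'\<le>t. (step (com_tm R c idx) ^^ t') (idx K, mtapes R x s) (idx [], mtapes R x s')"
  using assms(3-)
proof (induction t arbitrary: K s)
  case 0
  then show ?case by (intro exI[of _ 0]) auto
next
  case (Suc t)
  show ?case
  proof (cases "K = []")
    case True
    have "(cstep x ^^ n) ([], s) = ([], s)" for n by (induction n) auto
    then show ?thesis using Suc.prems True by (intro exI[of _ 0]) auto
  next
    case False
    obtain K' s1 where c: "cstep x (K, s) = (K', s1)" by (cases "cstep x (K, s)")
    have st: "K' \<in> conts c []" "step (com_tm R c idx) (idx K, mtapes R x s) (idx K', mtapes R x s1)"
      using com_tm_step[OF bij Suc.prems(1) R False, of x s] c by auto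
    have "(cstep x ^^ t) (K', s1) = ([], s')"
      using Suc.prems(2) c by (simp add: funpow_swap1)
    from Suc.IH[OF st(1) this] obtain t' where "t' \<le> t"
      "(step (com_tm R c idx) ^^ t') (idx K', mtapes R x s1) (idx [], mtapes R x s')" by blast
    then show ?thesis using st(2) by (intro exI[of _ "Suc t'"]) (auto intro: relpowp_Suc_I2 simp del: relpowp.simps)
  qed
qed

lemma com_tm_init:
  "step (com_tm R c idx) (init_config (com_tm R c idx) x) (idx [c], mtapes R x (\<lambda>_. 0, 0, []))"
proof -
  let ?M = "com_tm R c idx"
  let ?ts = "(string_content x, 0) # replicate (R + 1) (string_content [], 0)"
  let ?ss = "map scan ?ts"
  have mark: "(string_content [])(0 := 1) = fst (reg_tape 0)" "snd (reg_tape 0) = 0"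
    by (auto simp: string_content_def reg_tape_def)
  have "map2 act ((?ss ! 0, 0) # replicate R (1, 0) @ [(?ss ! Suc R, 0)]) ?ts
    = mtapes R x (\<lambda>_. 0, 0, [])"
  proof (rule nth_equalityI)
    fix k assume "k < length (map2 act ((?ss ! 0, 0) # replicate R (1, 0) @ [(?ss ! Suc R, 0)]) ?ts)"
    then have "k < R + 2" by simp
    then consider "k = 0" | k' where "k = Suc k'" "k' < R" | "k = Suc R"
      by (metis add_2_eq_Suc' less_Suc_eq not0_implies_Suc Suc_less_eq)
    then show "map2 act ((?ss ! 0, 0) # replicate R (1, 0) @ [(?ss ! Suc R, 0)]) ?ts ! k
      = mtapes R x (\<lambda>_. 0, 0, []) ! k"
      using mark
      by cases (auto simp: mtapes_def nth_append nth_Cons' scan_def act_def prod_eq_iff simp del: upt_Suc)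
  qed (simp add: mtapes_def)
  moreover have "init_config ?M x = (card (conts c []), ?ts)"
    by (simp add: init_config_def com_tm_def)
  ultimately show ?thesis
    by (auto simp: step_def com_tm_def)
qed

theorem com_poly_time:
  fixes p :: "nat poly"
  assumes "\<And>x. \<exists>t \<rho> i. (cstep x ^^ t) ([c], (\<lambda>_. 0, 0, [])) = ([], (\<rho>, i, f x)) \<and> t \<le> poly p (length x)"
  shows "poly_time_computable f"
proof -
  obtain R where R: "regs c \<subseteq> {..<R}"
    using finite_regs[of c] finite_nat_iff_bounded by blast
  obtain idx where bij: "bij_betw idx (conts c []) {..<card (conts c [])}"
    using ex_bij_betw_finite_nat[OF finite_conts, of c "[]"] atLeast0LessThan by auto
  let ?M = "com_tm R c idx"
  \<comment> \<open>The additional step is the one that writes the markers.\<close>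
  have "\<exists>t cf. t \<le> poly (p + [:1:]) (length x) \<and> (step ?M ^^ t) (init_config ?M x) cf \<and>
      halted ?M cf \<and> fst (last (snd cf)) = string_content (f x)" for x
  proof -
    obtain t \<rho> i where t: "(cstep x ^^ t) ([c], (\<lambda>_. 0, 0, [])) = ([], (\<rho>, i, f x))"
      "t \<le> poly p (length x)" using assms by blast
    obtain t' where t': "t' \<le> t"
      "(step ?M ^^ t') (idx [c], mtapes R x (\<lambda>_. 0, 0, [])) (idx [], mtapes R x (\<rho>, i, f x))"
      using com_tm_steps[OF bij R in_conts(1) t(1)] by blast
    have "(step ?M ^^ Suc t') (init_config ?M x) (idx [], mtapes R x (\<rho>, i, f x))"
      using com_tm_init t'(2) by (rule relpowp_Suc_I2)
    moreover have "fst (last (mtapes R x (\<rho>, i, f x))) = string_content (f x)"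
      by (simp add: mtapes_def)
    ultimately show ?thesis using com_tm_halted[OF bij] t' t(2)
      by (intro exI[of _ "Suc t'"] exI[of _ "(idx [], mtapes R x (\<rho>, i, f x))"]) auto
  qed
  then show ?thesis
    using wf_com_tm[OF bij] deterministic_com_tm unfolding poly_time_computable_def by blast
qed

section \<open>Compositional running times of programs\<close>

text \<open>The number of steps is the same for all continuations \<open>K\<close>, so runs can be
  chained exactly; \<open>B\<close> merely bounds it, so bounds can be weakened freely.\<close>

definition exec :: "bool list \<Rightarrow> com \<Rightarrow> mstate \<Rightarrow> nat \<Rightarrow> mstate \<Rightarrow> bool" where
  "exec x c s B s' \<longleftrightarrow> (\<exists>t\<le>B. \<forall>K. (cstep x ^^ t) (c # K, s) = (K, s'))"

lemma exec_mono: "exec x c s B s' \<Longrightarrow> B \<le> B' \<Longrightarrow> exec x c s B' s'"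
  unfolding exec_def by (meson le_trans)

lemma exec_1: "(\<And>K. cstep x (c # K, s) = (K, s')) \<Longrightarrow> exec x c s 1 s'"
  unfolding exec_def by (intro exI[of _ 1]) auto

text \<open>Common core of the rules for sequences, loops and branches: one administrative step
  pushes \<open>a\<close> on top of the commands \<open>b\<close> that are still to follow.\<close>

lemma exec_trans:
  assumes "\<And>K. cstep x (c # K, s) = (a # b @ K, s)"
    "exec x a s B s1" "\<exists>t\<le>B'. \<forall>K. (cstep x ^^ t) (b @ K, s1) = (K, s2)"
  shows "exec x c s (Suc (B + B')) s2"
proof -
  obtain t where t: "t \<le> B" "\<And>K. (cstep x ^^ t) (a # K, s) = (K, s1)"
    using assms(2) unfolding exec_def by blast
  obtain u where u: "u \<le> B'" "\<And>K. (cstep x ^^ u) (b @ K, s1) = (K, s2)"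
    using assms(3) by blast
  have "(cstep x ^^ (u + (t + 1))) (c # K, s) = (K, s2)" for K
    by (subst funpow_add, subst funpow_add) (simp add: assms(1) t(2) u(2))
  then show ?thesis unfolding exec_def using t(1) u(1)
    by (intro exI[of _ "u + (t + 1)"]) auto
qed

lemma exec_Seq:
  assumes "exec x a s B s1" "exec x b s1 B' s2" "Suc (B + B') \<le> B''"
  shows "exec x (Seq a b) s B'' s2"
proof -
  have "exec x (Seq a b) s (Suc (B + B')) s2"
    by (rule exec_trans[where b = "[b]"]) (use assms in \<open>auto simp: exec_def\<close>)
  then show ?thesis using assms(3) exec_mono by blast
qed

lemma exec_While_0: "\<rho> r = 0 \<Longrightarrow> exec x (While r c) (\<rho>, i, out) 1 (\<rho>, i, out)"
  by (rule exec_1) simp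

lemma exec_While_Suc:
  assumes "\<rho> r \<noteq> 0" "exec x c (\<rho>, i, out) B s1" "exec x (While r c) s1 B' s2" "Suc (B + B') \<le> B''"
  shows "exec x (While r c) (\<rho>, i, out) B'' s2"
proof -
  have "exec x (While r c) (\<rho>, i, out) (Suc (B + B')) s2"
    by (rule exec_trans[where b = "[While r c]"]) (use assms in \<open>auto simp: exec_def\<close>)
  then show ?thesis using assms(4) exec_mono by blast
qed

lemma exec_WhileIn_0: "string_content x i = 0 \<Longrightarrow> exec x (WhileIn c) (\<rho>, i, out) 1 (\<rho>, i, out)"
  by (rule exec_1) simp

lemma exec_WhileIn_Suc:
  assumes "string_content x i \<noteq> 0" "exec x c (\<rho>, i, out) B s1" "exec x (WhileIn c) s1 B' s2"
    "Suc (B + B') \<le> B''"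
  shows "exec x (WhileIn c) (\<rho>, i, out) B'' s2"
proof -
  have "exec x (WhileIn c) (\<rho>, i, out) (Suc (B + B')) s2"
    by (rule exec_trans[where b = "[WhileIn c]"]) (use assms in \<open>auto simp: exec_def\<close>)
  then show ?thesis using assms(4) exec_mono by blast
qed

lemma exec_IfIn:
  assumes "exec x (if string_content x i = 2 then a else b) (\<rho>, i, out) B s2"
  shows "exec x (IfIn a b) (\<rho>, i, out) (Suc B) s2"
proof -
  have "exec x (IfIn a b) (\<rho>, i, out) (Suc (B + 0)) s2"
    by (rule exec_trans[where b = "[]"]) (use assms in \<open>auto simp: exec_def\<close>)
  then show ?thesis by simp
qed

lemma exec_basic:
  "exec x (Inc r) (\<rho>, i, out) 1 (\<rho>(r := Suc (\<rho> r)), i, out)"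
  "exec x (Dec r) (\<rho>, i, out) 1 (\<rho>(r := \<rho> r - 1), i, out)"
  "exec x (Out b) (\<rho>, i, out) 1 (\<rho>, i, out @ [b])"
  "exec x MvR (\<rho>, i, out) 1 (\<rho>, i + 1, out)"
  "exec x MvL (\<rho>, i, out) 1 (\<rho>, i - 1, out)"
  by (rule exec_1, simp)+

section \<open>Loops whose bounds are arithmetic expressions\<close>

datatype exp = Num nat | Var nat | Add exp exp | Mul exp exp

primrec eval :: "exp \<Rightarrow> (nat \<Rightarrow> nat) \<Rightarrow> nat" where
  "eval (Num n) \<sigma> = n"
| "eval (Var v) \<sigma> = \<sigma> v"
| "eval (Add a b) \<sigma> = eval a \<sigma> + eval b \<sigma>"
| "eval (Mul a b) \<sigma> = eval a \<sigma> * eval b \<sigma>"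

primrec vars :: "exp \<Rightarrow> nat set" where
  "vars (Num n) = {}"
| "vars (Var v) = {v}"
| "vars (Add a b) = vars a \<union> vars b"
| "vars (Mul a b) = vars a \<union> vars b"

text \<open>The number of scratch registers that are busy while the body of a repetition runs: a
  product nests two loops, whereas a sum runs them one after the other.\<close>

primrec width :: "exp \<Rightarrow> nat" where
  "width (Num n) = 0"
| "width (Var v) = 1"
| "width (Add a b) = max (width a) (width b)"
| "width (Mul a b) = width a + width b"

text \<open>\<open>Seq (Inc 0) (Dec 0)\<close> serves as the command that does nothing; its three
  steps are the constant 3 in \<open>rept_cost\<close>.\<close>

primrec reptn :: "nat \<Rightarrow> com \<Rightarrow> com" where
  "reptn 0 c = Seq (Inc 0) (Dec 0)"
| "reptn (Suc n) c = Seq c (reptn n c)"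

text \<open>Registers \<open>\<ge> d\<close> are scratch registers for \<open>rept e c d\<close>.
  The body \<open>c\<close> may only use the ones \<open>\<ge> d + width e\<close>.\<close>

primrec rept :: "exp \<Rightarrow> com \<Rightarrow> nat \<Rightarrow> com" where
  "rept (Num n) c d = reptn n c"
| "rept (Var v) c d =
     Seq (While v (Seq (Dec v) (Inc (Suc d))))
       (Seq (While (Suc d) (Seq (Dec (Suc d)) (Seq (Inc v) (Inc d))))
         (While d (Seq (Dec d) c)))"
| "rept (Add a b) c d = Seq (rept a c d) (rept b c d)"
| "rept (Mul a b) c d = rept a (rept b c (d + width a)) d"

text \<open>\<open>B\<close> bounds the variables and \<open>T\<close> the cost of the body. For a
  variable, the three loops take at most \<open>4 B + 1\<close>, \<open>6 B + 1\<close> and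
  \<open>B (T + 3) + 1\<close> steps, and the two sequences add 2.\<close>

primrec rept_cost :: "exp \<Rightarrow> nat \<Rightarrow> nat \<Rightarrow> nat" where
  "rept_cost (Num n) B T = n * (T + 1) + 3"
| "rept_cost (Var v) B T = B * (T + 13) + 5"
| "rept_cost (Add a b) B T = rept_cost a B T + rept_cost b B T + 1"
| "rept_cost (Mul a b) B T = rept_cost a B (rept_cost b B T)"

lemma eval_cong: "(\<And>v. v \<in> vars e \<Longrightarrow> \<sigma> v = \<sigma>' v) \<Longrightarrow> eval e \<sigma> = eval e \<sigma>'"
  by (induction e) auto

lemma eval_mono: "(\<And>v. v \<in> vars e \<Longrightarrow> \<sigma> v \<le> \<sigma>' v) \<Longrightarrow> eval e \<sigma> \<le> eval e \<sigma>'"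
  by (induction e) (auto intro!: add_mono mult_le_mono)

text \<open>The invariant that lets loops be nested: the command advances the index register
  \<open>d\<close> from \<open>k\<close> to \<open>k + q\<close> and prints the words belonging to
  the indices it passes. The index is incremented by the innermost body only, so enclosing
  repetitions merely multiply \<open>q\<close>. Registers below \<open>d\<close> hold the outer
  variables; those strictly between \<open>d\<close> and \<open>D\<close> are reserved for inner
  variables and are zero; those from \<open>D\<close> up to \<open>\<tau>\<close> may be busy as
  scratch registers of enclosing loops; those from \<open>\<tau>\<close> on are free and
  zero.\<close>

definition is_body ::
  "bool list \<Rightarrow> nat \<Rightarrow> nat \<Rightarrow> (nat \<Rightarrow> nat) \<Rightarrow> nat \<Rightarrow> (nat \<Rightarrow> bool list) \<Rightarrow> nat \<Rightarrow> com \<Rightarrow> nat \<Rightarrow> nat \<Rightarrow> bool" where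
  "is_body x D d \<sigma> M w q c \<tau> T \<longleftrightarrow> (\<forall>\<rho> k i out.
     (\<forall>r<d. \<rho> r = \<sigma> r) \<longrightarrow> (\<forall>r. d < r \<and> r < D \<or> \<tau> \<le> r \<longrightarrow> \<rho> r = 0) \<longrightarrow> k + q \<le> M \<longrightarrow>
     exec x c (\<rho>(d := k), i, out) T (\<rho>(d := k + q), i, out @ concat (map w [k..<k + q])))"

lemma is_bodyD:
  "is_body x D d \<sigma> M w q c \<tau> T \<Longrightarrow> \<forall>r<d. \<rho> r = \<sigma> r \<Longrightarrow>
    \<forall>r. d < r \<and> r < D \<or> \<tau> \<le> r \<longrightarrow> \<rho> r = 0 \<Longrightarrow> k + q \<le> M \<Longrightarrow>
    exec x c (\<rho>(d := k), i, out) T (\<rho>(d := k + q), i, out @ concat (map w [k..<k + q]))"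
  unfolding is_body_def by blast

lemma is_body_seq:
  assumes "is_body x D d \<sigma> M w q c \<tau> T" "is_body x D d \<sigma> M w q' c' \<tau> T'"
  shows "is_body x D d \<sigma> M w (q + q') (Seq c c') \<tau> (T + T' + 1)"
  unfolding is_body_def
proof (intro allI impI)
  fix \<rho> :: "nat \<Rightarrow> nat" and k i out
  assume a: "\<forall>r<d. \<rho> r = \<sigma> r" "\<forall>r. d < r \<and> r < D \<or> \<tau> \<le> r \<longrightarrow> \<rho> r = 0" "k + (q + q') \<le> M"
  have "exec x c (\<rho>(d := k), i, out) T (\<rho>(d := k + q), i, out @ concat (map w [k..<k + q]))"
    by (rule is_bodyD[OF assms(1) a(1,2)]) (use a(3) in simp)
  moreover have "exec x c' (\<rho>(d := k + q), i, out @ concat (map w [k..<k + q])) T'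
     (\<rho>(d := (k + q) + q'), i, (out @ concat (map w [k..<k + q])) @ concat (map w [k + q..<(k + q) + q']))"
    by (rule is_bodyD[OF assms(2) a(1,2)]) (use a(3) in simp)
  moreover have "[k..<k + (q + q')] = [k..<k + q] @ [k + q..<(k + q) + q']"
    using upt_add_eq_append[of k "k + q" q'] by (simp add: add.assoc)
  ultimately show "exec x (Seq c c') (\<rho>(d := k), i, out) (T + T' + 1)
     (\<rho>(d := k + (q + q')), i, out @ concat (map w [k..<k + (q + q')]))"
    by (auto intro: exec_Seq simp: add.assoc)
qed

lemma is_body_skip: "is_body x D d \<sigma> M w 0 (Seq (Inc 0) (Dec 0)) \<tau> 3"
  unfolding is_body_def
proof (intro allI impI)
  fix \<rho> :: "nat \<Rightarrow> nat" and k i out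
  let ?\<rho> = "\<rho>(d := k)"
  have "exec x (Seq (Inc 0) (Dec 0)) (?\<rho>, i, out) 3
     ((?\<rho>(0 := Suc (?\<rho> 0)))(0 := (?\<rho>(0 := Suc (?\<rho> 0))) 0 - 1), i, out)"
    by (rule exec_Seq[OF exec_basic(1) exec_basic(2)]) simp
  also have "(?\<rho>(0 := Suc (?\<rho> 0)))(0 := (?\<rho>(0 := Suc (?\<rho> 0))) 0 - 1) = ?\<rho>" by auto
  finally show "exec x (Seq (Inc 0) (Dec 0)) (\<rho>(d := k), i, out) 3
     (\<rho>(d := k + 0), i, out @ concat (map w [k..<k + 0]))" by (simp del: fun_upd_apply)
qed

lemma is_body_reptn:
  assumes "is_body x D d \<sigma> M w q c \<tau> T"
  shows "is_body x D d \<sigma> M w (q * n) (reptn n c) \<tau> (n * (T + 1) + 3)"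
proof (induction n)
  case 0
  then show ?case using is_body_skip by simp
next
  case (Suc n)
  have "is_body x D d \<sigma> M w (q + q * n) (Seq c (reptn n c)) \<tau> (T + (n * (T + 1) + 3) + 1)"
    by (rule is_body_seq[OF assms Suc])
  then show ?case by (simp add: add_ac)
qed

lemma exec_move:
  assumes "v \<noteq> u"
  shows "exec x (While v (Seq (Dec v) (Inc u))) (\<rho>, i, out) (4 * \<rho> v + 1)
    (\<rho>(v := 0, u := \<rho> u + \<rho> v), i, out)"
proof (induction "\<rho> v" arbitrary: \<rho>)
  case 0
  then have eq: "\<rho>(v := 0, u := \<rho> u + \<rho> v) = \<rho>" by (auto simp: fun_eq_iff)
  show ?case unfolding eq using exec_mono[OF exec_While_0[of \<rho> v]] 0 by auto
next
  case (Suc n)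
  let ?\<rho> = "\<rho>(v := \<rho> v - 1, u := Suc (\<rho> u))"
  have "exec x (Seq (Dec v) (Inc u)) (\<rho>, i, out) 3 (?\<rho>, i, out)"
    using exec_Seq[OF exec_basic(2)[of x v \<rho> i out] exec_basic(1)[of x u _ i out], of 3] assms by simp
  moreover have "exec x (While v (Seq (Dec v) (Inc u))) (?\<rho>, i, out) (4 * ?\<rho> v + 1)
    (?\<rho>(v := 0, u := ?\<rho> u + ?\<rho> v), i, out)"
    by (rule Suc(1)) (use assms Suc(2) in auto)
  ultimately have "exec x (While v (Seq (Dec v) (Inc u))) (\<rho>, i, out) (4 * \<rho> v + 1)
    (?\<rho>(v := 0, u := ?\<rho> u + ?\<rho> v), i, out)"
    by (rule exec_While_Suc[rotated]) (use assms Suc(2) in auto)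
  moreover have "?\<rho>(v := 0, u := ?\<rho> u + ?\<rho> v) = \<rho>(v := 0, u := \<rho> u + \<rho> v)"
    using assms Suc(2) by (auto simp: fun_eq_iff)
  ultimately show ?case by simp
qed

lemma exec_move2:
  assumes "u \<noteq> v" "u \<noteq> d" "v \<noteq> d"
  shows "exec x (While u (Seq (Dec u) (Seq (Inc v) (Inc d)))) (\<rho>, i, out) (6 * \<rho> u + 1)
    (\<rho>(u := 0, v := \<rho> v + \<rho> u, d := \<rho> d + \<rho> u), i, out)"
proof (induction "\<rho> u" arbitrary: \<rho>)
  case 0
  then have eq: "\<rho>(u := 0, v := \<rho> v + \<rho> u, d := \<rho> d + \<rho> u) = \<rho>" by (auto simp: fun_eq_iff)
  show ?case unfolding eq using exec_mono[OF exec_While_0[of \<rho> u]] 0 by auto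
next
  case (Suc n)
  let ?\<rho> = "\<rho>(u := \<rho> u - 1, v := Suc (\<rho> v), d := Suc (\<rho> d))"
  have "exec x (Seq (Dec u) (Seq (Inc v) (Inc d))) (\<rho>, i, out) 5 (?\<rho>, i, out)"
    using exec_Seq[OF exec_basic(2)[of x u \<rho> i out]
        exec_Seq[OF exec_basic(1)[of x v _ i out] exec_basic(1)[of x d _ i out], of 3], of 5] assms by simp
  moreover have "exec x (While u (Seq (Dec u) (Seq (Inc v) (Inc d)))) (?\<rho>, i, out) (6 * ?\<rho> u + 1)
    (?\<rho>(u := 0, v := ?\<rho> v + ?\<rho> u, d := ?\<rho> d + ?\<rho> u), i, out)"
    by (rule Suc(1)) (use assms Suc(2) in auto)
  ultimately have "exec x (While u (Seq (Dec u) (Seq (Inc v) (Inc d)))) (\<rho>, i, out) (6 * \<rho> u + 1)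
    (?\<rho>(u := 0, v := ?\<rho> v + ?\<rho> u, d := ?\<rho> d + ?\<rho> u), i, out)"
    by (rule exec_While_Suc[rotated]) (use assms Suc(2) in auto)
  moreover have "?\<rho>(u := 0, v := ?\<rho> v + ?\<rho> u, d := ?\<rho> d + ?\<rho> u)
     = \<rho>(u := 0, v := \<rho> v + \<rho> u, d := \<rho> d + \<rho> u)"
    using assms Suc(2) by (auto simp: fun_eq_iff)
  ultimately show ?case by simp
qed

text \<open>While the body runs, \<open>t0\<close> holds the remaining count; hence the body can
  rely on zero scratch registers only from \<open>Suc t0\<close> on.\<close>

lemma exec_count_down:
  assumes body: "is_body x D d \<sigma> M w q c (Suc t0) T" and "d < D" "D \<le> t0"
    and "\<forall>r<d. \<rho> r = \<sigma> r" "\<forall>r. d < r \<and> r < D \<or> t0 \<le> r \<longrightarrow> \<rho> r = 0" "k + q * a \<le> M"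
  shows "exec x (While t0 (Seq (Dec t0) c)) (\<rho>(d := k, t0 := a), i, out) (a * (T + 3) + 1)
    (\<rho>(d := k + q * a), i, out @ concat (map w [k..<k + q * a]))"
  using assms(6)
proof (induction a arbitrary: k out)
  case 0
  have eq: "\<rho>(d := k, t0 := 0) = \<rho>(d := k + q * 0)" using assms by (auto simp: fun_eq_iff)
  have "exec x (While t0 (Seq (Dec t0) c)) (\<rho>(d := k + q * 0), i, out) 1 (\<rho>(d := k + q * 0), i, out)"
    by (rule exec_While_0) (use assms in auto)
  then show ?case unfolding eq by (simp del: fun_upd_apply)
next
  case (Suc a)
  have "exec x c ((\<rho>(t0 := a))(d := k), i, out) T ((\<rho>(t0 := a))(d := k + q), i, out @ concat (map w [k..<k + q]))"
    using body assms Suc(2) unfolding is_body_def by (auto simp: algebra_simps)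
  then have c: "exec x c (\<rho>(d := k, t0 := a), i, out) T
      (\<rho>(d := k + q, t0 := a), i, out @ concat (map w [k..<k + q]))"
    using assms by (simp add: fun_upd_twist)
  have "exec x (Seq (Dec t0) c) (\<rho>(d := k, t0 := Suc a), i, out) (T + 2)
      (\<rho>(d := k + q, t0 := a), i, out @ concat (map w [k..<k + q]))"
    by (rule exec_Seq[OF exec_basic(2), where B' = T]) (use c in simp_all)
  moreover have "exec x (While t0 (Seq (Dec t0) c)) (\<rho>(d := k + q, t0 := a), i, out @ concat (map w [k..<k + q]))
     (a * (T + 3) + 1)
    (\<rho>(d := (k + q) + q * a), i, (out @ concat (map w [k..<k + q])) @ concat (map w [k + q..<(k + q) + q * a]))"
    by (rule Suc.IH) (use Suc(2) in simp)
  ultimately have "exec x (While t0 (Seq (Dec t0) c)) (\<rho>(d := k, t0 := Suc a), i, out) (Suc a * (T + 3) + 1)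
    (\<rho>(d := (k + q) + q * a), i, (out @ concat (map w [k..<k + q])) @ concat (map w [k + q..<(k + q) + q * a]))"
    by (rule exec_While_Suc[rotated]) auto
  moreover have "[k..<k + q * Suc a] = [k..<k + q] @ [k + q..<(k + q) + q * a]"
    using upt_add_eq_append[of k "k + q" "q * a"] by (simp add: add.assoc)
  ultimately show ?case by (simp add: add.assoc del: fun_upd_apply)
qed

lemma is_body_mono:
  "is_body x D d \<sigma> M w q c \<tau> T \<Longrightarrow> \<tau>' \<le> \<tau> \<Longrightarrow> is_body x D d \<sigma> M w q c \<tau>' T"
  unfolding is_body_def by (meson le_trans)

text \<open>By induction on the expression: sums add the advances of the index and products compose
  them, starting from the advance \<open>q\<close> of the body.\<close>

lemma is_body_rept:
  assumes "is_body x D d \<sigma> M w q c \<tau> T" "t0 + width e \<le> \<tau>"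
    "vars e \<subseteq> {..<d}" "d < D" "D \<le> t0" "\<And>r. r < d \<Longrightarrow> \<sigma> r \<le> B"
  shows "is_body x D d \<sigma> M w (q * eval e \<sigma>) (rept e c t0) t0 (rept_cost e B T)"
  using assms(1,2,3,5)
proof (induction e arbitrary: q c t0 T \<tau>)
  case (Num n)
  then show ?case using is_body_reptn is_body_mono by auto
next
  case (Var v)
  have v: "v < d" "\<sigma> v \<le> B" using Var assms(6) by auto
  have body: "is_body x D d \<sigma> M w q c (Suc t0) T" using Var(1,2) is_body_mono by auto
  show ?case unfolding is_body_def
  proof (intro allI impI)
    fix \<rho> :: "nat \<Rightarrow> nat" and k i out
    assume a: "\<forall>r<d. \<rho> r = \<sigma> r" "\<forall>r. d < r \<and> r < D \<or> t0 \<le> r \<longrightarrow> \<rho> r = 0"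
      "k + q * eval (Var v) \<sigma> \<le> M"
    let ?\<rho> = "\<rho>(d := k)"
    \<comment> \<open>The variable is first emptied into \<open>Suc t0\<close>, and then restored
      from there while a copy is made in \<open>t0\<close>. Counting down \<open>t0\<close> thus
      leaves the variable intact.\<close>
    let ?\<rho>1 = "?\<rho>(v := 0, Suc t0 := ?\<rho> (Suc t0) + ?\<rho> v)"
    have n: "v \<noteq> Suc t0" "v \<noteq> t0" "d \<noteq> t0" "d \<noteq> Suc t0" "v \<noteq> d"
      using v Var(4) assms(4) by auto
    have z: "\<rho> t0 = 0" "\<rho> (Suc t0) = 0" "\<rho> v = \<sigma> v" using a v by auto
    have \<rho>1: "?\<rho>1 (Suc t0) = \<sigma> v" "?\<rho>1 v = 0" "?\<rho>1 t0 = 0" using n z by auto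
    have 1: "exec x (While v (Seq (Dec v) (Inc (Suc t0)))) (?\<rho>, i, out) (4 * B + 1) (?\<rho>1, i, out)"
      by (rule exec_mono[OF exec_move]) (use n z v in auto)
    have "exec x (While (Suc t0) (Seq (Dec (Suc t0)) (Seq (Inc v) (Inc t0)))) (?\<rho>1, i, out) (6 * B + 1)
      (?\<rho>1(Suc t0 := 0, v := ?\<rho>1 v + ?\<rho>1 (Suc t0), t0 := ?\<rho>1 t0 + ?\<rho>1 (Suc t0)), i, out)"
      by (rule exec_mono[OF exec_move2]) (use n \<rho>1 v in auto)
    moreover have "?\<rho>1(Suc t0 := 0, v := ?\<rho>1 v + ?\<rho>1 (Suc t0), t0 := ?\<rho>1 t0 + ?\<rho>1 (Suc t0))
      = \<rho>(d := k, t0 := \<sigma> v)"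
      using n z by (auto simp: fun_eq_iff)
    ultimately have 2: "exec x (While (Suc t0) (Seq (Dec (Suc t0)) (Seq (Inc v) (Inc t0)))) (?\<rho>1, i, out) (6 * B + 1)
      (\<rho>(d := k, t0 := \<sigma> v), i, out)" by simp
    have 3: "exec x (While t0 (Seq (Dec t0) c)) (\<rho>(d := k, t0 := \<sigma> v), i, out) (B * (T + 3) + 1)
       (\<rho>(d := k + q * \<sigma> v), i, out @ concat (map w [k..<k + q * \<sigma> v]))"
      by (rule exec_mono[OF exec_count_down[OF body assms(4) Var(4)]]) (use a v in auto)
    show "exec x (rept (Var v) c t0) (\<rho>(d := k), i, out) (rept_cost (Var v) B T)
      (\<rho>(d := k + q * eval (Var v) \<sigma>), i, out @ concat (map w [k..<k + q * eval (Var v) \<sigma>]))"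
      unfolding rept.simps eval.simps
      by (rule exec_Seq[OF 1 exec_Seq[OF 2 3 order_refl]]) (simp add: algebra_simps)
  qed
next
  case (Add a b)
  have "is_body x D d \<sigma> M w (q * eval a \<sigma> + q * eval b \<sigma>) (Seq (rept a c t0) (rept b c t0)) t0
    (rept_cost a B T + rept_cost b B T + 1)"
    by (rule is_body_seq; rule Add.IH[where \<tau> = \<tau>]) (use Add.prems in auto)
  then show ?case by (simp add: algebra_simps)
next
  case (Mul a b)
  \<comment> \<open>The inner repetition is itself a body, with a larger advance; its scratch
    registers start above those that the outer one keeps busy.\<close>
  have "is_body x D d \<sigma> M w (q * eval b \<sigma>) (rept b c (t0 + width a)) (t0 + width a) (rept_cost b B T)"
    by (rule Mul.IH(2)[where \<tau> = \<tau>]) (use Mul.prems in auto)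
  then have "is_body x D d \<sigma> M w (q * eval b \<sigma> * eval a \<sigma>) (rept a (rept b c (t0 + width a)) t0) t0
    (rept_cost a B (rept_cost b B T))"
    by (rule Mul.IH(1)) (use Mul.prems in auto)
  then show ?case by (simp add: mult_ac)
qed

section \<open>Generators for lists of numbers and their compilation\<close>

text \<open>The index register is cleared at the end, so that it is zero again for the next loop at
  the same depth.\<close>

definition loop :: "nat \<Rightarrow> nat \<Rightarrow> exp \<Rightarrow> com \<Rightarrow> com" where
  "loop d \<tau> e c = Seq (rept e (Seq c (Inc d)) \<tau>) (While d (Dec d))"

lemma exec_clear:
  "exec x (While d (Dec d)) (\<rho>(d := a), i, out) (2 * a + 1) (\<rho>(d := 0), i, out)"
proof (induction a)
  case 0
  then show ?case using exec_While_0[of "\<rho>(d := 0)" d] by (simp del: fun_upd_apply add: fun_upd_same)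
next
  case (Suc a)
  have "exec x (Dec d) (\<rho>(d := Suc a), i, out) 1 (\<rho>(d := a), i, out)"
    using exec_basic(2)[of x d "\<rho>(d := Suc a)" i out] by simp
  from exec_While_Suc[OF _ this Suc order_refl] show ?case by (simp del: fun_upd_apply add: fun_upd_same)
qed

lemma exec_loop:
  assumes body: "\<And>\<rho>' k i out. \<lbrakk>\<forall>r<d. \<rho>' r = \<rho> r; \<forall>r. d < r \<and> r < D \<or> \<tau> + width e \<le> r \<longrightarrow> \<rho>' r = 0;
      k < eval e \<rho>; \<rho>' d = k\<rbrakk> \<Longrightarrow> exec x c (\<rho>', i, out) T (\<rho>', i, out @ w k)"
    and e: "vars e \<subseteq> {..<d}" "d < D" "D \<le> \<tau>" "\<And>r. r < d \<Longrightarrow> \<rho> r \<le> B"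
    and z: "\<forall>r. d \<le> r \<and> r < D \<or> \<tau> \<le> r \<longrightarrow> \<rho> r = 0" and E: "eval e \<rho> \<le> E"
  shows "exec x (loop d \<tau> e c) (\<rho>, i, out) (rept_cost e B (T + 2) + 2 * E + 2)
    (\<rho>, i, out @ concat (map w [0..<eval e \<rho>]))"
proof -
  have "is_body x D d \<rho> (eval e \<rho>) w 1 (Seq c (Inc d)) (\<tau> + width e) (T + 2)"
    unfolding is_body_def
  proof (intro allI impI)
    fix \<rho>' :: "nat \<Rightarrow> nat" and k i out
    assume a: "\<forall>r<d. \<rho>' r = \<rho> r" "\<forall>r. d < r \<and> r < D \<or> \<tau> + width e \<le> r \<longrightarrow> \<rho>' r = 0"
      "k + 1 \<le> eval e \<rho>"
    have "exec x c (\<rho>'(d := k), i, out) T (\<rho>'(d := k), i, out @ w k)"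
      by (rule body) (use a e in auto)
    moreover have "exec x (Inc d) (\<rho>'(d := k), i, out @ w k) 1 (\<rho>'(d := k + 1), i, out @ w k)"
      using exec_basic(1)[of x d "\<rho>'(d := k)" i "out @ w k"] by simp
    ultimately show "exec x (Seq c (Inc d)) (\<rho>'(d := k), i, out) (T + 2)
        (\<rho>'(d := k + 1), i, out @ concat (map w [k..<k + 1]))"
      by (auto intro: exec_Seq)
  qed
  from is_body_rept[OF this order_refl e]
  have "is_body x D d \<rho> (eval e \<rho>) w (eval e \<rho>) (rept e (Seq c (Inc d)) \<tau>) \<tau> (rept_cost e B (T + 2))"
    by simp
  then have "exec x (rept e (Seq c (Inc d)) \<tau>) (\<rho>(d := 0), i, out) (rept_cost e B (T + 2))
    (\<rho>(d := 0 + eval e \<rho>), i, out @ concat (map w [0..<0 + eval e \<rho>]))"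
    using z unfolding is_body_def by (metis add_0 less_imp_le order_refl)
  moreover have "\<rho>(d := 0) = \<rho>" using z e by auto
  moreover have "exec x (While d (Dec d)) (\<rho>(d := eval e \<rho>), i, out @ concat (map w [0..<eval e \<rho>]))
     (2 * E + 1) (\<rho>(d := 0), i, out @ concat (map w [0..<eval e \<rho>]))"
    by (rule exec_mono[OF exec_clear]) (use E in simp)
  ultimately show ?thesis unfolding loop_def by (auto intro: exec_Seq)
qed

text \<open>\<open>For e g\<close> at nesting depth \<open>d\<close> binds the variable \<open>d\<close> in \<open>g\<close> to the values below \<open>e\<close>.\<close>

datatype gen = Nat exp | Then gen gen | For exp gen

primrec nats :: "nat \<Rightarrow> gen \<Rightarrow> (nat \<Rightarrow> nat) \<Rightarrow> nat list" where
  "nats d (Nat e) \<sigma> = [eval e \<sigma>]"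
| "nats d (Then g h) \<sigma> = nats d g \<sigma> @ nats d h \<sigma>"
| "nats d (For e g) \<sigma> = concat (map (\<lambda>k. nats (Suc d) g (\<sigma>(d := k))) [0..<eval e \<sigma>])"

primrec scoped :: "nat \<Rightarrow> gen \<Rightarrow> bool" where
  "scoped d (Nat e) \<longleftrightarrow> vars e \<subseteq> {..<d}"
| "scoped d (Then g h) \<longleftrightarrow> scoped d g \<and> scoped d h"
| "scoped d (For e g) \<longleftrightarrow> vars e \<subseteq> {..<d} \<and> scoped (Suc d) g"

text \<open>A single number counts 1, since printing it in unary is a loop with an index of its
  own.\<close>

primrec depth :: "gen \<Rightarrow> nat" where
  "depth (Nat e) = 1"
| "depth (Then g h) = max (depth g) (depth h)"
| "depth (For e g) = Suc (depth g)"

primrec compile :: "nat \<Rightarrow> nat \<Rightarrow> gen \<Rightarrow> com" where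
  "compile d \<tau> (Nat e) = Seq (loop d \<tau> e (Out True)) (Out False)"
| "compile d \<tau> (Then g h) = Seq (compile d \<tau> g) (compile d \<tau> h)"
| "compile d \<tau> (For e g) = loop d \<tau> e (compile (Suc d) (\<tau> + width e) g)"

text \<open>Inside a loop the index stays below the loop bound, so
  \<open>B + eval e (\<lambda>_. B)\<close> bounds all variables of the body.\<close>

primrec cost :: "gen \<Rightarrow> nat \<Rightarrow> nat" where
  "cost (Nat e) B = rept_cost e B 3 + 2 * eval e (\<lambda>_. B) + 4"
| "cost (Then g h) B = cost g B + cost h B + 1"
| "cost (For e g) B =
     rept_cost e B (cost g (B + eval e (\<lambda>_. B)) + 2) + 2 * eval e (\<lambda>_. B) + 2"

lemma nats_cong: "scoped d g \<Longrightarrow> (\<And>r. r < d \<Longrightarrow> \<sigma> r = \<sigma>' r) \<Longrightarrow> nats d g \<sigma> = nats d g \<sigma>'"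
proof (induction g arbitrary: d \<sigma> \<sigma>')
  case (Nat e)
  then show ?case using eval_cong[of e \<sigma> \<sigma>'] by auto
next
  case (Then g h)
  then show ?case by (metis nats.simps(2) scoped.simps(2))
next
  case (For e g)
  have "eval e \<sigma> = eval e \<sigma>'" using For by (intro eval_cong) auto
  moreover have "nats (Suc d) g (\<sigma>(d := k)) = nats (Suc d) g (\<sigma>'(d := k))" for k
    by (rule For.IH) (use For.prems in auto)
  ultimately show ?case by simp
qed

lemma encode_nats_append: "encode_nats (ms @ ns) = encode_nats ms @ encode_nats ns"
  by (simp add: encode_nats_def)

lemma encode_nats_concat: "encode_nats (concat (map f ks)) = concat (map (\<lambda>k. encode_nats (f k)) ks)"
  by (induction ks) (simp_all add: encode_nats_def)

text \<open>\<open>D\<close> is fixed for the whole program and separates the variables from the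
  scratch registers. Each loop moves the start of the free scratch area up by the width of its
  bound.\<close>

lemma exec_comp:
  assumes "scoped d g" "d + depth g \<le> D" "D \<le> \<tau>" "\<And>r. r < d \<Longrightarrow> \<rho> r \<le> B"
    "\<forall>r. d \<le> r \<and> r < D \<or> \<tau> \<le> r \<longrightarrow> \<rho> r = 0"
  shows "exec x (compile d \<tau> g) (\<rho>, i, out) (cost g B) (\<rho>, i, out @ encode_nats (nats d g \<rho>))"
  using assms
proof (induction g arbitrary: d \<tau> \<rho> B i out)
  case (Nat e)
  have "eval e \<rho> \<le> eval e (\<lambda>_. B)" using Nat by (intro eval_mono) auto
  then have "exec x (loop d \<tau> e (Out True)) (\<rho>, i, out) (rept_cost e B (1 + 2) + 2 * eval e (\<lambda>_. B) + 2)
     (\<rho>, i, out @ concat (map (\<lambda>k. [True]) [0..<eval e \<rho>]))"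
    by (intro exec_loop[where D = D]) (use Nat exec_basic(3) in auto)
  moreover have "concat (map (\<lambda>k. [True]) [0..<n]) = replicate n True" for n
    by (induction n) (auto simp: replicate_append_same)
  ultimately show ?case unfolding compile.simps
    by (intro exec_Seq[OF _ exec_basic(3), THEN back_subst[of "exec x _ _ _"]]) (auto simp: encode_nats_def numeral_3_eq_3)
next
  case (Then g h)
  have "exec x (compile d \<tau> g) (\<rho>, i, out) (cost g B) (\<rho>, i, out @ encode_nats (nats d g \<rho>))"
    by (rule Then.IH(1)) (use Then.prems in auto)
  moreover have "exec x (compile d \<tau> h) (\<rho>, i, out @ encode_nats (nats d g \<rho>)) (cost h B)
     (\<rho>, i, (out @ encode_nats (nats d g \<rho>)) @ encode_nats (nats d h \<rho>))"
    by (rule Then.IH(2)) (use Then.prems in auto)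
  ultimately show ?case by (auto simp: encode_nats_append intro: exec_Seq)
next
  case (For e g)
  let ?E = "eval e (\<lambda>_. B)"
  have E: "eval e \<rho> \<le> ?E" using For by (intro eval_mono) auto
  have "exec x (loop d \<tau> e (compile (Suc d) (\<tau> + width e) g)) (\<rho>, i, out)
     (rept_cost e B (cost g (B + ?E) + 2) + 2 * ?E + 2)
     (\<rho>, i, out @ concat (map (\<lambda>k. encode_nats (nats (Suc d) g (\<rho>(d := k)))) [0..<eval e \<rho>]))"
  proof (rule exec_loop[where D = D])
    fix \<rho>' :: "nat \<Rightarrow> nat" and k i out
    assume a: "\<forall>r<d. \<rho>' r = \<rho> r" "\<forall>r. d < r \<and> r < D \<or> \<tau> + width e \<le> r \<longrightarrow> \<rho>' r = 0"
      "k < eval e \<rho>" "\<rho>' d = k"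
    have "exec x (compile (Suc d) (\<tau> + width e) g) (\<rho>', i, out) (cost g (B + ?E))
      (\<rho>', i, out @ encode_nats (nats (Suc d) g \<rho>'))"
    proof (rule For.IH)
      fix r assume "r < Suc d"
      then consider "r < d" | "r = d" by linarith
      then show "\<rho>' r \<le> B + ?E"
        using a E For.prems(4)[of r] by cases auto
    qed (use For.prems a in auto)
    moreover have "nats (Suc d) g \<rho>' = nats (Suc d) g (\<rho>(d := k))"
      by (rule nats_cong) (use For.prems a in \<open>auto simp: less_Suc_eq\<close>)
    ultimately show "exec x (compile (Suc d) (\<tau> + width e) g) (\<rho>', i, out) (cost g (B + ?E))
       (\<rho>', i, out @ encode_nats (nats (Suc d) g (\<rho>(d := k))))" by simp
  qed (use For.prems E in auto)
  then show ?case by (simp add: encode_nats_concat)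
qed

section \<open>Polynomial bounds for the running time\<close>

definition poly_bounded :: "(nat \<Rightarrow> nat) \<Rightarrow> bool" where
  "poly_bounded f \<longleftrightarrow> (\<exists>p :: nat poly. \<forall>x. f x \<le> poly p x)"

lemma poly_boundedI: "(\<And>x. f x \<le> poly p x) \<Longrightarrow> poly_bounded f"
  unfolding poly_bounded_def by blast

lemma poly_bounded_const: "poly_bounded (\<lambda>_. c)"
  by (rule poly_boundedI[of _ "[:c:]"]) simp

lemma poly_bounded_id: "poly_bounded (\<lambda>x. x)"
  by (rule poly_boundedI[of _ "[:0, 1:]"]) simp

lemma poly_bounded_add: "poly_bounded f \<Longrightarrow> poly_bounded g \<Longrightarrow> poly_bounded (\<lambda>x. f x + g x)"
  unfolding poly_bounded_def by (metis add_mono poly_add)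

lemma poly_bounded_mult: "poly_bounded f \<Longrightarrow> poly_bounded g \<Longrightarrow> poly_bounded (\<lambda>x. f x * g x)"
  unfolding poly_bounded_def by (metis mult_le_mono poly_mult)

lemma poly_bounded_le: "poly_bounded g \<Longrightarrow> (\<And>x. f x \<le> g x) \<Longrightarrow> poly_bounded f"
  unfolding poly_bounded_def by (meson le_trans)

lemmas poly_bounded_intros = poly_bounded_const poly_bounded_id poly_bounded_add poly_bounded_mult

lemma eval_poly: "\<exists>p :: nat poly. \<forall>B. eval e (\<lambda>_. B) = poly p B"
proof (induction e)
  case (Num n)
  then show ?case by (intro exI[of _ "[:n:]"]) simp
next
  case (Var v)
  then show ?case by (intro exI[of _ "[:0, 1:]"]) simp
qed (auto simp flip: poly_add poly_mult)

text \<open>Polynomials are closed under composition; this absorbs the larger bound on the variables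
  inside a loop.\<close>

lemma poly_bounded_comp_add:
  assumes "poly_bounded f"
  shows "poly_bounded (\<lambda>B. f (B + eval e (\<lambda>_. B)))"
proof -
  obtain p where p: "\<And>x. f x \<le> poly p x" using assms unfolding poly_bounded_def by blast
  obtain q :: "nat poly" where q: "\<And>B. eval e (\<lambda>_. B) = poly q B" using eval_poly by blast
  show ?thesis
    by (rule poly_boundedI[of _ "pcompose p ([:0, 1:] + q)"]) (use p q in \<open>simp add: poly_pcompose\<close>)
qed

text \<open>Being linear in \<open>T\<close> with a factor polynomial in \<open>B\<close> is
  preserved when repetitions are nested, so a fixed nesting keeps the total cost polynomial.\<close>

lemma rept_cost_bound: "\<exists>h. poly_bounded h \<and> (\<forall>B T. rept_cost e B T \<le> h B * (T + 1))"
proof (induction e)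
  case (Num n)
  then show ?case
    by (intro exI[of _ "\<lambda>_. n + 3"]) (auto intro: poly_bounded_intros simp: algebra_simps)
next
  case (Var v)
  then show ?case
    by (intro exI[of _ "\<lambda>B. 13 * B + 5"]) (auto intro!: poly_bounded_intros simp: algebra_simps)
next
  case (Add a b)
  then obtain f g where f: "poly_bounded f" "\<And>B T. rept_cost a B T \<le> f B * (T + 1)"
    and g: "poly_bounded g" "\<And>B T. rept_cost b B T \<le> g B * (T + 1)" by blast
  have "rept_cost (Add a b) B T \<le> (f B + g B + 1) * (T + 1)" for B T
    using f(2)[of B T] g(2)[of B T] by (simp add: algebra_simps)
  then show ?case using f(1) g(1)
    by (intro exI[of _ "\<lambda>B. f B + g B + 1"]) (auto intro!: poly_bounded_intros simp del: add_Suc_right One_nat_def)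
next
  case (Mul a b)
  then obtain f g where f: "poly_bounded f" "\<And>B T. rept_cost a B T \<le> f B * (T + 1)"
    and g: "poly_bounded g" "\<And>B T. rept_cost b B T \<le> g B * (T + 1)" by blast
  have "rept_cost (Mul a b) B T \<le> (f B * (g B + 1)) * (T + 1)" for B T
  proof -
    have "rept_cost (Mul a b) B T \<le> f B * (rept_cost b B T + 1)" using f(2) by simp
    also have "\<dots> \<le> f B * (g B * (T + 1) + 1)" using g(2)[of B T] by (intro mult_le_mono) auto
    also have "\<dots> \<le> (f B * (g B + 1)) * (T + 1)" by (simp add: algebra_simps)
    finally show ?thesis .
  qed
  then show ?case using f(1) g(1)
    by (intro exI[of _ "\<lambda>B. f B * (g B + 1)"]) (auto intro!: poly_bounded_intros simp del: add_Suc_right One_nat_def mult_Suc_right)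
qed

lemma poly_bounded_rept_cost: "poly_bounded f \<Longrightarrow> poly_bounded (\<lambda>B. rept_cost e B (f B))"
proof -
  assume f: "poly_bounded f"
  obtain h where h: "poly_bounded h" "\<And>B T. rept_cost e B T \<le> h B * (T + 1)"
    using rept_cost_bound by blast
  have "poly_bounded (\<lambda>B. h B * (f B + 1))" by (intro poly_bounded_intros f h)
  then show ?thesis by (rule poly_bounded_le) (use h in simp)
qed

lemma poly_bounded_eval: "poly_bounded (\<lambda>B. eval e (\<lambda>_. B))"
  using eval_poly[of e] unfolding poly_bounded_def by (metis order_refl)

lemma poly_bounded_cost: "poly_bounded (cost g)"
proof (induction g)
  case (Nat e)
  show ?case unfolding cost.simps[abs_def]
    by (intro poly_bounded_intros poly_bounded_rept_cost poly_bounded_eval)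
next
  case (Then g h)
  then show ?case unfolding cost.simps[abs_def] by (intro poly_bounded_intros)
next
  case (For e g)
  then show ?case unfolding cost.simps[abs_def]
    by (intro poly_bounded_intros poly_bounded_rept_cost poly_bounded_eval poly_bounded_comp_add)
qed

section \<open>Programs with two passes over the input\<close>

text \<open>The first pass leaves the length of the input in register 0. One step left from the
  blank behind the input, rewinding to the blank at position -1 and one step right bring the head
  back to cell 0, also for the empty input. The second pass runs \<open>gt\<close> or
  \<open>gf\<close> for each bit, with the position of the bit in register 1.\<close>

definition gen_prog :: "nat \<Rightarrow> gen \<Rightarrow> gen \<Rightarrow> gen \<Rightarrow> com" where
  "gen_prog D g gt gf =
     Seq (WhileIn (Seq (Inc 0) MvR)) (Seq MvL (Seq (WhileIn MvL) (Seq MvR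
      (Seq (compile 1 D g)
        (WhileIn (Seq (IfIn (compile 2 D gt) (compile 2 D gf)) (Seq (Inc 1) MvR)))))))"

lemma string_content_0_iff: "string_content x i = 0 \<longleftrightarrow> i < 0 \<or> int (length x) \<le> i"
  by (auto simp: string_content_def)

lemma exec_count_input:
  "j \<le> length x \<Longrightarrow> exec x (WhileIn (Seq (Inc 0) MvR)) (\<rho>(0 := j), int j, out) (4 * (length x - j) + 1)
    (\<rho>(0 := length x), int (length x), out)"
proof (induction "length x - j" arbitrary: j)
  case 0
  then show ?case using exec_WhileIn_0[of x "int j"] by (simp add: string_content_0_iff)
next
  case (Suc n)
  have "exec x (Seq (Inc 0) MvR) (\<rho>(0 := j), int j, out) 3 (\<rho>(0 := Suc j), int (Suc j), out)"
    using exec_Seq[OF exec_basic(1)[of x 0 "\<rho>(0 := j)" "int j" out] exec_basic(4), of 3] by (simp add: add.commute)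
  moreover have "exec x (WhileIn (Seq (Inc 0) MvR)) (\<rho>(0 := Suc j), int (Suc j), out)
     (4 * (length x - Suc j) + 1) (\<rho>(0 := length x), int (length x), out)"
    by (rule Suc(1)) (use Suc(2) in auto)
  ultimately show ?case
    by (rule exec_WhileIn_Suc[rotated]) (use Suc(2) in \<open>auto simp: string_content_0_iff\<close>)
qed

lemma exec_rewind:
  "j \<le> length x \<Longrightarrow> exec x (WhileIn MvL) (\<rho>, int j - 1, out) (2 * j + 1) (\<rho>, -1, out)"
proof (induction j)
  case 0
  then show ?case using exec_WhileIn_0[of x "-1"] by (simp add: string_content_0_iff)
next
  case (Suc j)
  have "exec x MvL (\<rho>, int (Suc j) - 1, out) 1 (\<rho>, int j - 1, out)"
    using exec_basic(5)[of x \<rho> "int (Suc j) - 1" out] by simp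
  moreover have "exec x (WhileIn MvL) (\<rho>, int j - 1, out) (2 * j + 1) (\<rho>, -1, out)"
    using Suc by simp
  ultimately show ?case
    by (rule exec_WhileIn_Suc[rotated]) (use Suc in \<open>auto simp: string_content_0_iff\<close>)
qed

text \<open>The format that both reductions fit: numbers computed from the length alone, followed by
  one segment for each input bit.\<close>

theorem gen_poly_time:
  assumes "scoped 1 g" "scoped 2 gt" "scoped 2 gf"
  shows "poly_time_computable (\<lambda>x. encode_nats (nats 1 g (\<lambda>_. length x) @
    concat (map (\<lambda>i. nats 2 (if x ! i then gt else gf) (\<lambda>r. if r = 0 then length x else i)) [0..<length x])))"
proof -
  define D where "D = 2 + depth g + depth gt + depth gf"
  define u where "u = (\<lambda>(x :: bool list) i. encode_nats (nats 2 (if x ! i then gt else gf) (\<lambda>r. if r = 0 then length x else i)))"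
  let ?env = "\<lambda>n i. (\<lambda>_. 0 :: nat)(0 :: nat := n, 1 := i)"
  let ?T = "\<lambda>n. cost gt n + cost gf n + 6"
  have inp: "exec x (WhileIn (Seq (IfIn (compile 2 D gt) (compile 2 D gf)) (Seq (Inc 1) MvR)))
      (?env (length x) j, int j, out) ((length x - j) * (?T (length x)) + 1)
      (?env (length x) (length x), int (length x), out @ concat (map (u x) [j..<length x]))"
    if "j \<le> length x" for x j out
    using that
  proof (induction "length x - j" arbitrary: j out)
    case 0
    then show ?case using exec_WhileIn_0[of x "int j"] by (simp add: string_content_0_iff)
  next
    case (Suc n)
    let ?\<rho> = "?env (length x) j"
    have j: "j < length x" using Suc(2) by simp
    have "exec x (compile 2 D h) (?\<rho>, int j, out) (cost h (length x)) (?\<rho>, int j, out @ encode_nats (nats 2 h ?\<rho>))"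
      if "h = gt \<or> h = gf" for h
      by (rule exec_comp[where D = D]) (use that assms j D_def in auto)
    then have "exec x (compile 2 D h) (?\<rho>, int j, out) (cost gt (length x) + cost gf (length x))
        (?\<rho>, int j, out @ encode_nats (nats 2 h ?\<rho>))"
      if "h = gt \<or> h = gf" for h
      using that by (elim disjE) (blast intro: exec_mono le_add1 le_add2)+
    moreover have "(if string_content x (int j) = 2 then compile 2 D gt else compile 2 D gf)
       = compile 2 D (if x ! j then gt else gf)"
      using j by (simp add: string_content_def)
    moreover have "u x j = encode_nats (nats 2 (if x ! j then gt else gf) ?\<rho>)"
      unfolding u_def by (intro arg_cong[where f = encode_nats] nats_cong) (use assms in \<open>auto simp: less_2_cases_iff\<close>)
    ultimately have "exec x (IfIn (compile 2 D gt) (compile 2 D gf)) (?\<rho>, int j, out)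
        (Suc (cost gt (length x) + cost gf (length x))) (?\<rho>, int j, out @ u x j)"
      by (intro exec_IfIn) simp
    moreover have "exec x (Seq (Inc 1) MvR) (?\<rho>, int j, out @ u x j) 3
       (?env (length x) (Suc j), int (Suc j), out @ u x j)"
      using exec_Seq[OF exec_basic(1)[of x 1 ?\<rho> "int j" "out @ u x j"] exec_basic(4), of 3]
      by (simp add: add.commute)
    ultimately have "exec x (Seq (IfIn (compile 2 D gt) (compile 2 D gf)) (Seq (Inc 1) MvR)) (?\<rho>, int j, out)
        (cost gt (length x) + cost gf (length x) + 5) (?env (length x) (Suc j), int (Suc j), out @ u x j)"
      by (rule exec_Seq) simp
    moreover have "exec x (WhileIn (Seq (IfIn (compile 2 D gt) (compile 2 D gf)) (Seq (Inc 1) MvR)))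
      (?env (length x) (Suc j), int (Suc j), out @ u x j) ((length x - Suc j) * (?T (length x)) + 1)
      (?env (length x) (length x), int (length x), (out @ u x j) @ concat (map (u x) [Suc j..<length x]))"
      by (rule Suc(1)) (use Suc(2) in auto)
    moreover have "Suc (cost gt (length x) + cost gf (length x) + 5 + ((length x - Suc j) * ?T (length x) + 1))
       \<le> (length x - j) * ?T (length x) + 1"
      using mult_Suc[of "length x - Suc j" "?T (length x)"] j by (simp only: Suc_diff_Suc)
    ultimately have "exec x (WhileIn (Seq (IfIn (compile 2 D gt) (compile 2 D gf)) (Seq (Inc 1) MvR)))
      (?env (length x) j, int j, out) ((length x - j) * ?T (length x) + 1)
      (?env (length x) (length x), int (length x), (out @ u x j) @ concat (map (u x) [Suc j..<length x]))"
      by (rule exec_WhileIn_Suc[rotated]) (use j in \<open>simp add: string_content_0_iff\<close>)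
    moreover have "out @ concat (map (u x) [j..<length x]) = (out @ u x j) @ concat (map (u x) [Suc j..<length x])"
      using j by (simp add: upt_conv_Cons)
    ultimately show ?case by metis
  qed
  let ?B = "\<lambda>n. 6 * n + cost g n + n * ?T n + 10"
  have run: "exec x (gen_prog D g gt gf) (\<lambda>_. 0, 0, []) (?B (length x))
    (?env (length x) (length x), int (length x),
     encode_nats (nats 1 g (\<lambda>_. length x)) @ concat (map (u x) [0..<length x]))" for x
  proof -
    let ?n = "length x" and ?\<rho> = "(\<lambda>_. 0)(0 := length x)"
    have 1: "exec x (WhileIn (Seq (Inc 0) MvR)) (\<lambda>_. 0, 0, []) (4 * ?n + 1) (?\<rho>, int ?n, [])"
      using exec_count_input[of 0 x "\<lambda>_. 0" "[]"] by (simp add: fun_upd_idem del: fun_upd_apply)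
    have 2: "exec x MvL (?\<rho>, int ?n, []) 1 (?\<rho>, int ?n - 1, [])" by (rule exec_basic)
    have 3: "exec x (WhileIn MvL) (?\<rho>, int ?n - 1, []) (2 * ?n + 1) (?\<rho>, -1, [])"
      by (rule exec_rewind) simp
    have 4: "exec x MvR (?\<rho>, -1, []) 1 (?\<rho>, 0, [])"
      using exec_basic(4)[of x ?\<rho> "-1" "[]"] by simp
    have "exec x (compile 1 D g) (?\<rho>, 0, []) (cost g ?n) (?\<rho>, 0, [] @ encode_nats (nats 1 g ?\<rho>))"
      by (rule exec_comp[where D = D]) (use assms D_def in auto)
    moreover have "nats 1 g ?\<rho> = nats 1 g (\<lambda>_. ?n)"
      by (rule nats_cong) (use assms in auto)
    ultimately have 5: "exec x (compile 1 D g) (?\<rho>, 0, []) (cost g ?n) (?\<rho>, 0, encode_nats (nats 1 g (\<lambda>_. ?n)))"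
      by simp
    have "?env ?n 0 = ?\<rho>" by auto
    then have 6: "exec x (WhileIn (Seq (IfIn (compile 2 D gt) (compile 2 D gf)) (Seq (Inc 1) MvR)))
      (?\<rho>, 0, encode_nats (nats 1 g (\<lambda>_. ?n))) (?n * ?T ?n + 1)
      (?env ?n ?n, int ?n, encode_nats (nats 1 g (\<lambda>_. ?n)) @ concat (map (u x) [0..<?n]))"
      using inp[of 0 x "encode_nats (nats 1 g (\<lambda>_. ?n))"] by (simp del: fun_upd_apply)
    show ?thesis unfolding gen_prog_def
      by (rule exec_Seq[OF 1 exec_Seq[OF 2 exec_Seq[OF 3 exec_Seq[OF 4
              exec_Seq[OF 5 6 order_refl] order_refl] order_refl] order_refl]]) simp
  qed
  have "poly_bounded ?B" by (intro poly_bounded_intros poly_bounded_cost)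
  then obtain p where p: "\<And>n. ?B n \<le> poly p n" unfolding poly_bounded_def by blast
  show ?thesis
  proof (rule com_poly_time[where c = "gen_prog D g gt gf" and p = p])
    fix x :: "bool list"
    obtain t where t: "t \<le> ?B (length x)" "\<And>K. (cstep x ^^ t) (gen_prog D g gt gf # K, (\<lambda>_. 0, 0, [])) =
       (K, (?env (length x) (length x), int (length x),
     encode_nats (nats 1 g (\<lambda>_. length x)) @ concat (map (u x) [0..<length x])))"
      using run[of x] unfolding exec_def by blast
    have "t \<le> poly p (length x)" using t(1) p[of "length x"] by linarith
    then show "\<exists>t \<rho> i. (cstep x ^^ t) ([gen_prog D g gt gf], (\<lambda>_. 0, 0, [])) = ([], \<rho>, i,
        encode_nats (nats 1 g (\<lambda>_. length x) @ concat (map (\<lambda>i. nats 2 (if x ! i then gt else gf)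
          (\<lambda>r. if r = 0 then length x else i)) [0..<length x]))) \<and> t \<le> poly p (length x)"
      using t(2)[of "[]"] unfolding encode_nats_append encode_nats_concat u_def by blast
  qed
qed

section \<open>Routings in the complete bipartite graph of hubs and leaves\<close>

definition hub_edges :: "nat \<Rightarrow> nat \<Rightarrow> nat set set" where
  "hub_edges r n = (\<lambda>(h, v). {h, r + v}) ` ({..<r} \<times> {..<n})"

lemma doubleton_hub_eq:
  "h < r \<Longrightarrow> h' < r \<Longrightarrow> {h, r + v} = {h', r + v'} \<longleftrightarrow> h = h' \<and> v = (v' :: nat)"
  by (auto simp: doubleton_eq_iff)

lemma card_hub_edges: "finite (hub_edges r n)" "card (hub_edges r n) = r * n"
proof -
  have "inj_on (\<lambda>(h, v). {h, r + v}) ({..<r} \<times> {..<n})"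
    by (auto simp: inj_on_def doubleton_hub_eq)
  then show "card (hub_edges r n) = r * n" by (simp add: hub_edges_def card_image)
qed (simp add: hub_edges_def)

lemma hub_edgesE:
  assumes "{x, y} \<in> hub_edges r n" "r \<le> x"
  shows "y < r" "x < r + n"
  using assms by (auto simp: hub_edges_def doubleton_eq_iff)

lemma hub_edgesE2:
  assumes "{x, y} \<in> hub_edges r n" "x < r"
  shows "r \<le> y" "y < r + n"
  using assms by (auto simp: hub_edges_def doubleton_eq_iff)

lemma path_edges_2: "path_edges [x, y] = {{x, y}}"
  by (auto simp: path_edges_def less_Suc_eq)

lemma path_edges_3: "path_edges [x, y, z] = {{x, y}, {y, z}}"
proof -
  have "{i. Suc i < length [x, y, z]} = {0, 1}" by auto
  moreover have "path_edges p = (\<lambda>i. {p ! i, p ! Suc i}) ` {i. Suc i < length p}" for p :: "'a list"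
    by (auto simp: path_edges_def)
  ultimately show ?thesis by simp
qed

lemma path_edgesI: "Suc i < length p \<Longrightarrow> {p ! i, p ! Suc i} \<in> path_edges p"
  by (auto simp: path_edges_def)

text \<open>A family \<open>J\<close> of demands, the one with index \<open>j\<close> going from the leaf \<open>a j\<close> (vertex \<open>r + a j\<close>)
  to the vertex \<open>b j\<close>, which is a hub if it is below \<open>r\<close>.\<close>

definition leaf_ends :: "nat \<Rightarrow> ('j \<Rightarrow> nat) \<Rightarrow> ('j \<Rightarrow> nat) \<Rightarrow> 'j \<Rightarrow> nat set" where
  "leaf_ends r a b j = (if b j < r then {a j} else {a j, b j - r})"

definition hub_colouring ::
  "nat \<Rightarrow> ('j \<Rightarrow> nat) \<Rightarrow> ('j \<Rightarrow> nat) \<Rightarrow> 'j set \<Rightarrow> ('j \<Rightarrow> nat) \<Rightarrow> bool" where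
  "hub_colouring r a b J col \<longleftrightarrow>
     (\<forall>j\<in>J. col j < r \<and> (b j < r \<longrightarrow> col j = b j)) \<and>
     (\<forall>j\<in>J. \<forall>j'\<in>J. j \<noteq> j' \<longrightarrow> leaf_ends r a b j \<inter> leaf_ends r a b j' \<noteq> {} \<longrightarrow> col j \<noteq> col j')"

locale demand_family =
  fixes r n :: nat and J :: "'j set" and a b :: "'j \<Rightarrow> nat"
  assumes finite_J: "finite J"
    and a_less: "j \<in> J \<Longrightarrow> a j < n"
    and b_less: "j \<in> J \<Longrightarrow> b j < r + n"
    and a_neq_b: "j \<in> J \<Longrightarrow> b j \<noteq> r + a j"
    and inj_pair: "inj_on (\<lambda>j. (r + a j, b j)) J"
begin

abbreviation "pair j \<equiv> (r + a j, b j)"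

text \<open>The edge between hub \<open>h\<close> and leaf \<open>v\<close> is used only by demands
  of colour \<open>h\<close> that end at \<open>v\<close>, and a colouring admits at most one of
  these.\<close>

lemma routable_if_colouring:
  assumes col: "hub_colouring r a b J col" and cap: "\<And>e. e \<in> hub_edges r n \<Longrightarrow> cap e = 1"
  shows "routable {..<r + n} (hub_edges r n) cap (pair ` J)"
proof -
  define route where "route j = (if b j < r then [r + a j, b j] else [r + a j, col j, b j])" for j
  define P where "P m = route (the_inv_into J pair m)" for m
  have P: "P (pair j) = route j" if "j \<in> J" for j
    using that by (simp add: P_def the_inv_into_f_f[OF inj_pair])
  have edge: "{h, r + v} \<in> hub_edges r n" if "h < r" "v < n" for h v
    using that by (auto simp: hub_edges_def)
  have es: "path_edges (route j) = (\<lambda>v. {col j, r + v}) ` leaf_ends r a b j" if "j \<in> J" for j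
    using that col by (auto simp: hub_colouring_def route_def leaf_ends_def path_edges_2 path_edges_3)
  have le: "v < n" if "j \<in> J" "v \<in> leaf_ends r a b j" for j v
    using that a_less[of j] b_less[of j] by (auto simp: leaf_ends_def split: if_splits)
  have colr: "col j < r" if "j \<in> J" for j using col that by (auto simp: hub_colouring_def)
  have "is_path {..<r + n} (hub_edges r n) (r + a j) (b j) (route j)" if "j \<in> J" for j
    using that es[OF that] colr[OF that] a_less[OF that] b_less[OF that] a_neq_b[OF that] le edge
    unfolding is_path_def by (auto simp: route_def)
  then have "\<forall>(s, t) \<in> pair ` J. is_path {..<r + n} (hub_edges r n) s t (P (s, t))"
    using P by auto
  moreover have "card {m \<in> pair ` J. e \<in> path_edges (P m)} \<le> cap e" if "e \<in> hub_edges r n" for e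
  proof -
    obtain h v where e: "e = {h, r + v}" "h < r" "v < n" using \<open>e \<in> hub_edges r n\<close> by (auto simp: hub_edges_def)
    have use: "col j = h \<and> v \<in> leaf_ends r a b j" if "j \<in> J" "e \<in> path_edges (P (pair j))" for j
      using that es[OF that(1)] P e colr[OF that(1)] by (auto simp: doubleton_hub_eq)
    have "m = m'" if "m \<in> pair ` J" "e \<in> path_edges (P m)" "m' \<in> pair ` J" "e \<in> path_edges (P m')" for m m'
    proof -
      obtain j j' where j: "m = pair j" "j \<in> J" "m' = pair j'" "j' \<in> J" using \<open>m \<in> pair ` J\<close> \<open>m' \<in> pair ` J\<close> by blast
      then have "col j = col j'" "v \<in> leaf_ends r a b j \<inter> leaf_ends r a b j'"
        using use[of j] use[of j'] that by auto
      then have "j = j'" using col j unfolding hub_colouring_def by blast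
      then show ?thesis using j by simp
    qed
    then have "card {m \<in> pair ` J. e \<in> path_edges (P m)} \<le> Suc 0"
      using finite_J by (subst card_le_Suc0_iff_eq) auto
    then show ?thesis using cap \<open>e \<in> hub_edges r n\<close> by simp
  qed
  ultimately show ?thesis unfolding routable_def by blast
qed

text \<open>The first and last edges of all routes are distinct, so if there are as many of them as
  edges, then no route passes through a leaf.\<close>

lemma colouring_if_routable:
  assumes rt: "routable {..<r + n} (hub_edges r n) cap (pair ` J)"
    and cap: "\<And>e. e \<in> hub_edges r n \<Longrightarrow> cap e = 1"
    and many: "r * n \<le> (\<Sum>j\<in>J. card (leaf_ends r a b j))"
  shows "(\<Sum>j\<in>J. card (leaf_ends r a b j)) = r * n \<and>
    (\<exists>col. hub_colouring r a b J col \<and>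
      (\<forall>h<r. \<forall>v<n. \<exists>j\<in>J. v \<in> leaf_ends r a b j \<and> col j = h))"
proof -
  from rt obtain P where "\<forall>(s, t)\<in>pair ` J. is_path {..<r + n} (hub_edges r n) s t (P (s, t))"
    "\<forall>e\<in>hub_edges r n. card {m \<in> pair ` J. e \<in> path_edges (P m)} \<le> cap e"
    unfolding routable_def by blast
  then have P: "\<And>j. j \<in> J \<Longrightarrow> is_path {..<r + n} (hub_edges r n) (r + a j) (b j) (P (pair j))"
    and card_le: "\<And>e. e \<in> hub_edges r n \<Longrightarrow> card {m \<in> pair ` J. e \<in> path_edges (P m)} \<le> 1"
    using cap by auto
  define p where "p j = P (pair j)" for j
  have p: "hd (p j) = r + a j" "last (p j) = b j" "distinct (p j)" "p j \<noteq> []" "path_edges (p j) \<subseteq> hub_edges r n"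
    if "j \<in> J" for j
    using P[OF that] by (auto simp: p_def is_path_def)
  have uniq: "j = j'" if "j \<in> J" "j' \<in> J" "e \<in> path_edges (p j)" "e \<in> path_edges (p j')" for j j' e
  proof -
    have "e \<in> hub_edges r n" using p(5) that by blast
    then have "card {m \<in> pair ` J. e \<in> path_edges (P m)} \<le> Suc 0" using card_le by simp
    moreover have "pair j \<in> {m \<in> pair ` J. e \<in> path_edges (P m)}" "pair j' \<in> {m \<in> pair ` J. e \<in> path_edges (P m)}"
      using that by (simp_all add: p_def)
    moreover have "finite {m \<in> pair ` J. e \<in> path_edges (P m)}" using finite_J by simp
    ultimately have "pair j = pair j'" by (meson card_le_Suc0_iff_eq)
    then show ?thesis by (rule inj_onD[OF inj_pair]) (use that in auto)
  qed
  have len: "2 \<le> length (p j)" if "j \<in> J" for j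
  proof (rule ccontr)
    assume "\<not> 2 \<le> length (p j)"
    then have "length (p j) = 1" using p(4)[OF that] by (cases "p j") (auto simp: not_le)
    then have "hd (p j) = last (p j)" by (cases "p j") auto
    then show False using p(1,2)[OF that] a_neq_b[OF that] by simp
  qed
  have p0: "p j ! 0 = r + a j" "p j ! (length (p j) - 1) = b j" if "j \<in> J" for j
    using p[OF that] by (auto simp: hd_conv_nth last_conv_nth)
  \<comment> \<open>The edge by which the route of \<open>j\<close> meets its leaf end
    \<open>v\<close>: the first edge if \<open>v\<close> is the start, and otherwise the last
    one.\<close>
  define f where "f = (\<lambda>(j, v). {r + v, if v = a j then p j ! 1 else p j ! (length (p j) - 2)})"
  let ?S = "Sigma J (leaf_ends r a b)"
  have f_path: "f (j, v) \<in> path_edges (p j)" if "j \<in> J" "v \<in> leaf_ends r a b j" for j v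
  proof (cases "v = a j")
    case True
    then show ?thesis using path_edgesI[of 0 "p j"] len[OF that(1)] p0[OF that(1)] by (simp add: f_def)
  next
    case False
    then have "r + v = b j" using that(2) by (auto simp: leaf_ends_def split: if_splits)
    moreover have "Suc (length (p j) - 2) = length (p j) - 1" using len[OF that(1)] by simp
    ultimately show ?thesis
      using False path_edgesI[of "length (p j) - 2" "p j"] len[OF that(1)] p0[OF that(1)]
      by (simp add: f_def insert_commute)
  qed
  have f_edge: "f (j, v) \<in> hub_edges r n" if "j \<in> J" "v \<in> leaf_ends r a b j" for j v
    using f_path[OF that] p(5)[OF that(1)] by blast
  have leaf_unique: "v = v'" if "{r + v, x} = {r + v', y}" "{r + v, x} \<in> hub_edges r n" for v v' x y
  proof -
    have "x < r" using hub_edgesE(1)[OF that(2)] by simp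
    moreover have "y < r" using that hub_edgesE(1)[of "r + v'" y] by simp
    ultimately show ?thesis using that(1) by (auto simp: doubleton_eq_iff)
  qed
  have inj_f: "inj_on f ?S"
  proof (rule inj_onI, clarsimp)
    fix j v j' v' assume *: "j \<in> J" "v \<in> leaf_ends r a b j" "j' \<in> J" "v' \<in> leaf_ends r a b j'" "f (j, v) = f (j', v')"
    have "j = j'" using uniq[OF *(1,3) f_path[OF *(1,2)]] f_path[OF *(3,4)] *(5) by simp
    moreover have "v = v'"
      using *(5) f_edge[OF *(1,2)] unfolding f_def prod.case by (rule leaf_unique)
    ultimately show "j = j' \<and> v = v'" by simp
  qed
  have fin: "finite ?S" using finite_J by (auto simp: leaf_ends_def)
  have sub: "f ` ?S \<subseteq> hub_edges r n" using f_edge by auto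
  have "card ?S \<le> r * n"
    using card_inj_on_le[OF inj_f sub card_hub_edges(1)] by (simp add: card_hub_edges)
  moreover have "card ?S = (\<Sum>j\<in>J. card (leaf_ends r a b j))"
    using finite_J by (intro card_SigmaI) (auto simp: leaf_ends_def)
  ultimately have eq: "(\<Sum>j\<in>J. card (leaf_ends r a b j)) = r * n" "card ?S = r * n" using many by auto
  then have "card (f ` ?S) = card (hub_edges r n)" by (simp add: card_image[OF inj_f] card_hub_edges)
  \<comment> \<open>By counting, the end edges of the routes exhaust the graph.\<close>
  then have img: "f ` ?S = hub_edges r n"
    using sub card_hub_edges(1) by (simp add: card_subset_eq)
  \<comment> \<open>If an inner vertex were a leaf \<open>v\<close>, then the edge leaving it would
    be an end edge at \<open>v\<close> of some route; by unit capacity this is the same route, so a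
    path without repetition would visit its own end in between.\<close>
  have inner: "p j ! i < r" if j: "j \<in> J" and i: "0 < i" "Suc i < length (p j)" for j i
  proof (rule ccontr)
    assume "\<not> p j ! i < r"
    then obtain v where v: "p j ! i = r + v" by (metis le_Suc_ex not_less)
    have e: "{p j ! i, p j ! Suc i} \<in> path_edges (p j)" using i by (intro path_edgesI)
    then have "{r + v, p j ! Suc i} \<in> f ` ?S" using img p(5)[OF j] v by auto
    then obtain j' v' where jv: "j' \<in> J" "v' \<in> leaf_ends r a b j'" "f (j', v') = {r + v, p j ! Suc i}" by auto
    then have "v' = v"
      using jv(3) f_edge[OF jv(1,2)] unfolding f_def prod.case by (intro leaf_unique)
    moreover have "j' = j" using uniq[OF jv(1) j f_path[OF jv(1,2)]] e jv(3) v by simp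
    ultimately have "v \<in> leaf_ends r a b j" using jv by simp
    then have "p j ! i = p j ! 0 \<or> p j ! i = p j ! (length (p j) - 1)"
      using p0[OF j] v by (auto simp: leaf_ends_def split: if_splits)
    moreover have "p j ! i \<noteq> p j ! k" if "k = 0 \<or> k = length (p j) - 1" for k
      using p(3)[OF j] i that by (subst nth_eq_iff_index_eq) auto
    ultimately show False by blast
  qed
  have edge: "{p j ! i, p j ! Suc i} \<in> hub_edges r n" if "j \<in> J" "Suc i < length (p j)" for j i
    using path_edgesI[OF that(2)] p(5)[OF that(1)] by blast
  have p1: "p j ! 1 < r" if "j \<in> J" for j
    using edge[OF that, of 0] len[OF that] p0[OF that] hub_edgesE(1)[of "r + a j" "p j ! 1"] by simp
  \<comment> \<open>Hubs and leaves alternate along a route. A third vertex is therefore a leaf,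
    hence not an inner vertex, hence the last one.\<close>
  have shape: "if b j < r then p j ! 1 = b j else length (p j) = 3" if "j \<in> J" for j
  proof (cases "length (p j) = 2")
    case True
    then show ?thesis using p0[OF that] p1[OF that] by simp
  next
    case False
    then have l: "2 < length (p j)" using len[OF that] by simp
    then have "r \<le> p j ! 2"
      using edge[OF that, of 1] p1[OF that] hub_edgesE2(1)[of "p j ! 1" "p j ! 2"] by (simp add: numeral_2_eq_2)
    then have "length (p j) = 3" using inner[OF that, of 2] l by fastforce
    then show ?thesis using p0[OF that] \<open>r \<le> p j ! 2\<close> by simp
  qed
  have f_col: "f (j, v) = {p j ! 1, r + v}" if "j \<in> J" "v \<in> leaf_ends r a b j" for j v
    using that shape[OF that(1)] by (auto simp: f_def leaf_ends_def split: if_splits)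
  have "hub_colouring r a b J (\<lambda>j. p j ! 1)"
    unfolding hub_colouring_def
  proof (intro conjI ballI impI)
    fix j j' assume j: "j \<in> J" "j' \<in> J" "j \<noteq> j'" "leaf_ends r a b j \<inter> leaf_ends r a b j' \<noteq> {}"
    then obtain v where v: "v \<in> leaf_ends r a b j" "v \<in> leaf_ends r a b j'" by blast
    have "f (j, v) \<noteq> f (j', v)" using inj_f j v by (auto simp: inj_on_def)
    then show "p j ! 1 \<noteq> p j' ! 1" unfolding f_col[OF j(1) v(1)] f_col[OF j(2) v(2)] by auto
  next
    fix j assume "j \<in> J" "b j < r"
    then show "p j ! 1 = b j" using shape[of j] by simp
  qed (use p1 in auto)
  moreover have "\<exists>j\<in>J. v \<in> leaf_ends r a b j \<and> p j ! 1 = h" if "h < r" "v < n" for h v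
  proof -
    have "{h, r + v} \<in> f ` ?S" unfolding img using that by (auto simp: hub_edges_def)
    then obtain j v' where jv: "j \<in> J" "v' \<in> leaf_ends r a b j" "f (j, v') = {h, r + v}" by auto
    then have "p j ! 1 = h \<and> v' = v" using f_col[OF jv(1,2)] p1[OF jv(1)] that by (simp add: doubleton_hub_eq)
    then show ?thesis using jv by blast
  qed
  ultimately show ?thesis using eq by blast
qed

end

section \<open>Three-colourings of cubic demand systems as routing problems\<close>

text \<open>Demands \<open>d\<close> between the leaves \<open>S d\<close> and \<open>T d\<close>; a stub \<open>(v, c)\<close> occupies colour \<open>c\<close> at leaf \<open>v\<close>.
  Each leaf meets three demands or stubs.\<close>

locale cubic_demands =
  fixes n :: nat and DN :: "'d set" and S T :: "'d \<Rightarrow> nat" and St :: "(nat \<times> nat) set"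
  assumes finite_DN: "finite DN"
    and S_less: "d \<in> DN \<Longrightarrow> S d < n" and T_less: "d \<in> DN \<Longrightarrow> T d < n"
    and S_neq_T: "d \<in> DN \<Longrightarrow> S d \<noteq> T d"
    and inj_ST: "inj_on (\<lambda>d. (S d, T d)) DN"
    and St_sub: "St \<subseteq> {..<n} \<times> {..<3}"
    and cubic: "v < n \<Longrightarrow> card {d \<in> DN. v = S d \<or> v = T d} + card {c. (v, c) \<in> St} = 3"
begin

definition proper :: "('d \<Rightarrow> nat) \<Rightarrow> bool" where
  "proper col \<longleftrightarrow>
     (\<forall>d\<in>DN. col d < 3) \<and>
     (\<forall>d\<in>DN. \<forall>d'\<in>DN. d \<noteq> d' \<longrightarrow> {S d, T d} \<inter> {S d', T d'} \<noteq> {} \<longrightarrow> col d \<noteq> col d') \<and>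
     (\<forall>d\<in>DN. \<forall>(v, c)\<in>St. v \<in> {S d, T d} \<longrightarrow> col d \<noteq> c)"

text \<open>Stubs whose colour has no hub are dropped; for \<open>r = 2\<close> these are the stubs
  of colour 2.\<close>

definition items :: "nat \<Rightarrow> ('d + nat \<times> nat) set" where
  "items r = Inl ` DN \<union> Inr ` {(v, c) \<in> St. c < r}"

definition it_a :: "'d + nat \<times> nat \<Rightarrow> nat" where
  "it_a j = (case j of Inl d \<Rightarrow> S d | Inr vc \<Rightarrow> fst vc)"

definition it_b :: "nat \<Rightarrow> 'd + nat \<times> nat \<Rightarrow> nat" where
  "it_b r j = (case j of Inl d \<Rightarrow> r + T d | Inr vc \<Rightarrow> snd vc)"

abbreviation it_ends :: "nat \<Rightarrow> 'd + nat \<times> nat \<Rightarrow> nat set" where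
  "it_ends r \<equiv> leaf_ends r it_a (it_b r)"

definition terminal_pairs :: "nat \<Rightarrow> (nat \<times> nat) set" where
  "terminal_pairs r = (\<lambda>d. (r + S d, r + T d)) ` DN \<union> (\<lambda>(v, c). (r + v, c)) ` {(v, c) \<in> St. c < r}"

lemma finite_St: "finite St"
  using St_sub finite_subset by blast

lemma demand_family_items: "J \<subseteq> items r \<Longrightarrow> demand_family r n J it_a (it_b r)"
proof
  assume J: "J \<subseteq> items r"
  have "finite (items r)"
    using finite_DN finite_St by (auto simp: items_def intro: finite_subset[of _ St])
  then show "finite J" using J finite_subset by blast
  have "inj_on (\<lambda>j. (r + it_a j, it_b r j)) (items r)"
  proof (rule inj_onI)
    fix j j' assume j: "j \<in> items r" "j' \<in> items r" "(r + it_a j, it_b r j) = (r + it_a j', it_b r j')"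
    show "j = j'"
    proof (cases j; cases j')
      fix d d' assume *: "j = Inl d" "j' = Inl d'"
      have "d = d'"
        by (rule inj_onD[OF inj_ST]) (use j * in \<open>auto simp: items_def it_a_def it_b_def\<close>)
      then show ?thesis using * by simp
    qed (use j in \<open>auto simp: items_def it_a_def it_b_def\<close>)
  qed
  then show "inj_on (\<lambda>j. (r + it_a j, it_b r j)) J" using J inj_on_subset by blast
qed (use S_less T_less S_neq_T St_sub in \<open>force simp: items_def it_a_def it_b_def\<close>)+

lemma pair_items: "(\<lambda>j. (r + it_a j, it_b r j)) ` items r = terminal_pairs r"
  by (auto simp: terminal_pairs_def items_def it_a_def it_b_def image_Un image_image case_prod_unfold)

lemma it_ends_Inl: "it_ends r (Inl d) = {S d, T d}"
  by (simp add: leaf_ends_def it_a_def it_b_def)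

lemma it_ends_Inr: "c < r \<Longrightarrow> it_ends r (Inr (v, c)) = {v}"
  by (simp add: leaf_ends_def it_a_def it_b_def)

lemma items_at:
  "{j \<in> items r. v \<in> it_ends r j} = Inl ` {d \<in> DN. v = S d \<or> v = T d} \<union> Inr ` (Pair v ` {c. (v, c) \<in> St \<and> c < r})"
  by (auto simp: items_def it_ends_Inl it_ends_Inr)

lemma finite_stubs_at: "finite {c. (v, c) \<in> St \<and> P c}"
  using finite_imageI[OF finite_St, of snd] by (rule finite_subset[rotated]) force

lemma card_items_at:
  "card {j \<in> items r. v \<in> it_ends r j} = card {d \<in> DN. v = S d \<or> v = T d} + card {c. (v, c) \<in> St \<and> c < r}"
proof -
  have "card (Inr ` (Pair v ` {c. (v, c) \<in> St \<and> c < r}) :: ('d + nat \<times> nat) set) = card {c. (v, c) \<in> St \<and> c < r}"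
    by (simp add: card_image inj_on_def)
  moreover have "card (Inl ` {d \<in> DN. v = S d \<or> v = T d} :: ('d + nat \<times> nat) set) = card {d \<in> DN. v = S d \<or> v = T d}"
    by (simp add: card_image)
  moreover have "finite {d \<in> DN. v = S d \<or> v = T d}" using finite_DN by simp
  ultimately show ?thesis unfolding items_at
    by (subst card_Un_disjoint) (auto simp: finite_stubs_at)
qed

lemma card_items3_at: "v < n \<Longrightarrow> card {j \<in> items 3. v \<in> it_ends 3 j} = 3"
proof -
  assume "v < n"
  have "{c. (v, c) \<in> St \<and> c < 3} = {c. (v, c) \<in> St}" using St_sub by auto
  then show ?thesis using cubic[OF \<open>v < n\<close>] by (simp add: card_items_at)
qed

text \<open>Double counting of the incidences between items and leaves.\<close>

lemma sum_card_ends: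
  assumes "J \<subseteq> items r"
  shows "(\<Sum>j\<in>J. card (it_ends r j)) = (\<Sum>v<n. card {j \<in> J. v \<in> it_ends r j})"
proof -
  interpret demand_family r n J it_a "it_b r" using assms by (rule demand_family_items)
  have sub: "it_ends r j \<subseteq> {..<n}" if "j \<in> J" for j
    using a_less[OF that] b_less[OF that] by (auto simp: leaf_ends_def)
  have "(\<Sum>j\<in>J. card (it_ends r j)) = (\<Sum>j\<in>J. \<Sum>v<n. if v \<in> it_ends r j then 1 else 0)"
  proof (rule sum.cong[OF refl])
    fix j assume "j \<in> J"
    then have "{..<n} \<inter> it_ends r j = it_ends r j" using sub by blast
    then show "card (it_ends r j) = (\<Sum>v<n. if v \<in> it_ends r j then 1 else 0)"
      by (simp add: sum.If_cases)
  qed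
  also have "\<dots> = (\<Sum>v<n. \<Sum>j\<in>J. if v \<in> it_ends r j then 1 else 0)" by (rule sum.swap)
  also have "\<dots> = (\<Sum>v<n. card {j \<in> J. v \<in> it_ends r j})"
    using finite_J by (intro sum.cong refl) (simp add: sum.If_cases Int_def)
  finally show ?thesis .
qed

text \<open>A demand has two leaf ends but a stub only one, hence the correction by the number of
  stubs.\<close>

lemma sum_card_ends':
  assumes "J \<subseteq> items r"
  shows "(\<Sum>j\<in>J. card (it_ends r j)) + card (J \<inter> range Inr) = 2 * card J"
proof -
  interpret demand_family r n J it_a "it_b r" using assms by (rule demand_family_items)
  have "(\<Sum>j\<in>J. card (it_ends r j)) + card (J \<inter> range Inr)
     = (\<Sum>j\<in>J. card (it_ends r j) + (if j \<in> range Inr then 1 else 0))"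
    using finite_J by (simp add: sum.distrib sum.If_cases)
  also have "\<dots> = (\<Sum>j\<in>J. 2)"
    by (rule sum.cong) (use assms S_neq_T in \<open>auto simp: items_def it_ends_Inl it_ends_Inr\<close>)
  finally show ?thesis by simp
qed

text \<open>Two demands, or a demand and a stub, that meet at a leaf differ in colour by properness;
  two stubs with the same leaf and the same colour are the same pair.\<close>

lemma proper_inj:
  assumes col: "proper col" and j: "j \<in> items 3" "j' \<in> items 3" "v \<in> it_ends 3 j" "v \<in> it_ends 3 j'"
    and eq: "case_sum col snd j = case_sum col snd j'"
  shows "j = j'"
proof -
  have dd: "d = d'" if "d \<in> DN" "d' \<in> DN" "v \<in> {S d, T d}" "v \<in> {S d', T d'}" "col d = col d'" for d d'
    using col that unfolding proper_def by (metis disjoint_iff)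
  have ds: False if "d \<in> DN" "(v, c) \<in> St" "v \<in> {S d, T d}" "col d = c" for d c
    using col that unfolding proper_def by fastforce
  show ?thesis
  proof (cases j; cases j')
    fix d d' assume *: "j = Inl d" "j' = Inl d'"
    then show ?thesis using dd[of d d'] j eq by (auto simp: items_def it_ends_Inl)
  next
    fix d x assume *: "j = Inl d" "j' = Inr x"
    then show ?thesis using ds[of d "snd x"] j eq by (cases x) (auto simp: items_def it_ends_Inl it_ends_Inr)
  next
    fix d x assume *: "j = Inr x" "j' = Inl d"
    have "d \<in> DN" "x \<in> St" "v \<in> {S d, T d}" "col d = snd x" "fst x = v"
      using j eq * by (auto simp: items_def it_ends_Inl it_ends_Inr)
    then show ?thesis using ds[of d "snd x"] by (metis prod.collapse)
  next
    fix x y assume *: "j = Inr x" "j' = Inr y"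
    then show ?thesis using j eq by (cases x; cases y) (auto simp: items_def it_ends_Inr)
  qed
qed

lemma proper_less: "proper col \<Longrightarrow> j \<in> items 3 \<Longrightarrow> case_sum col snd j < 3"
  by (auto simp: proper_def items_def)

text \<open>Colours are hubs; in the presence of two hubs only, colour 2 stands for not being routed.\<close>

theorem routable_iff_proper:
  assumes cap: "\<And>e. e \<in> hub_edges 3 n \<Longrightarrow> cap e = 1"
  shows "routable {..<3 + n} (hub_edges 3 n) cap (terminal_pairs 3) \<longleftrightarrow> (\<exists>col. proper col)"
proof -
  interpret demand_family 3 n "items 3" it_a "it_b 3" by (rule demand_family_items) simp
  show ?thesis
  proof
    assume "routable {..<3 + n} (hub_edges 3 n) cap (terminal_pairs 3)"
    moreover have "(\<Sum>j\<in>items 3. card (it_ends 3 j)) = 3 * n"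
      by (subst sum_card_ends) (simp_all add: card_items3_at)
    ultimately obtain col where col: "hub_colouring 3 it_a (it_b 3) (items 3) col"
      using colouring_if_routable[of cap] cap by (auto simp: pair_items)
    have "proper (\<lambda>d. col (Inl d))"
      unfolding proper_def
    proof (intro conjI ballI impI, goal_cases)
      case (1 d)
      then show ?case using col by (auto simp: hub_colouring_def items_def)
    next
      case (2 d d')
      then have "Inl d \<in> items 3" "Inl d' \<in> items 3" "it_ends 3 (Inl d) \<inter> it_ends 3 (Inl d') \<noteq> {}"
        by (auto simp: items_def it_ends_Inl)
      then show ?case using col 2(3) unfolding hub_colouring_def by blast
    next
      case (3 d x)
      obtain v c where x: "x = (v, c)" by (cases x)
      have "v \<in> {S d, T d} \<longrightarrow> col (Inl d) \<noteq> c"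
      proof
        assume v: "v \<in> {S d, T d}"
        have c: "c < 3" using 3 x St_sub by auto
        have "Inl d \<in> items 3" "Inr (v, c) \<in> items 3" using 3 x c by (auto simp: items_def)
        moreover have "it_ends 3 (Inl d) \<inter> it_ends 3 (Inr (v, c)) \<noteq> {}"
          using v c by (auto simp: it_ends_Inl it_ends_Inr)
        moreover have "it_b 3 (Inr (v, c)) = c" by (simp add: it_b_def)
        ultimately show "col (Inl d) \<noteq> c"
          using col c unfolding hub_colouring_def by (metis Inl_Inr_False)
      qed
      then show ?case by (simp add: x)
    qed
    then show "\<exists>col. proper col" by blast
  next
    assume "\<exists>col. proper col"
    then obtain col where col: "proper col" by blast
    have "hub_colouring 3 it_a (it_b 3) (items 3) (case_sum col snd)"
      unfolding hub_colouring_def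
    proof (intro conjI ballI impI)
      fix j j' assume "j \<in> items 3" "j' \<in> items 3" "j \<noteq> j'" "it_ends 3 j \<inter> it_ends 3 j' \<noteq> {}"
      then show "case_sum col snd j \<noteq> case_sum col snd j'" using proper_inj[OF col] by blast
    next
      fix j assume "j \<in> items 3" "it_b 3 j < 3"
      then show "case_sum col snd j = it_b 3 j" by (auto simp: items_def it_b_def)
    qed (rule proper_less[OF col])
    then show "routable {..<3 + n} (hub_edges 3 n) cap (terminal_pairs 3)"
      using routable_if_colouring[of _ cap] cap by (simp add: pair_items)
  qed
qed

text \<open>The threshold is the number of items in a routing that uses up all \<open>2 * n\<close>
  edges and contains all stubs of colour below 2. Among \<open>k\<close> routed items at most that
  many are stubs, so together they have at least \<open>2 * n\<close> leaf ends, which is already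
  the number of edges. Hence equality holds throughout: all these stubs are routed, and at most one
  item per leaf is not, where a stub of colour 2 counts as not routed. Unrouted demands can then be
  coloured 2.\<close>

theorem max_routable_iff_proper:
  assumes cap: "\<And>e. e \<in> hub_edges 2 n \<Longrightarrow> cap e = 1"
    and k: "2 * k = 2 * n + card {(v, c) \<in> St. c < 2}"
  shows "k \<le> max_routable {..<2 + n} (hub_edges 2 n) cap (terminal_pairs 2) \<longleftrightarrow> (\<exists>col. proper col)"
proof -
  let ?rt = "routable {..<2 + n} (hub_edges 2 n) cap"
  let ?pair = "\<lambda>j. (2 + it_a j, it_b 2 j)"
  interpret I: demand_family 2 n "items 2" it_a "it_b 2" by (rule demand_family_items) simp
  let ?C = "{card M' | M'. M' \<subseteq> terminal_pairs 2 \<and> ?rt M'}"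
  have fin: "finite ?C"
  proof -
    have "finite (terminal_pairs 2)" using I.finite_J pair_items[of 2] by (metis finite_imageI)
    then show ?thesis by simp
  qed
  have "?rt {}" by (simp add: routable_def)
  then have ne: "?C \<noteq> {}" by blast
  have "k \<le> max_routable {..<2 + n} (hub_edges 2 n) cap (terminal_pairs 2) \<longleftrightarrow> (\<exists>M'\<subseteq>terminal_pairs 2. ?rt M' \<and> k \<le> card M')"
    unfolding max_routable_def by (subst Max_ge_iff[OF fin ne]) auto
  also have "\<dots> \<longleftrightarrow> (\<exists>J\<subseteq>items 2. ?rt (?pair ` J) \<and> k \<le> card J)"
  proof
    assume "\<exists>M'\<subseteq>terminal_pairs 2. ?rt M' \<and> k \<le> card M'"
    then obtain M' where M': "M' \<subseteq> terminal_pairs 2" "?rt M'" "k \<le> card M'" by blast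
    then have "M' \<subseteq> ?pair ` items 2" unfolding pair_items by blast
    then obtain J where J: "J \<subseteq> items 2" "M' = ?pair ` J" by (rule subset_imageE)
    then have "card J = card M'" using card_image[OF inj_on_subset[OF I.inj_pair J(1)]] by simp
    then show "\<exists>J\<subseteq>items 2. ?rt (?pair ` J) \<and> k \<le> card J" using M' J by auto
  next
    assume "\<exists>J\<subseteq>items 2. ?rt (?pair ` J) \<and> k \<le> card J"
    then obtain J where J: "J \<subseteq> items 2" "?rt (?pair ` J)" "k \<le> card J" by blast
    have "?pair ` J \<subseteq> terminal_pairs 2" using image_mono[OF J(1), of ?pair] unfolding pair_items .
    moreover have "card (?pair ` J) = card J" by (rule card_image[OF inj_on_subset[OF I.inj_pair J(1)]])
    ultimately show "\<exists>M'\<subseteq>terminal_pairs 2. ?rt M' \<and> k \<le> card M'" using J by auto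
  qed
  also have "\<dots> \<longleftrightarrow> (\<exists>col. proper col)"
  proof
    assume "\<exists>J\<subseteq>items 2. ?rt (?pair ` J) \<and> k \<le> card J"
    then obtain J where J: "J \<subseteq> items 2" "?rt (?pair ` J)" "k \<le> card J" by blast
    interpret demand_family 2 n J it_a "it_b 2" by (rule demand_family_items[OF J(1)])
    let ?h = "card {(v, c) \<in> St. c < 2}"
    let ?St = "Inr ` {(v, c) \<in> St. c < 2} :: ('d + nat \<times> nat) set"
    have sub: "J \<inter> range Inr \<subseteq> ?St" using J(1) by (auto simp: items_def)
    have finSt: "finite ?St" using finite_St by (auto intro: finite_subset[of _ St])
    have cSt: "card ?St = ?h" by (simp add: card_image)
    have le: "card (J \<inter> range Inr) \<le> ?h" using card_mono[OF finSt sub] cSt by simp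
    have sum: "(\<Sum>j\<in>J. card (it_ends 2 j)) + card (J \<inter> range Inr) = 2 * card J"
      by (rule sum_card_ends'[OF J(1)])
    then have "2 * n \<le> (\<Sum>j\<in>J. card (it_ends 2 j))" using le k J(3) by linarith
    from colouring_if_routable[OF J(2) cap this] obtain col
      where eq: "(\<Sum>j\<in>J. card (it_ends 2 j)) = 2 * n" and col: "hub_colouring 2 it_a (it_b 2) J col"
        and all: "\<And>h v. h < 2 \<Longrightarrow> v < n \<Longrightarrow> \<exists>j\<in>J. v \<in> it_ends 2 j \<and> col j = h" by blast
    have "card (J \<inter> range Inr) = card ?St" using eq sum le k J(3) cSt by linarith
    then have stubs: "?St \<subseteq> J" using card_subset_eq[OF finSt sub] by blast
    have two: "2 \<le> card {j \<in> J. v \<in> it_ends 2 j}" if v: "v < n" for v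
    proof -
      obtain j j' where "j \<in> J" "v \<in> it_ends 2 j" "col j = 0" "j' \<in> J" "v \<in> it_ends 2 j'" "col j' = 1"
        using all[of 0 v] all[of 1 v] v by auto
      moreover from this have "j \<noteq> j'" by auto
      ultimately have "card {j, j'} = 2" "{j, j'} \<subseteq> {j \<in> J. v \<in> it_ends 2 j}" by auto
      then show ?thesis using card_mono[of "{j \<in> J. v \<in> it_ends 2 j}" "{j, j'}"] finite_J by simp
    qed
    \<comment> \<open>At least two of the three items at a leaf are routed, so unrouted demands and
      a stub of colour 2 together number at most one.\<close>
    have unrouted: "card A + 2 + card {c. (v, c) \<in> St \<and> c = 2} \<le> 3"
      if v: "v < n" and A: "A \<subseteq> {d \<in> DN. v = S d \<or> v = T d}" "\<And>d. d \<in> A \<Longrightarrow> Inl d \<notin> J" for v A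
    proof -
      have "finite A" using A(1) finite_DN by (auto intro: finite_subset)
      moreover have "Inl ` A \<inter> {j \<in> J. v \<in> it_ends 2 j} = {}" using A by auto
      ultimately have "card A + card {j \<in> J. v \<in> it_ends 2 j} = card (Inl ` A \<union> {j \<in> J. v \<in> it_ends 2 j})"
        using finite_J by (subst card_Un_disjoint) (auto simp: card_image)
      also have "\<dots> \<le> card {j \<in> items 2. v \<in> it_ends 2 j}"
        by (rule card_mono) (use I.finite_J J(1) A(1) in \<open>auto simp: items_def it_ends_Inl\<close>)
      also have "\<dots> + card {c. (v, c) \<in> St \<and> c = 2} = 3"
      proof -
        have "{c. (v, c) \<in> St} = {c. (v, c) \<in> St \<and> c < 2} \<union> {c. (v, c) \<in> St \<and> c = 2}"
          using St_sub by auto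
        then have "card {c. (v, c) \<in> St} = card {c. (v, c) \<in> St \<and> c < 2} + card {c. (v, c) \<in> St \<and> c = 2}"
          using finite_stubs_at by (simp only:, subst card_Un_disjoint) auto
        then show ?thesis using cubic[OF v] by (simp add: card_items_at)
      qed
      finally show ?thesis using two[OF v] by linarith
    qed
    have colJ: "col j < 2" if "j \<in> J" for j using col that by (auto simp: hub_colouring_def)
    define col' where "col' d = (if Inl d \<in> J then col (Inl d) else 2)" for d
    have "proper col'"
      unfolding proper_def
    proof (intro conjI ballI impI, goal_cases)
      case (1 d)
      then show ?case using colJ[of "Inl d"] by (auto simp: col'_def)
    next
      case (2 d d')
      then obtain v where v: "v = S d \<or> v = T d" "v = S d' \<or> v = T d'" by auto
      then have "v < n" using 2 S_less T_less by blast
      have "\<not> (Inl d \<notin> J \<and> Inl d' \<notin> J)"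
        using unrouted[OF \<open>v < n\<close>, of "{d, d'}"] 2 v by auto
      moreover have "col (Inl d) \<noteq> col (Inl d')" if "Inl d \<in> J" "Inl d' \<in> J"
        using col that 2 unfolding hub_colouring_def by (metis it_ends_Inl sum.inject(1))
      ultimately show ?case
        using colJ[of "Inl d"] colJ[of "Inl d'"] by (auto simp: col'_def)
    next
      case (3 d x)
      obtain v c where x: "x = (v, c)" by (cases x)
      have "v \<in> {S d, T d} \<longrightarrow> col' d \<noteq> c"
      proof
        assume v: "v \<in> {S d, T d}"
        then have "v < n" using 3 S_less T_less by blast
        have c: "(v, c) \<in> St" "c < 3" using 3 x St_sub by auto
        consider "c = 2" | "c < 2" using c by linarith
        then show "col' d \<noteq> c"
        proof cases
          case 1
          then have "{c. (v, c) \<in> St \<and> c = 2} = {2}" using c by auto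
          then have "card {c. (v, c) \<in> St \<and> c = 2} = 1" by simp
          then have "Inl d \<in> J" using unrouted[OF \<open>v < n\<close>, of "{d}"] 3 v by auto
          then show ?thesis using colJ[of "Inl d"] 1 by (auto simp: col'_def)
        next
          case 2
          then have st: "Inr (v, c) \<in> J" using stubs c by auto
          have "it_ends 2 (Inl d) \<inter> it_ends 2 (Inr (v, c)) \<noteq> {}"
            using v 2 by (auto simp: it_ends_Inl it_ends_Inr)
          moreover have "it_b 2 (Inr (v, c)) = c" by (simp add: it_b_def)
          ultimately have "col (Inl d) \<noteq> c" if "Inl d \<in> J"
            using col st that 2 unfolding hub_colouring_def by (metis Inl_Inr_False)
          then show ?thesis using 2 by (auto simp: col'_def)
        qed
      qed
      then show ?case by (simp add: x)
    qed
    then show "\<exists>col. proper col" by blast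
  next
    assume "\<exists>col. proper col"
    then obtain col where col: "proper col" by blast
    define c' where "c' = case_sum col (snd :: nat \<times> nat \<Rightarrow> nat)"
    \<comment> \<open>Each leaf sees every colour exactly once, so keeping the colours 0 and 1
      retains exactly two items per leaf. This gives the \<open>2 * n\<close> leaf ends on which the
      threshold is based.\<close>
    define J where "J = {j \<in> items 3. c' j < 2}"
    have items2: "items 2 \<subseteq> items 3" by (auto simp: items_def)
    have J2: "J \<subseteq> items 2" by (auto simp: J_def items_def c'_def)
    have ends: "it_ends 2 j = it_ends 3 j" if "j \<in> items 2" for j
      using that by (auto simp: items_def it_ends_Inl it_ends_Inr)
    have inj: "inj_on c' {j \<in> items 3. v \<in> it_ends 3 j}" for v
      using proper_inj[OF col] unfolding inj_on_def c'_def by blast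
    have at: "card {j \<in> J. v \<in> it_ends 2 j} = 2" if v: "v < n" for v
    proof -
      let ?A = "{j \<in> items 3. v \<in> it_ends 3 j}"
      have "c' ` ?A \<subseteq> {..<3}"
        using proper_less[OF col] unfolding c'_def by blast
      moreover have "card (c' ` ?A) = 3" using card_image[OF inj] card_items3_at[OF v] by simp
      ultimately have img: "c' ` ?A = {..<3}" by (simp add: card_subset_eq)
      have "{j \<in> J. v \<in> it_ends 2 j} = {j \<in> ?A. c' j < 2}" using J2 ends by (auto simp: J_def)
      moreover have "card {j \<in> ?A. c' j < 2} = card (c' ` {j \<in> ?A. c' j < 2})"
        by (rule card_image[symmetric]) (rule inj_on_subset[OF inj], auto)
      moreover have "c' ` {j \<in> ?A. c' j < 2} = {..<2}"
      proof (intro equalityI subsetI)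
        fix c :: nat assume "c \<in> {..<2}"
        then have "c \<in> c' ` ?A" unfolding img by simp
        then show "c \<in> c' ` {j \<in> ?A. c' j < 2}" using \<open>c \<in> {..<2}\<close> by auto
      qed auto
      ultimately show ?thesis by simp
    qed
    have "(\<Sum>j\<in>J. card (it_ends 2 j)) = 2 * n" by (subst sum_card_ends[OF J2]) (simp add: at)
    moreover have "J \<inter> range Inr = Inr ` {(v, c) \<in> St. c < 2}"
      using St_sub by (auto simp: J_def items_def c'_def)
    then have "card (J \<inter> range Inr) = card {(v, c) \<in> St. c < 2}" by (simp add: card_image)
    ultimately have "card J = k" using sum_card_ends'[OF J2] k by linarith
    interpret demand_family 2 n J it_a "it_b 2" by (rule demand_family_items[OF J2])
    have "hub_colouring 2 it_a (it_b 2) J c'"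
      unfolding hub_colouring_def
    proof (intro conjI ballI impI)
      fix j j' assume j: "j \<in> J" "j' \<in> J" "j \<noteq> j'" "it_ends 2 j \<inter> it_ends 2 j' \<noteq> {}"
      then obtain v where "v \<in> it_ends 2 j" "v \<in> it_ends 2 j'" by blast
      then show "c' j \<noteq> c' j'" using inj[of v] j ends J2 by (auto simp: inj_on_def J_def subset_iff)
    next
      fix j assume j: "j \<in> J" "it_b 2 j < 2"
      then show "c' j = it_b 2 j" by (auto simp: J_def items_def c'_def it_b_def)
    qed (simp add: J_def)
    then have "?rt (?pair ` J)" using routable_if_colouring[of _ cap] cap by blast
    then show "\<exists>J\<subseteq>items 2. ?rt (?pair ` J) \<and> k \<le> card J" using J2 \<open>card J = k\<close> by blast
  qed
  finally show ?thesis .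
qed

end

section \<open>Hub instances and their feedback vertex number\<close>

definition hub_instance :: "nat \<Rightarrow> nat \<Rightarrow> (nat \<times> nat) list \<Rightarrow> edp_instance" where
  "hub_instance r n ps =
     \<lparr>order = r + n, edge_list = concat (map (\<lambda>v. map (\<lambda>h. (h, r + v, 1)) [0..<r]) [0..<n]),
      pair_list = ps\<rparr>"

lemma set_edge_list_hub: "set (edge_list (hub_instance r n ps)) = (\<lambda>(h, v). (h, r + v, 1)) ` ({..<r} \<times> {..<n})"
  by (auto simp: hub_instance_def)

lemma hub_instance_simps:
  "verts (hub_instance r n ps) = {..<r + n}" "edges (hub_instance r n ps) = hub_edges r n"
  "pairs (hub_instance r n ps) = set ps"
proof -
  show "edges (hub_instance r n ps) = hub_edges r n"
    by (simp add: edges_def set_edge_list_hub hub_edges_def image_image case_prod_unfold)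
qed (simp_all add: verts_def pairs_def hub_instance_def)

lemma hub_instance_capacity:
  assumes "e \<in> hub_edges r n"
  shows "capacity (hub_instance r n ps) e = 1"
proof -
  let ?m = "map (\<lambda>(u, v, c). ({u, v}, c)) (edge_list (hub_instance r n ps))"
  obtain h v where e: "e = {h, r + v}" "h < r" "v < n" using assms by (auto simp: hub_edges_def)
  then have "(h, r + v, 1) \<in> set (edge_list (hub_instance r n ps))" by (auto simp: set_edge_list_hub)
  then have "({h, r + v}, 1) \<in> set ?m" by force
  then obtain c where c: "map_of ?m e = Some c"
    using e by (metis weak_map_of_SomeI)
  then have "(e, c) \<in> set ?m" by (rule map_of_SomeD)
  then have "c = 1" by (auto simp: set_edge_list_hub)
  then show ?thesis using c by (simp add: capacity_def)
qed

lemma hub_instance_valid: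
  assumes "distinct ps" "\<And>s t. (s, t) \<in> set ps \<Longrightarrow> s < r + n \<and> t < r + n"
  shows "valid_instance (hub_instance r n ps)"
proof -
  have "distinct (concat (map (\<lambda>v. map (\<lambda>h. (h, r + v)) [0..<r]) [0..<n]))"
  proof -
    have "distinct (map (\<lambda>(v, h). (h, r + v)) (List.product [0..<n] [0..<r]))"
      by (auto simp: distinct_map distinct_product inj_on_def)
    then show ?thesis by (simp add: product_concat_map map_concat o_def)
  qed
  then have "distinct (map (\<lambda>(u, v, c). (u, v)) (edge_list (hub_instance r n ps)))"
    by (simp add: hub_instance_def map_concat o_def)
  then show ?thesis
    using assms unfolding valid_instance_def set_edge_list_hub by (auto simp: hub_instance_def)
qed

text \<open>Deleting all hubs but one leaves a star and isolated vertices at most. If fewer than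
  \<open>r - 1\<close> vertices are deleted, then two hubs and, by \<open>r \<le> n\<close>, two
  leaves survive, and these four form a cycle.\<close>

lemma fvs_number_hub:
  assumes "2 \<le> r" "r \<le> n"
  shows "fvs_number {..<r + n} (hub_edges r n) = r - 1"
proof -
  let ?V = "{..<r + n}" and ?E = "hub_edges r n"
  have edge: "{h, r + v} \<in> ?E" if "h < r" "v < n" for h v using that by (auto simp: hub_edges_def)
  have "feedback_vertex_set ?V ?E {..<r - 1}"
    unfolding feedback_vertex_set_def
  proof (intro conjI notI)
    assume "\<exists>p. is_cycle (?V - {..<r - 1}) ?E p"
    then obtain p where p: "3 \<le> length p" "distinct p" "set p \<subseteq> ?V - {..<r - 1}" "path_edges p \<subseteq> ?E" "{last p, hd p} \<in> ?E"
      unfolding is_cycle_def by blast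
    have hub: "x = r - 1 \<or> y = r - 1" if "{x, y} \<in> ?E" "x \<in> set p" "y \<in> set p" for x y
      using that p(3) assms by (fastforce simp: hub_edges_def doubleton_eq_iff)
    \<comment> \<open>Each of these three edges would have to contain the one remaining hub, but
      they have no vertex in common.\<close>
    have "{p ! 0, p ! Suc 0} \<in> ?E" "{p ! 1, p ! Suc 1} \<in> ?E"
      using path_edgesI[of 0 p] path_edgesI[of 1 p] p(1,4) by auto
    moreover have "{p ! (length p - 1), p ! 0} \<in> ?E"
      using p(1,5) by (simp add: last_conv_nth hd_conv_nth flip: length_greater_0_conv)
    moreover have mem: "p ! 0 \<in> set p" "p ! 1 \<in> set p" "p ! 2 \<in> set p" "p ! (length p - 1) \<in> set p"
      using p(1) by (auto intro: nth_mem)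
    ultimately have "p ! 0 = r - 1 \<or> p ! 1 = r - 1" "p ! 1 = r - 1 \<or> p ! 2 = r - 1"
       "p ! (length p - 1) = r - 1 \<or> p ! 0 = r - 1"
      using hub by (auto simp: numeral_2_eq_2)
    moreover have "p ! i \<noteq> p ! k" if "i \<noteq> k" "i < length p" "k < length p" for i k
      using p(2) that by (simp add: nth_eq_iff_index_eq)
    moreover have "0 < length p" "1 < length p" "2 < length p" "length p - 1 < length p" "length p - 1 \<noteq> 1" "length p - 1 \<noteq> 0"
      using p(1) by auto
    ultimately show False by (metis one_neq_zero zero_neq_numeral)
  qed (use assms in auto)
  moreover have "r - 1 \<le> card R" if R: "feedback_vertex_set ?V ?E R" for R
  proof (rule ccontr)
    assume "\<not> r - 1 \<le> card R"
    then have c: "card R \<le> r - 2" by simp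
    have fin: "finite R" using R by (auto simp: feedback_vertex_set_def intro: finite_subset)
    have two: "\<exists>x\<in>A - R. \<exists>y\<in>A - R. x \<noteq> y" if "finite A" "r \<le> card A" for A
    proof -
      have "2 \<le> card (A - R)" using diff_card_le_card_Diff[OF fin, of A] that c assms by linarith
      then show ?thesis using \<open>finite A\<close> card_le_Suc0_iff_eq[of "A - R"] by force
    qed
    obtain h h' where h: "h < r" "h' < r" "h \<noteq> h'" "h \<notin> R" "h' \<notin> R"
      using two[of "{..<r}"] by auto
    obtain v v' where v: "r \<le> v" "v < r + n" "r \<le> v'" "v' < r + n" "v \<noteq> v'" "v \<notin> R" "v' \<notin> R"
      using two[of "{r..<r + n}"] assms by auto
    have e: "{x, y} \<in> ?E" if "x < r" "r \<le> y" "y < r + n" for x y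
      using edge[of x "y - r"] that by simp
    have "path_edges [h, v, h', v'] = {{h, v}, {v, h'}, {h', v'}}"
    proof -
      have "{i. Suc i < length [h, v, h', v']} = {0, 1, 2}" by auto
      moreover have "path_edges p = (\<lambda>i. {p ! i, p ! Suc i}) ` {i. Suc i < length p}" for p :: "nat list"
        by (auto simp: path_edges_def)
      ultimately show ?thesis by (simp add: numeral_2_eq_2)
    qed
    then have "is_cycle (?V - R) ?E [h, v, h', v']"
      using h v e[of h v] e[of h' v] e[of h' v'] e[of h v'] unfolding is_cycle_def
      by (auto simp: insert_commute)
    then show False using R unfolding feedback_vertex_set_def by blast
  qed
  ultimately show ?thesis unfolding fvs_number_def
    by (intro Least_equality) (auto intro!: exI[of _ "{..<r - 1}"])
qed

lemma hub_instance_unit_capacity_fvs: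
  assumes "2 \<le> r" "r \<le> n" "distinct ps" "\<And>s t. (s, t) \<in> set ps \<Longrightarrow> s < r + n \<and> t < r + n"
  shows "hub_instance r n ps \<in> unit_capacity_fvs (r - 1)"
  using assms hub_instance_valid[OF assms(3,4)] fvs_number_hub[OF assms(1,2)]
  by (auto simp: unit_capacity_fvs_def unit_capacity_def hub_instance_simps hub_instance_capacity)

section \<open>Gadgets that express tilings by colourings\<close>

datatype lv = W nat | Z nat | Q nat | V nat nat | U nat nat | Y nat | R nat

text \<open>\<open>Lk\<close> are the links of the path of the vertices \<open>W\<close>,
  \<open>X\<close> the selectors of the tiles, \<open>Fd\<close> feeds the chain of a tile,
  \<open>In\<close> are the links of this chain, and \<open>Cf\<close> hands its state to a vertex
  \<open>U\<close>. In a conflict test, \<open>Gt\<close> is converted into \<open>Gr\<close> at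
  \<open>R\<close>, and \<open>Gs\<close> and \<open>Gr\<close> meet at \<open>Y\<close>. The other
  components of a vertex or a demand are the cell and the copy.\<close>

datatype dn = Lk nat | X nat | Fd nat | In nat nat | Cf nat nat | Gs nat | Gt nat | Gr nat | Jn lv

type_synonym vertex = "lv \<times> nat \<times> bool"
type_synonym demand = "dn \<times> nat \<times> bool"

datatype item = Stub nat | Dem demand

lemma mod3_div3:
  "3 * c = k \<longleftrightarrow> k div 3 = c \<and> k mod 3 = 0" "Suc (3 * c) = k \<longleftrightarrow> k div 3 = c \<and> k mod 3 = 1" for k c :: nat
  by presburger+

lemma rotate_iff:
  fixes N o' j j' :: nat
  assumes "o' < N" "j < N" "j' < N"
  shows "(j' + o') mod N = j \<longleftrightarrow> j' = (j + (N - o')) mod N"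
proof -
  have "(j' + o') mod N = (if j' + o' < N then j' + o' else j' + o' - N)"
    using assms by (auto simp: le_mod_geq)
  moreover have "(j + (N - o')) mod N = (if j < o' then j + (N - o') else j - o')"
    using assms by (auto simp: le_mod_geq)
  ultimately show ?thesis using assms by auto
qed

text \<open>
  Tile \<open>\<theta>\<close> of a cell is selected if the demand \<open>X \<theta>\<close> has colour 2. The vertices \<open>W i\<close> force some tile
  to be selected. Along the chain \<open>V \<theta> 0, V \<theta> 1, \<dots>\<close> this information is copied to the vertices \<open>U \<theta> k\<close>:
  \<open>U \<theta> (3 c)\<close> and \<open>U \<theta> (3 c + 1)\<close> are there for \<open>\<theta>\<close> being the first and second tile of conflict \<open>c < C\<close>,
  which is tested at \<open>Y c\<close>; for \<open>c = C, C + 1\<close>, the vertex \<open>U \<theta> (3 c + 1)\<close> serves to forbid \<open>\<theta>\<close> in a cell.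
  A vertex that meets only two demands is joined by \<open>Jn\<close> to its twin in a second copy of the construction.
\<close>

locale gadget_shape =
  fixes m C :: nat and sc tc :: "nat \<Rightarrow> nat"
  assumes m_pos: "0 < m" and sc_less: "c < C \<Longrightarrow> sc c < m" and tc_less: "c < C \<Longrightarrow> tc c < m"
begin

text \<open>Colours along a chain have period 3, so each conflict and each of the two blocking slots
  receives a block of three stages.\<close>

definition stages :: nat where
  "stages = 3 * (C + 2)"

primrec is_vertex :: "lv \<Rightarrow> bool" where
  "is_vertex (W i) \<longleftrightarrow> i < 2 * m - 1"
| "is_vertex (Z \<theta>) \<longleftrightarrow> \<theta> < m"
| "is_vertex (Q \<theta>) \<longleftrightarrow> \<theta> < m"
| "is_vertex (V \<theta> k) \<longleftrightarrow> \<theta> < m \<and> k < stages"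
| "is_vertex (U \<theta> k) \<longleftrightarrow> \<theta> < m \<and> k < stages"
| "is_vertex (Y c) \<longleftrightarrow> c < C"
| "is_vertex (R c) \<longleftrightarrow> c < C"

primrec src :: "dn \<Rightarrow> lv" where
  "src (Lk i) = W i"
| "src (X \<theta>) = W (2 * \<theta>)"
| "src (Fd \<theta>) = Z \<theta>"
| "src (In \<theta> k) = (if k = 0 then Q \<theta> else V \<theta> (k - 1))"
| "src (Cf \<theta> k) = V \<theta> k"
| "src (Gs c) = U (sc c) (3 * c)"
| "src (Gt c) = R c"
| "src (Gr c) = R c"
| "src (Jn v) = v"

primrec tgt :: "dn \<Rightarrow> lv" where
  "tgt (Lk i) = W (Suc i)"
| "tgt (X \<theta>) = Z \<theta>"
| "tgt (Fd \<theta>) = Q \<theta>"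
| "tgt (In \<theta> k) = V \<theta> k"
| "tgt (Cf \<theta> k) = U \<theta> k"
| "tgt (Gs c) = Y c"
| "tgt (Gt c) = U (tc c) (3 * c + 1)"
| "tgt (Gr c) = Y c"
| "tgt (Jn v) = v"

primrec is_link :: "dn \<Rightarrow> bool" where
  "is_link (Lk i) \<longleftrightarrow> i < 2 * m - 2"
| "is_link (X \<theta>) \<longleftrightarrow> \<theta> < m"
| "is_link (Fd \<theta>) \<longleftrightarrow> \<theta> < m"
| "is_link (In \<theta> k) \<longleftrightarrow> \<theta> < m \<and> k < stages"
| "is_link (Cf \<theta> k) \<longleftrightarrow> \<theta> < m \<and> k < stages"
| "is_link (Gs c) \<longleftrightarrow> c < C"
| "is_link (Gt c) \<longleftrightarrow> c < C"
| "is_link (Gr c) \<longleftrightarrow> c < C"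
| "is_link (Jn v) \<longleftrightarrow> False"

definition conflict_use :: "nat \<Rightarrow> nat \<Rightarrow> bool" where
  "conflict_use \<theta> k \<longleftrightarrow> k div 3 < C \<and> (k mod 3 = 0 \<and> \<theta> = sc (k div 3) \<or> k mod 3 = 1 \<and> \<theta> = tc (k div 3))"

definition may_block :: "nat \<Rightarrow> bool" where
  "may_block k \<longleftrightarrow> k mod 3 = 1 \<and> C \<le> k div 3"

lemma finite_is_vertex: "finite {v. is_vertex v}"
proof -
  have "{v. is_vertex v} \<subseteq> W ` {..<2 * m - 1} \<union> Z ` {..<m} \<union> Q ` {..<m} \<union>
     (\<lambda>(\<theta>, k). V \<theta> k) ` ({..<m} \<times> {..<stages}) \<union> (\<lambda>(\<theta>, k). U \<theta> k) ` ({..<m} \<times> {..<stages}) \<union>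
     Y ` {..<C} \<union> R ` {..<C}" (is "_ \<subseteq> ?A")
  proof
    fix v assume "v \<in> {v. is_vertex v}"
    then show "v \<in> ?A" by (cases v) auto
  qed
  then show ?thesis by (rule finite_subset) auto
qed

lemma is_link_vertex: "is_link d \<Longrightarrow> is_vertex (src d) \<and> is_vertex (tgt d)"
  using m_pos sc_less tc_less by (cases d) (auto simp: stages_def)

lemma finite_is_link: "finite {d. is_link d}"
proof -
  have "inj_on (\<lambda>d. (src d, tgt d)) {d. is_link d}"
  proof (rule inj_onI, clarsimp)
    fix d d' assume "is_link d" "is_link d'" "src d = src d'" "tgt d = tgt d'"
    then show "d = d'" by (cases d; cases d') (auto split: if_splits)
  qed
  moreover have "(\<lambda>d. (src d, tgt d)) ` {d. is_link d} \<subseteq> {v. is_vertex v} \<times> {v. is_vertex v}"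
    using is_link_vertex by auto
  ultimately show ?thesis using finite_is_vertex by (meson finite_SigmaI inj_on_finite)
qed

end

locale gadget = gadget_shape m C sc tc for m C :: nat and sc tc :: "nat \<Rightarrow> nat" +
  fixes N :: nat and off :: "nat \<Rightarrow> nat" and blk :: "nat \<Rightarrow> nat \<Rightarrow> nat \<Rightarrow> bool"
  assumes N_pos: "0 < N" and off_less: "c < C \<Longrightarrow> off c < N"
begin

definition tiling :: "(nat \<Rightarrow> nat) \<Rightarrow> bool" where
  "tiling sel \<longleftrightarrow> (\<forall>j<N. sel j < m \<and> (\<forall>b<2. \<not> blk b j (sel j)) \<and>
     (\<forall>c<C. \<not> (sel j = sc c \<and> sel ((j + off c) mod N) = tc c)))"

definition blocked :: "nat \<Rightarrow> nat \<Rightarrow> nat \<Rightarrow> bool" where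
  "blocked j \<theta> k \<longleftrightarrow> may_block k \<and> blk (k div 3 - C) j \<theta>"

text \<open>A demand \<open>Gt\<close> is indexed by the cell of its source \<open>R\<close>; at its
  target \<open>U\<close> the offset has to be undone, which is the shift by \<open>N - off\<close>
  modulo \<open>N\<close>.\<close>

fun ports :: "vertex \<Rightarrow> item list" where
  "ports (W i, j, b) =
     [if i = 0 then Stub 0 else Dem (Lk (i - 1), j, b),
      if i = 2 * m - 2 then Stub 1 else Dem (Lk i, j, b),
      if even i then Dem (X (i div 2), j, b) else Dem (Jn (W i), j, False)]"
| "ports (Z \<theta>, j, b) = [Dem (X \<theta>, j, b), Dem (Fd \<theta>, j, b), Dem (Jn (Z \<theta>), j, False)]"
| "ports (Q \<theta>, j, b) = [Stub 1, Dem (Fd \<theta>, j, b), Dem (In \<theta> 0, j, b)]"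
| "ports (V \<theta> k, j, b) =
     [Dem (In \<theta> k, j, b), Dem (Cf \<theta> k, j, b),
      if k = stages - 1 then Dem (Jn (V \<theta> k), j, False) else Dem (In \<theta> (Suc k), j, b)]"
| "ports (U \<theta> k, j, b) =
     [Stub (k mod 3), Dem (Cf \<theta> k, j, b),
      if k div 3 < C \<and> k mod 3 = 0 \<and> \<theta> = sc (k div 3) then Dem (Gs (k div 3), j, b)
      else if k div 3 < C \<and> k mod 3 = 1 \<and> \<theta> = tc (k div 3)
        then Dem (Gt (k div 3), (j + (N - off (k div 3))) mod N, b)
      else if blocked j \<theta> k then Stub 2
      else Dem (Jn (U \<theta> k), j, False)]"
| "ports (Y c, j, b) = [Dem (Gs c, j, b), Dem (Gr c, j, b), Dem (Jn (Y c), j, False)]"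
| "ports (R c, j, b) = [Stub 1, Dem (Gt c, j, b), Dem (Gr c, j, b)]"

primrec joined :: "nat \<Rightarrow> lv \<Rightarrow> bool" where
  "joined j (W i) \<longleftrightarrow> i < 2 * m - 1 \<and> odd i"
| "joined j (Z \<theta>) \<longleftrightarrow> \<theta> < m"
| "joined j (Q \<theta>) \<longleftrightarrow> False"
| "joined j (V \<theta> k) \<longleftrightarrow> \<theta> < m \<and> k = stages - 1"
| "joined j (U \<theta> k) \<longleftrightarrow> \<theta> < m \<and> k < stages \<and> \<not> conflict_use \<theta> k \<and> \<not> blocked j \<theta> k"
| "joined j (Y c) \<longleftrightarrow> c < C"
| "joined j (R c) \<longleftrightarrow> False"

fun is_demand :: "demand \<Rightarrow> bool" where
  "is_demand (d, j, b) \<longleftrightarrow> j < N \<and> (case d of Jn v \<Rightarrow> joined j v \<and> \<not> b | _ \<Rightarrow> is_link d)"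

fun Sv :: "demand \<Rightarrow> vertex" where
  "Sv (d, j, b) = (src d, j, b)"

fun Tv :: "demand \<Rightarrow> vertex" where
  "Tv (d, j, b) =
     (tgt d, case d of Gt c \<Rightarrow> (j + off c) mod N | _ \<Rightarrow> j, case d of Jn v \<Rightarrow> True | _ \<Rightarrow> b)"

definition verts :: "vertex set" where
  "verts = {v. is_vertex v} \<times> {..<N} \<times> UNIV"

lemma stages_pos: "0 < stages"
  by (simp add: stages_def)

lemma join_incident:
  "is_demand (Jn w, j', b') \<and> (Sv (Jn w, j', b') = (u, j, b) \<or> Tv (Jn w, j', b') = (u, j, b)) \<longleftrightarrow>
   j < N \<and> joined j u \<and> w = u \<and> j' = j \<and> \<not> b'"
  by (cases b) auto

text \<open>The stage number encodes a conflict \<open>q\<close> and a phase \<open>r\<close>;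
  naming both keeps division out of the case analysis.\<close>

lemma ports_iff_U:
  assumes "\<theta> < m" "k < stages" "j < N"
  shows "Dem d \<in> set (ports (U \<theta> k, j, b)) \<longleftrightarrow> is_demand d \<and> (Sv d = (U \<theta> k, j, b) \<or> Tv d = (U \<theta> k, j, b))"
proof -
  obtain e j' b' where d: "d = (e, j', b')" by (cases d)
  define q r where "q = k div 3" and "r = k mod 3"
  have ports: "ports (U \<theta> k, j, b) =
     [Stub r, Dem (Cf \<theta> k, j, b),
      if q < C \<and> r = 0 \<and> \<theta> = sc q then Dem (Gs q, j, b)
      else if q < C \<and> r = 1 \<and> \<theta> = tc q then Dem (Gt q, (j + (N - off q)) mod N, b)
      else if blocked j \<theta> k then Stub 2 else Dem (Jn (U \<theta> k), j, False)]"
    unfolding q_def r_def ports.simps ..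
  have k: "3 * c = k \<longleftrightarrow> q = c \<and> r = 0" "Suc (3 * c) = k \<longleftrightarrow> q = c \<and> r = 1" for c
    unfolding q_def r_def by (rule mod3_div3)+
  have cu: "conflict_use \<theta> k \<longleftrightarrow> q < C \<and> (r = 0 \<and> \<theta> = sc q \<or> r = 1 \<and> \<theta> = tc q)"
    unfolding q_def r_def conflict_use_def ..
  note [simp del] = ports.simps
  show ?thesis
  proof (cases e)
    case (Gs c)
    then show ?thesis using assms by (auto simp: d k ports)
  next
    case (Gt c)
    have "c < C \<Longrightarrow> j' < N \<Longrightarrow> (j' + off c) mod N = j \<longleftrightarrow> j' = (j + (N - off c)) mod N"
      by (rule rotate_iff) (use off_less assms in auto)
    moreover have "(j + (N - off c)) mod N < N" using N_pos by simp
    ultimately show ?thesis using Gt assms by (auto simp: d k ports)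
  next
    case (Jn v)
    have "Dem d \<in> set (ports (U \<theta> k, j, b)) \<longleftrightarrow> joined j (U \<theta> k) \<and> v = U \<theta> k \<and> j' = j \<and> \<not> b'"
      using assms by (auto simp: ports cu d Jn)
    then show ?thesis unfolding d Jn join_incident using assms by simp
  qed (use assms in \<open>auto simp: d ports split: if_splits\<close>)
qed

lemma ports_iff:
  assumes "v \<in> verts"
  shows "Dem d \<in> set (ports v) \<longleftrightarrow> is_demand d \<and> (Sv d = v \<or> Tv d = v)"
proof -
  obtain e j' b' where d: "d = (e, j', b')" by (cases d)
  obtain u j b where v: "v = (u, j, b)" by (cases v)
  have u: "is_vertex u" "j < N" using assms v by (auto simp: verts_def)
  show ?thesis
  proof (cases u)
    case (U \<theta> k)
    then show ?thesis using ports_iff_U u v by simp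
  next
    case (W i)
    show ?thesis
    proof (cases e)
      case (Lk l)
      then show ?thesis using u m_pos by (auto simp: v d W)
    next
      case (Jn w)
      show ?thesis using u m_pos unfolding d v Jn join_incident by (auto simp: W)
    qed (use u in \<open>auto simp: v d W split: if_splits\<close>)
  next
    case (V \<theta> k)
    then show ?thesis
    proof (cases e)
      case (In l k')
      then show ?thesis using u by (cases k') (auto simp: v d V)
    next
      case (Jn w)
      show ?thesis using u m_pos unfolding d v Jn join_incident by (auto simp: V)
    qed (use u in \<open>auto simp: v d V split: if_splits\<close>)
  next
    case (Z \<theta>)
    show ?thesis
    proof (cases e)
      case (Jn w)
      show ?thesis using u m_pos unfolding d v Jn join_incident by (auto simp: Z)
    qed (use u in \<open>auto simp: v d Z split: if_splits\<close>)
  next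
    case (Q \<theta>)
    show ?thesis
    proof (cases e)
      case (Jn w)
      show ?thesis using u m_pos unfolding d v Jn join_incident by (auto simp: Q)
    qed (use u stages_pos in \<open>auto simp: v d Q split: if_splits\<close>)
  next
    case (Y c)
    show ?thesis
    proof (cases e)
      case (Jn w)
      show ?thesis using u m_pos unfolding d v Jn join_incident by (auto simp: Y)
    qed (use u in \<open>auto simp: v d Y split: if_splits\<close>)
  next
    case (R c)
    show ?thesis
    proof (cases e)
      case (Jn w)
      show ?thesis using u m_pos unfolding d v Jn join_incident by (auto simp: R)
    qed (use u in \<open>auto simp: v d R split: if_splits\<close>)
  qed
qed

lemma distinct_ports: "v \<in> verts \<Longrightarrow> distinct (ports v) \<and> length (ports v) = 3"
proof -
  assume "v \<in> verts"
  obtain u j b where v: "v = (u, j, b)" by (cases v)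
  show ?thesis by (cases u) (auto simp: v blocked_def may_block_def)
qed

lemma stub_less: "v \<in> verts \<Longrightarrow> Stub s \<in> set (ports v) \<Longrightarrow> s < 3"
proof -
  assume *: "v \<in> verts" "Stub s \<in> set (ports v)"
  obtain u j b where v: "v = (u, j, b)" by (cases v)
  show ?thesis using * by (cases u) (auto simp: v split: if_splits)
qed

lemma joined_vertex: "joined j v \<Longrightarrow> is_vertex v"
  using stages_pos by (cases v) auto

lemma demand_verts:
  assumes "is_demand d"
  shows "Sv d \<in> verts" "Tv d \<in> verts" "Sv d \<noteq> Tv d"
proof -
  obtain e j' b' where d: "d = (e, j', b')" by (cases d)
  have "is_vertex (src e) \<and> is_vertex (tgt e)"
  proof (cases "\<exists>v. e = Jn v")
    case True
    then show ?thesis using assms joined_vertex by (auto simp: d)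
  next
    case False
    then have "is_link e" using assms by (auto simp: d split: dn.splits)
    then show ?thesis by (rule is_link_vertex)
  qed
  then show "Sv d \<in> verts" "Tv d \<in> verts"
    using assms N_pos by (auto simp: d verts_def split: dn.split)
  show "Sv d \<noteq> Tv d" using assms by (cases e) (auto simp: d)
qed

lemma inj_Sv_Tv:
  assumes "is_demand d" "is_demand d'" "Sv d = Sv d'" "Tv d = Tv d'"
  shows "d = d'"
proof -
  obtain e j b where d: "d = (e, j, b)" by (cases d)
  obtain e' j' b' where d': "d' = (e', j', b')" by (cases d')
  have eq: "src e = src e'" "tgt e = tgt e'" "j = j'" "b = b'" using assms by (auto simp: d d')
  then have "e = e'" using assms(4) by (cases e; cases e') (auto simp: d d' split: if_splits)
  then show ?thesis using eq by (simp add: d d')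
qed

definition item_col :: "(demand \<Rightarrow> nat) \<Rightarrow> item \<Rightarrow> nat" where
  "item_col col x = (case x of Stub s \<Rightarrow> s | Dem d \<Rightarrow> col d)"

lemma item_col_simps [simp]: "item_col col (Stub s) = s" "item_col col (Dem d) = col d"
  by (simp_all add: item_col_def)

definition good :: "(demand \<Rightarrow> nat) \<Rightarrow> bool" where
  "good col \<longleftrightarrow> (\<forall>d. is_demand d \<longrightarrow> col d < 3) \<and> (\<forall>v\<in>verts. distinct (map (item_col col) (ports v)))"

lemma finite_verts: "finite verts"
  by (simp add: verts_def finite_is_vertex)

lemma finite_demands: "finite {d. is_demand d}"
proof -
  have "inj_on (\<lambda>d. (Sv d, Tv d)) {d. is_demand d}"
    unfolding inj_on_def using inj_Sv_Tv by blast
  moreover have "(\<lambda>d. (Sv d, Tv d)) ` {d. is_demand d} \<subseteq> verts \<times> verts"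
    using demand_verts by blast
  ultimately show ?thesis using finite_verts by (meson finite_SigmaI inj_on_finite)
qed

end

section \<open>Good colourings correspond to tilings\<close>

context gadget
begin

lemma good_lt: "good col \<Longrightarrow> v \<in> verts \<Longrightarrow> x \<in> set (ports v) \<Longrightarrow> item_col col x < 3"
  using ports_iff[of v] stub_less[of v] by (cases x) (auto simp: good_def)

text \<open>The three colours add up to 3.\<close>

lemma third_colour:
  "distinct [a, b, c] \<Longrightarrow> a < 3 \<Longrightarrow> b < 3 \<Longrightarrow> c < 3 \<Longrightarrow> a = 3 - (b + c)" for a b c :: nat
  by (auto; arith)

lemma mod3_cases:
  fixes k :: nat
  obtains "k mod 3 = 0" "(k + 1) mod 3 = 1" "(k + 2) mod 3 = 2"
  | "k mod 3 = 1" "(k + 1) mod 3 = 2" "(k + 2) mod 3 = 0"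
  | "k mod 3 = 2" "(k + 1) mod 3 = 0" "(k + 2) mod 3 = 1"
proof -
  have "k mod 3 < 3" by simp
  then consider "k mod 3 = 0" | "k mod 3 = 1" | "k mod 3 = 2" by linarith
  then show thesis by cases (rule that; simp add: mod_Suc numeral_2_eq_2)+
qed

lemma good_at:
  assumes "good col" "is_vertex v" "j < N"
  shows "distinct (map (item_col col) (ports (v, j, b)))" "\<forall>x\<in>set (ports (v, j, b)). item_col col x < 3"
proof -
  have "(v, j, b) \<in> verts" using assms by (simp add: verts_def)
  then show "distinct (map (item_col col) (ports (v, j, b)))" "\<forall>x\<in>set (ports (v, j, b)). item_col col x < 3"
    using assms(1) good_lt unfolding good_def by blast+
qed

text \<open>Suppose that no \<open>X\<close> has colour 2. The stub of colour 0 at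
  \<open>W 0\<close> then forces colour 2 on the first link; odd vertices make the next link avoid
  2, and at even vertices the outgoing link must take it, because no other item there does. At the
  last vertex the incoming link avoids 2 and the outgoing link is replaced by the stub of colour 1,
  so colour 2 is missing among three different colours.\<close>

lemma selection_if_good:
  assumes "good col" "j < N"
  shows "\<exists>\<theta><m. col (X \<theta>, j, False) = 2"
proof (rule ccontr)
  assume "\<not> ?thesis"
  then have none: "\<theta> < m \<Longrightarrow> col (X \<theta>, j, False) \<noteq> 2" for \<theta> by blast
  have W: "distinct (map (item_col col) (ports (W i, j, False)))"
      "\<forall>x\<in>set (ports (W i, j, False)). item_col col x < 3" if "i < 2 * m - 1" for i
    by (rule good_at; use assms that in simp)+
  have "\<theta> = 0 \<or> col (Lk (2 * \<theta> - 1), j, False) \<noteq> 2" if "\<theta> < m" for \<theta>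
    using that
  proof (induction \<theta>)
    case (Suc \<theta>)
    then have "\<theta> = 0 \<or> col (Lk (2 * \<theta> - 1), j, False) \<noteq> 2" by simp
    moreover have "2 * \<theta> < 2 * m - 1" "2 * \<theta> \<noteq> 2 * m - 2" "Suc (2 * \<theta>) < 2 * m - 1" "Suc (2 * \<theta>) \<noteq> 2 * m - 2"
      using Suc.prems by presburger+
    moreover define l where "l = item_col col (if \<theta> = 0 then Stub 0 else Dem (Lk (2 * \<theta> - 1), j, False))"
    ultimately have "distinct [l, col (Lk (2 * \<theta>), j, False), col (X \<theta>, j, False)]"
      "l < 3" "l \<noteq> 2" "col (Lk (2 * \<theta>), j, False) < 3" "col (X \<theta>, j, False) < 3" "col (X \<theta>, j, False) \<noteq> 2"
      using W[of "2 * \<theta>"] none[of \<theta>] Suc.prems by (auto simp: l_def)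
    then have "col (Lk (2 * \<theta>), j, False) = 2" by (auto; arith)
    moreover have "col (Lk (2 * \<theta>), j, False) \<noteq> col (Lk (Suc (2 * \<theta>)), j, False)"
      using W(1)[of "Suc (2 * \<theta>)"] Suc.prems
        \<open>Suc (2 * \<theta>) < 2 * m - 1\<close> \<open>Suc (2 * \<theta>) \<noteq> 2 * m - 2\<close> by auto
    ultimately show ?case by simp
  qed simp
  from this[of "m - 1"] have l: "m - 1 = 0 \<or> col (Lk (2 * (m - 1) - 1), j, False) \<noteq> 2" using m_pos by simp
  have "2 * m - 2 < 2 * m - 1" using m_pos by arith
  define x where "x = item_col col (if m = 1 then Stub 0 else Dem (Lk (2 * m - 3), j, False))"
  have "distinct [x, 1, col (X (m - 1), j, False)]" "x < 3" "x \<noteq> 2" "col (X (m - 1), j, False) < 3"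
    "col (X (m - 1), j, False) \<noteq> 2"
  proof -
    have d: "(2 * m - 2) div 2 = m - 1" "2 * m - 2 - 1 = 2 * m - 3" "2 * (m - 1) - 1 = 2 * m - 3"
      "2 * m - 2 = 0 \<longleftrightarrow> m = 1" "even (2 * m - 2)" using m_pos by auto
    have "ports (W (2 * m - 2), j, False) =
       [if m = 1 then Stub 0 else Dem (Lk (2 * m - 3), j, False), Stub 1, Dem (X (m - 1), j, False)]"
      unfolding ports.simps d using d(5) by simp
    then show "distinct [x, 1, col (X (m - 1), j, False)]" "x < 3" "x \<noteq> 2" "col (X (m - 1), j, False) < 3"
      "col (X (m - 1), j, False) \<noteq> 2"
      using W[OF \<open>2 * m - 2 < 2 * m - 1\<close>] l[unfolded d] none[of "m - 1"] m_pos by (cases "m = 1"; auto simp: x_def)+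
  qed
  then show False by (auto; arith)
qed

text \<open>\<open>Fd\<close> avoids 2 at \<open>Z\<close>, and at \<open>Q\<close> the stub takes
  1, so \<open>In \<theta> 0\<close> has colour 2. In stage \<open>k\<close>, the stub at
  \<open>U\<close> excludes \<open>k mod 3\<close> and the incoming link at \<open>V\<close>
  excludes \<open>(k + 2) mod 3\<close>, so \<open>Cf\<close> has colour
  \<open>(k + 1) mod 3\<close>. The next link gets what remains, \<open>k mod 3\<close>, and this is
  \<open>(Suc k + 2) mod 3\<close>.\<close>

lemma chain_if_good:
  assumes good: "good col" and j: "j < N" and \<theta>: "\<theta> < m" and X: "col (X \<theta>, j, False) = 2"
  shows "k < stages \<Longrightarrow> col (In \<theta> k, j, False) = (k + 2) mod 3 \<and> col (Cf \<theta> k, j, False) = (k + 1) mod 3"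
proof (induction k)
  have dist: "distinct (map (item_col col) (ports (v, j, False)))"
    "\<forall>x\<in>set (ports (v, j, False)). item_col col x < 3" if "is_vertex v" for v
    by (rule good_at; use good j that in simp)+
  have three: "c = (k + 1) mod 3" if "a = (k + 2) mod 3" "c \<noteq> a" "c \<noteq> k mod 3" "c < 3" for a c k :: nat
    by (rule mod3_cases[of k]) (use that in auto)
  have three': "c = (Suc k + 2) mod 3" if "a = (k + 2) mod 3" "b = (k + 1) mod 3" "c \<noteq> a" "c \<noteq> b" "c < 3" for a b c k :: nat
    by (rule mod3_cases[of k]) (use that in \<open>auto simp: mod_Suc\<close>)
  have cf: "col (Cf \<theta> k, j, False) = (k + 1) mod 3" if "k < stages" "col (In \<theta> k, j, False) = (k + 2) mod 3" for k
  proof (rule three[OF that(2)])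
    show "col (Cf \<theta> k, j, False) \<noteq> col (In \<theta> k, j, False)" "col (Cf \<theta> k, j, False) < 3"
      using dist[of "V \<theta> k"] that(1) \<theta> by (simp_all split del: if_split)
    show "col (Cf \<theta> k, j, False) \<noteq> k mod 3"
      using dist(1)[of "U \<theta> k"] that(1) \<theta> by (simp split del: if_split)
  qed
  {
    case 0
    have "col (Fd \<theta>, j, False) \<noteq> 2" "distinct [1, col (Fd \<theta>, j, False), col (In \<theta> 0, j, False)]"
      "col (Fd \<theta>, j, False) < 3" "col (In \<theta> 0, j, False) < 3"
      using dist[of "Z \<theta>"] dist[of "Q \<theta>"] \<theta> X by auto
    then have "col (In \<theta> 0, j, False) = 2" by (auto; arith)
    then show ?case using cf[OF 0] by simp
  next
    case (Suc k)
    then have *: "col (In \<theta> k, j, False) = (k + 2) mod 3" "col (Cf \<theta> k, j, False) = (k + 1) mod 3" by auto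
    have "k \<noteq> stages - 1" using Suc.prems by arith
    then have "col (In \<theta> (Suc k), j, False) \<noteq> col (In \<theta> k, j, False)"
      "col (In \<theta> (Suc k), j, False) \<noteq> col (Cf \<theta> k, j, False)" "col (In \<theta> (Suc k), j, False) < 3"
      using dist[of "V \<theta> k"] Suc.prems \<theta> by auto
    then have "col (In \<theta> (Suc k), j, False) = (Suc k + 2) mod 3" by (rule three'[OF *])
    then show ?case using cf[OF Suc.prems] by simp
  }
qed

text \<open>Several tiles of a cell may have colour 2, and any of them can be chosen; one copy is
  enough to read them off. For a chosen tile, \<open>Cf\<close> has colour 1 at stage
  \<open>3 * c\<close> and colour 2 at stage \<open>3 * c + 1\<close>. A conflict would give
  \<open>Gs\<close> colour 2 and \<open>Gt\<close> colour 0; the latter becomes 2 on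
  \<open>Gr\<close> at \<open>R\<close>, and both clash at \<open>Y\<close>. A forbidden tile would
  clash with the stub of colour 2.\<close>

lemma tiling_if_good:
  assumes "good col"
  shows "\<exists>sel. tiling sel"
proof -
  obtain sel where sel: "\<And>j. j < N \<Longrightarrow> sel j < m \<and> col (X (sel j), j, False) = 2"
    using selection_if_good[OF assms] by metis
  have dist: "distinct (map (item_col col) (ports (v, j, False)))"
    "\<forall>x\<in>set (ports (v, j, False)). item_col col x < 3" if "is_vertex v" "j < N" for v j
    by (rule good_at; use assms that in simp)+
  have cf: "col (Cf (sel j) k, j, False) = (k + 1) mod 3" if "j < N" "k < stages" for j k
    using chain_if_good[OF assms that(1), of "sel j" k] sel[OF that(1)] that by simp
  have "\<not> blk b j (sel j)" if "j < N" "b < 2" for b j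
  proof
    assume "blk b j (sel j)"
    let ?k = "3 * (C + b) + 1"
    have k: "?k < stages" "?k div 3 = C + b" "?k mod 3 = 1" using that by (auto simp: stages_def)
    then have "blocked j (sel j) ?k" using \<open>blk b j (sel j)\<close> by (simp add: blocked_def may_block_def)
    moreover have "(?k + 1) mod 3 = 2" by presburger
    ultimately show False
      using dist(1)[of "U (sel j) ?k" j] cf[OF that(1) k(1)] k sel[OF that(1)] that
      by (simp del: One_nat_def)
  qed
  moreover have "\<not> (sel j = sc c \<and> sel ((j + off c) mod N) = tc c)" if j: "j < N" and c: "c < C" for j c
  proof
    assume s: "sel j = sc c \<and> sel ((j + off c) mod N) = tc c"
    let ?j = "(j + off c) mod N"
    have j': "?j < N" using N_pos by simp
    have rot: "(?j + (N - off c)) mod N = j" using rotate_iff[OF off_less[OF c] j' j] by simp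
    have k: "3 * c < stages" "3 * c + 1 < stages" using c by (auto simp: stages_def)
    have "col (Cf (sc c) (3 * c), j, False) = 1" using cf[OF j k(1)] s by simp
    then have gs: "col (Gs c, j, False) = 2"
      using third_colour[of "col (Gs c, j, False)" 0 1] dist[of "U (sc c) (3 * c)" j] j c sc_less[OF c] k by auto
    have "(3 * c + 1 + 1) mod 3 = 2" by presburger
    then have "col (Cf (tc c) (3 * c + 1), ?j, False) = 2" using cf[OF j' k(2)] s by simp
    moreover have "Suc (3 * c) div 3 = c" by presburger
    ultimately have "col (Gt c, j, False) = 0"
      using third_colour[of "col (Gt c, j, False)" 1 2] dist[of "U (tc c) (3 * c + 1)" ?j] j' c tc_less[OF c] k rot by auto
    then have "col (Gr c, j, False) = 2"
      using third_colour[of "col (Gr c, j, False)" 1 0] dist[of "R c" j] j c by auto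
    then show False using gs dist(1)[of "Y c" j] j c by simp
  qed
  ultimately show ?thesis using sel unfolding tiling_def by blast
qed

text \<open>On the chain of the selected tile these colours are forced. The links of the path
  alternate 2, 0 before the selected tile and 1, 2 after it. The chains of the other tiles have
  their \<open>In\<close> and \<open>Cf\<close> colours shifted by one, which leads to
  \<open>Gs\<close> of colour 1 and \<open>Gt\<close> of colour 2.\<close>

fun link_col :: "(nat \<Rightarrow> nat) \<Rightarrow> demand \<Rightarrow> nat" where
  "link_col sel (Lk i, j, b) =
     (if i < 2 * sel j then (if even i then 2 else 0) else (if even i then 1 else 2))"
| "link_col sel (X \<theta>, j, b) = (if \<theta> = sel j then 2 else if \<theta> < sel j then 1 else 0)"
| "link_col sel (Fd \<theta>, j, b) = (if \<theta> = sel j then 0 else 2)"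
| "link_col sel (In \<theta> k, j, b) = (if \<theta> = sel j then (k + 2) mod 3 else k mod 3)"
| "link_col sel (Cf \<theta> k, j, b) = (if \<theta> = sel j then (k + 1) mod 3 else (k + 2) mod 3)"
| "link_col sel (Gs c, j, b) = (if sel j = sc c then 2 else 1)"
| "link_col sel (Gt c, j, b) = (if sel ((j + off c) mod N) = tc c then 0 else 2)"
| "link_col sel (Gr c, j, b) = (if sel ((j + off c) mod N) = tc c then 2 else 0)"
| "link_col sel (Jn v, j, b) = 0"

text \<open>Joining demands occur only as the third entry of \<open>ports\<close>; they get the colour missing there.\<close>

fun full_col :: "(nat \<Rightarrow> nat) \<Rightarrow> demand \<Rightarrow> nat" where
  "full_col sel (Jn v, j, b) =
     3 - (item_col (link_col sel) (ports (v, j, False) ! 0) + item_col (link_col sel) (ports (v, j, False) ! 1))"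
| "full_col sel d = link_col sel d"

lemma missing_colour: "a < 3 \<Longrightarrow> b < 3 \<Longrightarrow> a \<noteq> b \<Longrightarrow> 3 - (a + b) < 3 \<and> 3 - (a + b) \<noteq> a \<and> 3 - (a + b) \<noteq> b" for a b :: nat
  by arith

lemma missing_colour_list:
  fixes f :: "'x \<Rightarrow> nat"
  assumes "map f xs = [a, b, 3 - (a + b)]" "a < 3" "b < 3" "a \<noteq> b"
  shows "distinct (map f xs) \<and> (\<forall>x\<in>set xs. f x < 3)"
proof -
  note * = missing_colour[OF assms(2-4)]
  have "\<forall>y\<in>set (map f xs). y < 3" unfolding assms(1) using * assms(2,3) by simp
  moreover have "distinct (map f xs)" unfolding assms(1) using * assms(4) by auto
  ultimately show ?thesis by simp
qed

text \<open>A vertex either has three items of known colour or is joined to its twin. The first two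
  items of twins have the same colours in both copies, so the missing colour is the same at both
  ends of the joining demand.\<close>

lemma good_if_tiling:
  assumes "tiling sel"
  shows "good (full_col sel)"
proof -
  have sel: "sel j < m" "b < 2 \<Longrightarrow> \<not> blk b j (sel j)"
    "c < C \<Longrightarrow> \<not> (sel j = sc c \<and> sel ((j + off c) mod N) = tc c)" if "j < N" for j b c
    using assms that by (auto simp: tiling_def)
  have dist: "distinct (map (item_col (full_col sel)) (ports (v, j, b))) \<and>
      (\<forall>x\<in>set (ports (v, j, b)). item_col (full_col sel) x < 3)" if v: "is_vertex v" and j: "j < N" for v j b
  proof (cases v)
    case (W i)
    have i: "i < 2 * m - 1" using v W by simp
    let ?a = "item_col (full_col sel) (if i = 0 then Stub 0 else Dem (Lk (i - 1), j, b))"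
    let ?c = "item_col (full_col sel) (if i = 2 * m - 2 then Stub 1 else Dem (Lk i, j, b))"
    have a: "?a = (if i \<le> 2 * sel j then (if even i then 0 else 2) else (if even i then 2 else 1))"
      by (cases i) auto
    have c: "?c = (if i < 2 * sel j then (if even i then 2 else 0) else (if even i then 1 else 2))"
    proof (cases "i = 2 * m - 2")
      case True
      then have "even i" "\<not> i < 2 * sel j" using sel(1)[OF j] m_pos by auto
      then show ?thesis using True by simp
    qed simp
    show ?thesis
    proof (cases "even i")
      case True
      then obtain \<theta> where \<theta>: "i = 2 * \<theta>" by blast
      have x: "item_col (full_col sel) (Dem (X (i div 2), j, b)) = (if \<theta> = sel j then 2 else if \<theta> < sel j then 1 else 0)"
        by (simp add: \<theta>)
      show ?thesis unfolding W ports.simps list.map list.set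
        using True a c x \<theta> by (simp only: if_True) auto
    next
      case False
      show ?thesis
      proof (rule missing_colour_list[of _ _ ?a ?c])
        have "full_col sel (Jn (W i), j, False) = 3 - (?a + ?c)" by (simp add: item_col_def)
        then show "map (item_col (full_col sel)) (ports (v, j, b)) = [?a, ?c, 3 - (?a + ?c)]"
          unfolding W ports.simps list.map using False by (simp only: if_False item_col_simps)
        have "i \<noteq> 2 * sel j" using False by auto
        then show "?a < 3" "?c < 3" "?a \<noteq> ?c" unfolding a c using False by auto
      qed
    qed
  next
    case (Z \<theta>)
    then show ?thesis by auto
  next
    case (Q \<theta>)
    then show ?thesis by auto
  next
    case (V \<theta> k)
    define r where "r = k mod 3"
    let ?i = "full_col sel (In \<theta> k, j, b)" and ?c = "full_col sel (Cf \<theta> k, j, b)"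
      and ?n = "full_col sel (In \<theta> (Suc k), j, b)"
    have "?i = (if \<theta> = sel j then (r + 2) mod 3 else r)" "?c = (if \<theta> = sel j then (r + 1) mod 3 else (r + 2) mod 3)"
      "?n = (if \<theta> = sel j then (r + 3) mod 3 else (r + 1) mod 3)"
      unfolding r_def full_col.simps link_col.simps by (simp_all only: mod_add_left_eq mod_mod_trivial) simp
    moreover have "r = 0 \<or> r = 1 \<or> r = 2" unfolding r_def by arith
    ultimately have vals: "distinct [?i, ?c, ?n]" "?i < 3" "?c < 3" "?n < 3" by auto
    show ?thesis
    proof (cases "k = stages - 1")
      case True
      have "full_col sel (Jn (V \<theta> k), j, False) = 3 - (?i + ?c)" by simp
      then show ?thesis using True vals
        by (intro missing_colour_list[of _ _ ?i ?c]) (simp_all add: V del: full_col.simps)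
    next
      case False
      then show ?thesis using vals by (simp add: V del: full_col.simps)
    qed
  next
    case (U \<theta> k)
    define q r where "q = k div 3" and "r = k mod 3"
    have ports: "ports (U \<theta> k, j, b) =
       [Stub r, Dem (Cf \<theta> k, j, b),
        if q < C \<and> r = 0 \<and> \<theta> = sc q then Dem (Gs q, j, b)
        else if q < C \<and> r = 1 \<and> \<theta> = tc q then Dem (Gt q, (j + (N - off q)) mod N, b)
        else if blocked j \<theta> k then Stub 2 else Dem (Jn (U \<theta> k), j, False)]" for b
      unfolding q_def r_def ports.simps ..
    have cf: "full_col sel (Cf \<theta> k, j, b) = (if \<theta> = sel j then (r + 1) mod 3 else (r + 2) mod 3)" for b
      unfolding r_def full_col.simps link_col.simps by (simp only: mod_add_left_eq)
    have r: "r < 3" by (simp add: r_def)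
    have jn: "full_col sel (Jn (U \<theta> k), j, False) = 3 - (r + full_col sel (Cf \<theta> k, j, b))"
      by (simp add: ports del: ports.simps)
    \<comment> \<open>A forbidden tile is not the selected one, so its \<open>Cf\<close> takes
      colour 0 between the stubs of colours 1 and 2.\<close>
    have bl: "\<theta> \<noteq> sel j \<and> r = 1" if "blocked j \<theta> k"
    proof -
      have "k div 3 - C < 2" using v U by (auto simp: stages_def)
      then show ?thesis using that sel(2)[OF j] by (auto simp: blocked_def may_block_def r_def)
    qed
    have rot: "((j + (N - off q)) mod N + off q) mod N = j" if "q < C"
      using rotate_iff[OF off_less[OF that] j, of "(j + (N - off q)) mod N"] N_pos by simp
    show ?thesis
    proof (cases "conflict_use \<theta> k \<or> blocked j \<theta> k")
      case True
      moreover have "C \<le> q" if "blocked j \<theta> k" using that by (simp add: blocked_def may_block_def q_def)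
      ultimately consider "q < C" "r = 0" "\<theta> = sc q" | "q < C" "r = 1" "\<theta> = tc q" | "C \<le> q" "blocked j \<theta> k"
        unfolding q_def r_def conflict_use_def by metis
      then show ?thesis
      proof cases
        case 1
        then have "ports (v, j, b) = [Stub 0, Dem (Cf \<theta> k, j, b), Dem (Gs q, j, b)]" unfolding U ports by simp
        then show ?thesis using 1 cf[of b]
          by (intro missing_colour_list[of _ _ 0 "if sel j = sc q then 1 else 2"]) (auto simp del: ports.simps)
      next
        case 2
        then have "ports (v, j, b) = [Stub 1, Dem (Cf \<theta> k, j, b), Dem (Gt q, (j + (N - off q)) mod N, b)]"
          unfolding U ports by simp
        moreover have "full_col sel (Cf \<theta> k, j, b) = (if sel j = tc q then 2 else 0)"
          unfolding cf using 2 by auto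
        moreover have "full_col sel (Gt q, (j + (N - off q)) mod N, b) = (if sel j = tc q then 0 else 2)"
          using rot[OF 2(1)] by simp
        ultimately show ?thesis
          by (intro missing_colour_list[of _ _ 1 "if sel j = tc q then 2 else 0"])
             (simp_all del: ports.simps full_col.simps)
      next
        case 3
        then have "ports (v, j, b) = [Stub 1, Dem (Cf \<theta> k, j, b), Stub 2]" "full_col sel (Cf \<theta> k, j, b) = 0"
          unfolding U ports cf using bl by auto
        then show ?thesis
          by (intro missing_colour_list[of _ _ 1 0]) (simp_all del: ports.simps full_col.simps)
      qed
    next
      case False
      let ?c = "full_col sel (Cf \<theta> k, j, b)"
      show ?thesis
      proof (rule missing_colour_list[of _ _ r ?c])
        show "map (item_col (full_col sel)) (ports (v, j, b)) = [r, ?c, 3 - (r + ?c)]"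
          unfolding U ports jn[symmetric] using False by (auto simp: conflict_use_def q_def r_def)
        show "?c < 3" by (simp add: cf)
        show "r \<noteq> ?c" unfolding cf using r by (auto simp: mod_Suc)
      qed (rule r)
    qed
  next
    case (Y c)
    then show ?thesis using sel(3)[OF j, of c] v by auto
  next
    case (R c)
    then show ?thesis by auto
  qed
  have "full_col sel d < 3" if "is_demand d" for d
  proof -
    obtain v j b where v: "Sv d = (v, j, b)" by (cases "Sv d")
    have "Sv d \<in> verts" by (rule demand_verts[OF that])
    then have "is_vertex v" "j < N" "Dem d \<in> set (ports (v, j, b))"
      using ports_iff[of "Sv d" d] that v by (auto simp: verts_def)
    then show ?thesis using dist[of v j b] by fastforce
  qed
  moreover have "distinct (map (item_col (full_col sel)) (ports v))" if "v \<in> verts" for v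
  proof -
    obtain u j b where v: "v = (u, j, b)" by (cases v)
    then have "is_vertex u" "j < N" using that by (auto simp: verts_def)
    then show ?thesis unfolding v using dist by blast
  qed
  ultimately show ?thesis unfolding good_def by blast
qed

theorem good_iff_tiling: "(\<exists>col. good col) \<longleftrightarrow> (\<exists>sel. tiling sel)"
  using tiling_if_good good_if_tiling by blast

end

section \<open>Numbering of the leaves and templates for the terminal pairs\<close>

text \<open>A template \<open>(a, t)\<close> produces for a cell the terminal pair from its leaf number \<open>a\<close> to the leaf
  \<open>a'\<close> of some cell (\<open>t = Inl a'\<close>) or to the hub \<open>s\<close> (\<open>t = Inr s\<close>).\<close>

type_synonym template = "nat \<times> (nat + nat)"

definition inst :: "nat \<Rightarrow> nat \<Rightarrow> nat \<Rightarrow> nat \<Rightarrow> template \<Rightarrow> nat \<times> nat" where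
  "inst L r j j' = (\<lambda>(a, t). (r + (L * j + a), case t of Inl a' \<Rightarrow> r + (L * j' + a') | Inr s \<Rightarrow> s))"

text \<open>\<open>idx\<close> numbers the leaves of one cell, those of both copies together.
  Conflict \<open>c\<close> owes its offset to the class \<open>oc c\<close>.\<close>

locale numbered_shape = gadget_shape m C sc tc for m C :: nat and sc tc :: "nat \<Rightarrow> nat" +
  fixes oc :: "nat \<Rightarrow> nat" and idx :: "lv \<times> bool \<Rightarrow> nat" and L :: nat
  assumes bij_idx: "bij_betw idx ({v. is_vertex v} \<times> UNIV) {..<L}"
begin

text \<open>The stubs that are the same in every cell; the others are the blocking stubs, see
  \<open>stub_ports_iff\<close>.\<close>

primrec stubs_of :: "lv \<Rightarrow> nat set" where
  "stubs_of (W i) = {s. i = 0 \<and> s = 0 \<or> i = 2 * m - 2 \<and> s = 1}"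
| "stubs_of (Z \<theta>) = {}"
| "stubs_of (Q \<theta>) = {1}"
| "stubs_of (V \<theta> k) = {}"
| "stubs_of (U \<theta> k) = {k mod 3}"
| "stubs_of (Y c) = {}"
| "stubs_of (R c) = {1}"

primrec always_joined :: "lv \<Rightarrow> bool" where
  "always_joined (W i) \<longleftrightarrow> i < 2 * m - 1 \<and> odd i"
| "always_joined (Z \<theta>) \<longleftrightarrow> \<theta> < m"
| "always_joined (Q \<theta>) \<longleftrightarrow> False"
| "always_joined (V \<theta> k) \<longleftrightarrow> \<theta> < m \<and> k = stages - 1"
| "always_joined (U \<theta> k) \<longleftrightarrow> \<theta> < m \<and> k < stages \<and> \<not> conflict_use \<theta> k \<and> \<not> may_block k"
| "always_joined (Y c) \<longleftrightarrow> c < C"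
| "always_joined (R c) \<longleftrightarrow> False"

definition links_local :: "dn set" where
  "links_local = {d. is_link d \<and> (\<forall>c. d \<noteq> Gt c)}"

definition tm_local :: "nat \<Rightarrow> template set" where
  "tm_local r =
     (\<lambda>(d, b). (idx (src d, b), Inl (idx (tgt d, b)))) ` (links_local \<times> UNIV) \<union>
     (\<lambda>v. (idx (v, False), Inl (idx (v, True)))) ` {v. always_joined v} \<union>
     (\<lambda>((v, s), b). (idx (v, b), Inr s)) ` ({(v, s). is_vertex v \<and> s \<in> stubs_of v \<and> s < r} \<times> UNIV)"

definition tm_cross :: "nat \<Rightarrow> template set" where
  "tm_cross q = (\<lambda>(c, b). (idx (R c, b), Inl (idx (U (tc c) (3 * c + 1), b)))) ` ({c. c < C \<and> oc c = q} \<times> UNIV)"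

text \<open>\<open>B\<close> is the set of tiles forbidden by slot \<open>sl\<close>. Their stubs of
  colour 2 are terminal pairs only if there is a hub 2; with two hubs, a forbidden tile merely loses
  its joining demand.\<close>

definition tm_block :: "nat \<Rightarrow> nat \<Rightarrow> nat set \<Rightarrow> template set" where
  "tm_block r sl B =
     (\<lambda>\<theta>. (idx (U \<theta> (3 * (C + sl) + 1), False), Inl (idx (U \<theta> (3 * (C + sl) + 1), True)))) ` ({..<m} - B) \<union>
     (\<lambda>(\<theta>, b). (idx (U \<theta> (3 * (C + sl) + 1), b), Inr 2)) ` ({\<theta> \<in> {..<m} \<inter> B. 2 < r} \<times> UNIV)"

text \<open>Blocking stubs have colour 2 and do not enter here, so the threshold of MaxEDP depends
  on the input only through the number of cells.\<close>

definition low_stubs :: nat where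
  "low_stubs = card {(v, s). is_vertex v \<and> s \<in> stubs_of v \<and> s < 2}"

lemma idx_less: "is_vertex v \<Longrightarrow> idx (v, b) < L"
  using bij_idx by (auto simp: bij_betw_def)

lemma idx_inj: "is_vertex v \<Longrightarrow> is_vertex v' \<Longrightarrow> idx (v, b) = idx (v', b') \<Longrightarrow> v = v' \<and> b = b'"
  using bij_idx by (auto simp: bij_betw_def inj_on_def)

lemma finite_stub_pairs: "finite {(v, s). is_vertex v \<and> s \<in> stubs_of v \<and> s < r}"
  by (rule finite_subset[of _ "{v. is_vertex v} \<times> {..<r}"]) (auto simp: finite_is_vertex)

lemma always_joined_vertex: "always_joined v \<Longrightarrow> is_vertex v"
  by (cases v) (auto simp: stages_def)

lemma finite_templates: "finite (tm_local r)" "finite (tm_cross q)" "finite (tm_block r sl B)"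
proof -
  have "finite links_local" using finite_is_link by (auto simp: links_local_def intro: finite_subset)
  moreover have "finite {v. always_joined v}"
    using always_joined_vertex by (intro finite_subset[OF _ finite_is_vertex]) auto
  ultimately show "finite (tm_local r)" using finite_stub_pairs by (auto simp: tm_local_def)
qed (auto simp: tm_cross_def tm_block_def)

end

locale numbered_gadget =
  numbered_shape m C sc tc oc idx L + gadget m C sc tc N "\<lambda>c. ov (oc c)" blk
  for m C :: nat and sc tc oc :: "nat \<Rightarrow> nat" and idx :: "lv \<times> bool \<Rightarrow> nat" and L N :: nat
    and ov :: "nat \<Rightarrow> nat" and blk :: "nat \<Rightarrow> nat \<Rightarrow> nat \<Rightarrow> bool"
begin

fun num :: "vertex \<Rightarrow> nat" where
  "num (v, j, b) = L * j + idx (v, b)"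

lemma mult_add_inj: "a < L \<Longrightarrow> a' < L \<Longrightarrow> L * j + a = L * j' + a' \<Longrightarrow> j = j' \<and> a = a'" for a a' j j' :: nat
  by (metis add.commute div_mult_self1 mod_mult_self1 add_0 div_less less_nat_zero_code mod_less mult.commute not_gr_zero)

lemma num_inj: "v \<in> verts \<Longrightarrow> v' \<in> verts \<Longrightarrow> num v = num v' \<longleftrightarrow> v = v'"
proof -
  assume *: "v \<in> verts" "v' \<in> verts"
  obtain u j b u' j' b' where v: "v = (u, j, b)" "v' = (u', j', b')" by (cases v, cases v')
  have u: "is_vertex u" "is_vertex u'" using * by (auto simp: v verts_def)
  have "num v = num v' \<Longrightarrow> v = v'"
    using mult_add_inj[OF idx_less[OF u(1)] idx_less[OF u(2)], of j b j' b'] idx_inj[OF u, of b b'] by (simp add: v)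
  then show ?thesis by blast
qed

lemma num_image: "num ` verts = {..<L * N}"
proof (intro equalityI subsetI)
  fix x assume "x \<in> num ` verts"
  then obtain v j b where v: "x = L * j + idx (v, b)" "is_vertex v" "j < N" by (auto simp: verts_def)
  have "x < L * j + L" using v idx_less[of v b] by simp
  also have "\<dots> \<le> L * N" using v(3) by (metis Suc_leI add.commute mult_Suc_right mult_le_mono2)
  finally show "x \<in> {..<L * N}" by simp
next
  fix x assume "x \<in> {..<L * N}"
  then have x: "x < L * N" by simp
  then have "0 < L" by (cases L) auto
  then have "x mod L \<in> {..<L}" by simp
  also have "{..<L} = idx ` ({v. is_vertex v} \<times> UNIV)" using bij_idx by (simp add: bij_betw_def)
  finally obtain v b where v: "is_vertex v" "x mod L = idx (v, b)" by blast
  have "x div L < N" using x by (simp add: less_mult_imp_div_less mult.commute)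
  then have "(v, x div L, b) \<in> verts" "num (v, x div L, b) = x"
    using v(1) by (auto simp: verts_def simp flip: v(2))
  then show "x \<in> num ` verts" by (metis image_eqI)
qed

declare ports.simps [simp del] num.simps [simp del] Sv.simps [simp del] Tv.simps [simp del]
  is_demand.simps [simp del]

definition stubs :: "(nat \<times> nat) set" where
  "stubs = {(x, s). \<exists>v\<in>verts. x = num v \<and> Stub s \<in> set (ports v)}"

lemma stubs_iff: "v \<in> verts \<Longrightarrow> (num v, s) \<in> stubs \<longleftrightarrow> Stub s \<in> set (ports v)"
  by (auto simp: stubs_def num_inj)

text \<open>Cubicity holds because \<open>ports\<close> lists precisely the items at a vertex, and
  these are three distinct ones.\<close>

sublocale cubic_demands "L * N" "{d. is_demand d}" "\<lambda>d. num (Sv d)" "\<lambda>d. num (Tv d)" stubs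
proof
  fix d assume d: "d \<in> {d. is_demand d}"
  then show "num (Sv d) < L * N" "num (Tv d) < L * N" "num (Sv d) \<noteq> num (Tv d)"
    using demand_verts[of d] num_image num_inj[of "Sv d" "Tv d"] by blast+
next
  show "inj_on (\<lambda>d. (num (Sv d), num (Tv d))) {d. is_demand d}"
  proof (rule inj_onI)
    fix d d' assume "d \<in> {d. is_demand d}" "d' \<in> {d. is_demand d}"
      "(num (Sv d), num (Tv d)) = (num (Sv d'), num (Tv d'))"
    then show "d = d'" using inj_Sv_Tv[of d d'] demand_verts[of d] demand_verts[of d'] num_inj by simp
  qed
next
  show "stubs \<subseteq> {..<L * N} \<times> {..<3}" using num_image stub_less by (auto simp: stubs_def)
next
  fix x assume "x < L * N"
  then obtain v where v: "v \<in> verts" "x = num v" using num_image by blast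
  have 1: "{d \<in> {d. is_demand d}. x = num (Sv d) \<or> x = num (Tv d)} = {d. Dem d \<in> set (ports v)}"
  proof -
    have "x = num (Sv d) \<longleftrightarrow> Sv d = v" "x = num (Tv d) \<longleftrightarrow> Tv d = v" if "is_demand d" for d
      using num_inj[OF demand_verts(1)[OF that] v(1)] num_inj[OF demand_verts(2)[OF that] v(1)] v(2) by auto
    then show ?thesis using ports_iff[OF v(1)] by blast
  qed
  have 2: "{c. (x, c) \<in> stubs} = {c. Stub c \<in> set (ports v)}" using stubs_iff v by simp
  have "set (ports v) = Dem ` {d. Dem d \<in> set (ports v)} \<union> Stub ` {c. Stub c \<in> set (ports v)}"
  proof (intro equalityI subsetI)
    fix y assume y: "y \<in> set (ports v)"
    show "y \<in> Dem ` {d. Dem d \<in> set (ports v)} \<union> Stub ` {c. Stub c \<in> set (ports v)}"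
      by (cases y) (use y in auto)
  qed auto
  moreover have fin: "finite {d. Dem d \<in> set (ports v)}" "finite {c. Stub c \<in> set (ports v)}"
    using finite_vimageI[of "set (ports v)" Dem] finite_vimageI[of "set (ports v)" Stub]
    by (auto simp: inj_def vimage_def)
  moreover have "card (Dem ` {d. Dem d \<in> set (ports v)} \<union> Stub ` {c. Stub c \<in> set (ports v)}) =
      card {d. Dem d \<in> set (ports v)} + card {c. Stub c \<in> set (ports v)}"
    using fin by (subst card_Un_disjoint) (auto simp: card_image inj_on_def)
  moreover have "card (set (ports v)) = 3" using distinct_ports[OF v(1)] distinct_card by metis
  ultimately show "card {d \<in> {d. is_demand d}. x = num (Sv d) \<or> x = num (Tv d)} + card {c. (x, c) \<in> stubs} = 3"
    unfolding 1 2 by simp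
qed (rule finite_demands)

lemma proper_iff_good: "proper col \<longleftrightarrow> good col"
proof
  assume p: "proper col"
  have "distinct (map (item_col col) (ports v))" if v: "v \<in> verts" for v
  proof -
    have "inj_on (item_col col) (set (ports v))"
    proof (rule inj_onI)
      fix x y assume xy: "x \<in> set (ports v)" "y \<in> set (ports v)" "item_col col x = item_col col y"
      have dd: "d = d'" if "Dem d \<in> set (ports v)" "Dem d' \<in> set (ports v)" "col d = col d'" for d d'
      proof -
        have "{num (Sv d), num (Tv d)} \<inter> {num (Sv d'), num (Tv d')} \<noteq> {}"
          using that ports_iff[OF v] by auto
        then show ?thesis using p that ports_iff[OF v] unfolding proper_def by blast
      qed
      have ds: "col d \<noteq> s" if "Dem d \<in> set (ports v)" "Stub s \<in> set (ports v)" for d s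
      proof -
        have *: "(num v, s) \<in> stubs" "num v \<in> {num (Sv d), num (Tv d)}" "is_demand d"
          using that ports_iff[OF v] stubs_iff[OF v] by auto
        have "case x of (y, c) \<Rightarrow> y \<in> {num (Sv d), num (Tv d)} \<longrightarrow> col d \<noteq> c" if "x \<in> stubs" for x
          using p that *(3) unfolding proper_def by blast
        from this[OF *(1)] show ?thesis using *(2) by auto
      qed
      show "x = y"
        by (cases x; cases y; insert xy; simp; metis dd ds)
    qed
    then show ?thesis using distinct_ports[OF v] by (simp add: distinct_map)
  qed
  then show "good col" using p unfolding proper_def good_def by blast
next
  assume g: "good col"
  then have inj: "inj_on (item_col col) (set (ports v))" if "v \<in> verts" for v
    using that by (simp add: good_def distinct_map)
  show "proper col"
    unfolding proper_def
  proof (intro conjI ballI impI, goal_cases)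
    case (1 d)
    then show ?case using g unfolding good_def by blast
  next
    case (2 d d')
    have vs: "Sv d \<in> verts" "Tv d \<in> verts" "Sv d' \<in> verts" "Tv d' \<in> verts"
      using demand_verts 2 by blast+
    from 2(4) obtain v v' where v: "v = Sv d \<or> v = Tv d" "v' = Sv d' \<or> v' = Tv d'" "num v = num v'"
      by blast
    then have "v' = v" "v \<in> verts" using num_inj[of v v'] vs by auto
    then have v: "v \<in> verts" "v = Sv d \<or> v = Tv d" "v = Sv d' \<or> v = Tv d'" using v by auto
    then have "Dem d \<in> set (ports v)" "Dem d' \<in> set (ports v)" using ports_iff[OF v(1)] 2 by auto
    then show ?case using inj[OF v(1)] 2(3) unfolding inj_on_def by (metis item.inject(2) item_col_simps(2))
  next
    case (3 d x)
    obtain y s where x: "x = (y, s)" by (cases x)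
    have "y \<in> {num (Sv d), num (Tv d)} \<longrightarrow> col d \<noteq> s"
    proof
      assume "y \<in> {num (Sv d), num (Tv d)}"
      then obtain v where v: "v \<in> verts" "v = Sv d \<or> v = Tv d" "y = num v" using demand_verts[of d] 3 by blast
      then have "Dem d \<in> set (ports v)" "Stub s \<in> set (ports v)"
        using ports_iff[OF v(1), of d] stubs_iff[OF v(1), of s] 3(1,2) x by (simp_all, blast)
      then show "col d \<noteq> s" using inj[OF v(1)] unfolding inj_on_def by (metis item.distinct(1) item_col_simps)
    qed
    then show ?case by (simp add: x)
  qed
qed

lemma stub_ports_iff:
  assumes "is_vertex v"
  shows "Stub s \<in> set (ports (v, j, b)) \<longleftrightarrow> s \<in> stubs_of v \<or> s = 2 \<and> (\<exists>\<theta> k. v = U \<theta> k \<and> blocked j \<theta> k)"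
  by (cases v) (auto simp: ports.simps blocked_def may_block_def)

text \<open>The factor 2 counts the two copies.\<close>

theorem card_low_stubs: "card {(v, c) \<in> stubs. c < 2} = 2 * low_stubs * N"
proof -
  let ?A = "{(v, s). is_vertex v \<and> s \<in> stubs_of v \<and> s < 2} \<times> {..<N} \<times> (UNIV :: bool set)"
  let ?f = "\<lambda>((v, s), j, b). (num (v, j, b), s)"
  have inj: "inj_on ?f ?A"
  proof (rule inj_onI)
    fix x y assume xy: "x \<in> ?A" "y \<in> ?A" "?f x = ?f y"
    obtain v s j b where x: "x = ((v, s), j, b)" by (metis prod.exhaust)
    obtain v' s' j' b' where y: "y = ((v', s'), j', b')" by (metis prod.exhaust)
    have "(v, j, b) = (v', j', b')" using num_inj[of "(v, j, b)" "(v', j', b')"] xy by (simp add: x y verts_def)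
    then show "x = y" using xy by (simp add: x y)
  qed
  have "{(v, c) \<in> stubs. c < 2} = ?f ` ?A"
  proof (intro equalityI subsetI)
    fix x assume "x \<in> {(v, c) \<in> stubs. c < 2}"
    then obtain v j b s where x: "x = (num (v, j, b), s)" "is_vertex v" "j < N" "Stub s \<in> set (ports (v, j, b))" "s < 2"
      unfolding stubs_def verts_def by auto
    then have "s \<in> stubs_of v" using stub_ports_iff by auto
    then have "((v, s), j, b) \<in> ?A" using x by auto
    then show "x \<in> ?f ` ?A" using x(1) by force
  next
    fix x assume "x \<in> ?f ` ?A"
    then obtain v s j b where x: "x = (num (v, j, b), s)" "is_vertex v" "s \<in> stubs_of v" "s < 2" "j < N" by auto
    then have "(num (v, j, b), s) \<in> stubs" using stub_ports_iff stubs_iff[of "(v, j, b)"] by (simp add: verts_def)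
    then show "x \<in> {(v, c) \<in> stubs. c < 2}" using x by auto
  qed
  then have "card {(v, c) \<in> stubs. c < 2} = card ?A" using card_image[OF inj] by simp
  also have "\<dots> = low_stubs * (N * 2)" by (simp only: card_cartesian_product low_stubs_def) simp
  finally show ?thesis by simp
qed

lemma blocked_iff:
  assumes "k < stages"
  shows "blocked j \<theta> k \<longleftrightarrow> (\<exists>sl<2. k = 3 * (C + sl) + 1 \<and> blk sl j \<theta>)"
proof
  assume b: "blocked j \<theta> k"
  then have k: "k mod 3 = 1" "C \<le> k div 3" "blk (k div 3 - C) j \<theta>" by (auto simp: blocked_def may_block_def)
  have "k div 3 < C + 2" using assms by (simp add: stages_def less_mult_imp_div_less mult.commute)
  then have "k div 3 - C < 2" by simp
  moreover have "k = 3 * (C + (k div 3 - C)) + 1" using k mult_div_mod_eq[of 3 k] by simp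
  ultimately show "\<exists>sl<2. k = 3 * (C + sl) + 1 \<and> blk sl j \<theta>" using k(3) by blast
next
  assume "\<exists>sl<2. k = 3 * (C + sl) + 1 \<and> blk sl j \<theta>"
  then obtain sl where sl: "k = 3 * (C + sl) + 1" "blk sl j \<theta>" by blast
  have "k div 3 = C + sl" "k mod 3 = 1" unfolding sl(1) by simp_all
  then show "blocked j \<theta> k" using sl(2) by (simp add: blocked_def may_block_def)
qed

lemma block_stage: "sl < 2 \<Longrightarrow> 3 * (C + sl) + 1 < stages" "may_block (3 * (C + sl) + 1)"
  "\<not> conflict_use \<theta> (3 * (C + sl) + 1)"
proof -
  have "(3 * (C + sl) + 1) div 3 = C + sl" "(3 * (C + sl) + 1) mod 3 = 1" by simp_all
  then show "may_block (3 * (C + sl) + 1)" "\<not> conflict_use \<theta> (3 * (C + sl) + 1)"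
    unfolding may_block_def conflict_use_def by simp_all
qed (simp add: stages_def)

text \<open>Separates the joins common to all cells from those that depend on the cell, in
  accordance with \<open>tm_local\<close> and \<open>tm_block\<close>.\<close>

lemma joined_iff:
  "joined j v \<longleftrightarrow> always_joined v \<or> (\<exists>\<theta> sl. v = U \<theta> (3 * (C + sl) + 1) \<and> \<theta> < m \<and> sl < 2 \<and> \<not> blk sl j \<theta>)"
proof (cases v)
  case (U \<theta> k)
  show ?thesis
  proof (cases "\<theta> < m \<and> k < stages \<and> may_block k")
    case True
    then have k: "k mod 3 = 1" "C \<le> k div 3" by (auto simp: may_block_def)
    have "k div 3 < C + 2" using True by (simp add: stages_def less_mult_imp_div_less mult.commute)
    then have sl: "k div 3 - C < 2" "k = 3 * (C + (k div 3 - C)) + 1" using k mult_div_mod_eq[of 3 k] by auto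
    have "\<not> conflict_use \<theta> k" using k by (simp add: conflict_use_def)
    then have "joined j v \<longleftrightarrow> \<not> blocked j \<theta> k" using True U by simp
    also have "\<dots> \<longleftrightarrow> \<not> blk (k div 3 - C) j \<theta>" using True by (simp add: blocked_def)
    also have "\<dots> \<longleftrightarrow> (\<exists>\<theta>' sl. v = U \<theta>' (3 * (C + sl) + 1) \<and> \<theta>' < m \<and> sl < 2 \<and> \<not> blk sl j \<theta>')"
    proof
      assume "\<exists>\<theta>' sl. v = U \<theta>' (3 * (C + sl) + 1) \<and> \<theta>' < m \<and> sl < 2 \<and> \<not> blk sl j \<theta>'"
      then obtain sl' where sl': "k = 3 * (C + sl') + 1" "\<not> blk sl' j \<theta>" using U by auto
      then have "k div 3 - C = sl'" by simp
      then show "\<not> blk (k div 3 - C) j \<theta>" using sl' by simp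
    qed (use sl True U in blast)
    finally show ?thesis using True U by simp
  next
    case False
    then have "\<not> blocked j \<theta> k \<or> \<not> (\<theta> < m \<and> k < stages)" by (auto simp: blocked_def)
    moreover have "\<not> (\<exists>\<theta>' sl. v = U \<theta>' (3 * (C + sl) + 1) \<and> \<theta>' < m \<and> sl < 2 \<and> \<not> blk sl j \<theta>')"
      using False U block_stage(1,2) by auto
    ultimately show ?thesis using False U by auto
  qed
qed auto

lemma inst_Inl: "inst L r j j' (idx (v, b), Inl (idx (v', b'))) = (r + num (v, j, b), r + num (v', j', b'))"
  and inst_Inr: "inst L r j j' (idx (v, b), Inr s) = (r + num (v, j, b), s)"
  by (simp_all add: inst_def num.simps)

text \<open>The pairs are split by what they depend on besides the cell number: nothing, an offset
  class, or the set of tiles forbidden in the cell. Each part can then be listed by loops over cells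
  around a fixed finite list of templates.\<close>

theorem terminal_pairs_templates:
  "terminal_pairs r =
     {inst L r j j t | j t. j < N \<and> t \<in> tm_local r} \<union>
     {inst L r j ((j + ov q) mod N) t | j q t. j < N \<and> t \<in> tm_cross q} \<union>
     {inst L r j j t | j sl t. j < N \<and> sl < 2 \<and> t \<in> tm_block r sl {\<theta>. blk sl j \<theta>}}"
  (is "_ = ?A \<union> ?B \<union> ?D")
proof (intro equalityI subsetI)
  fix x assume "x \<in> terminal_pairs r"
  then consider (dem) d where "is_demand d" "x = (r + num (Sv d), r + num (Tv d))"
    | (stub) v s where "(v, s) \<in> stubs" "s < r" "x = (r + v, s)"
    unfolding terminal_pairs_def by auto
  then show "x \<in> ?A \<union> ?B \<union> ?D"
  proof cases
    case dem
    obtain e j b where d: "d = (e, j, b)" by (cases d)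
    have j: "j < N" using dem(1) by (simp add: d is_demand.simps)
    show ?thesis
    proof (cases "e \<in> links_local \<or> (\<exists>c. e = Gt c)")
      case True
      then show ?thesis
      proof
        assume e: "e \<in> links_local"
        then have "Tv d = (tgt e, j, b)" by (cases e) (auto simp: d Tv.simps links_local_def)
        then have "x = inst L r j j (idx (src e, b), Inl (idx (tgt e, b)))"
          unfolding dem(2) inst_Inl by (simp add: d Sv.simps)
        moreover have "(idx (src e, b), Inl (idx (tgt e, b))) \<in> tm_local r"
          using e unfolding tm_local_def by force
        ultimately show ?thesis using j by blast
      next
        assume "\<exists>c. e = Gt c"
        then obtain c where e: "e = Gt c" by blast
        then have c: "c < C" using dem(1) by (simp add: d is_demand.simps)
        have "x = inst L r j ((j + ov (oc c)) mod N) (idx (R c, b), Inl (idx (U (tc c) (3 * c + 1), b)))"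
          unfolding dem(2) inst_Inl by (simp add: d e Sv.simps Tv.simps)
        moreover have "(idx (R c, b), Inl (idx (U (tc c) (3 * c + 1), b))) \<in> tm_cross (oc c)"
          using c unfolding tm_cross_def by force
        ultimately show ?thesis using j by blast
      qed
    next
      case False
      then obtain v where e: "e = Jn v" using dem(1) by (cases e) (auto simp: d is_demand.simps links_local_def)
      have jv: "joined j v" "\<not> b" using dem(1) by (auto simp: d e is_demand.simps)
      have x: "x = inst L r j j (idx (v, False), Inl (idx (v, True)))"
        unfolding dem(2) inst_Inl using jv by (simp add: d e Sv.simps Tv.simps)
      from jv(1) consider "always_joined v"
        | \<theta> sl where "v = U \<theta> (3 * (C + sl) + 1)" "\<theta> < m" "sl < 2" "\<not> blk sl j \<theta>"
        unfolding joined_iff by blast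
      then show ?thesis
      proof cases
        case 1
        then have "(idx (v, False), Inl (idx (v, True))) \<in> tm_local r" unfolding tm_local_def by blast
        then show ?thesis using x j by blast
      next
        case 2
        then have "(idx (v, False), Inl (idx (v, True))) \<in> tm_block r sl {\<theta>. blk sl j \<theta>}"
          unfolding tm_block_def by blast
        then show ?thesis using x j 2(3) by blast
      qed
    qed
  next
    case stub
    then obtain v' j b where v: "v = num (v', j, b)" "is_vertex v'" "j < N" "Stub s \<in> set (ports (v', j, b))"
      unfolding stubs_def verts_def by auto
    have x: "x = inst L r j j (idx (v', b), Inr s)" unfolding stub(3) inst_Inr v(1) ..
    from v(4) consider "s \<in> stubs_of v'" | \<theta> k where "s = 2" "v' = U \<theta> k" "blocked j \<theta> k"
      unfolding stub_ports_iff[OF v(2)] by blast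
    then show ?thesis
    proof cases
      case 1
      then have "((v', s), b) \<in> {(v, s). is_vertex v \<and> s \<in> stubs_of v \<and> s < r} \<times> UNIV" using v stub by simp
      then have "(idx (v', b), Inr s) \<in> tm_local r" unfolding tm_local_def by force
      then show ?thesis using x v(3) by blast
    next
      case 2
      then obtain sl where sl: "sl < 2" "k = 3 * (C + sl) + 1" "blk sl j \<theta>" using blocked_iff v(2) by auto
      have "(\<theta>, b) \<in> {\<theta> \<in> {..<m} \<inter> {\<theta>. blk sl j \<theta>}. 2 < r} \<times> UNIV" using 2 v stub sl by simp
      then have "(idx (v', b), Inr s) \<in> tm_block r sl {\<theta>. blk sl j \<theta>}"
        unfolding tm_block_def 2 sl(2) by force
      then show ?thesis using x v(3) sl(1) by blast
    qed
  qed
next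
  fix x assume "x \<in> ?A \<union> ?B \<union> ?D"
  have dem: "(r + num (Sv d), r + num (Tv d)) \<in> terminal_pairs r" if "is_demand d" for d
    using that unfolding terminal_pairs_def by blast
  have link: "inst L r j j (idx (src e, b), Inl (idx (tgt e, b))) \<in> terminal_pairs r" if "e \<in> links_local" "j < N" for e j b
  proof -
    have "is_demand (e, j, b)" using that by (cases e) (auto simp: is_demand.simps links_local_def)
    moreover have "Tv (e, j, b) = (tgt e, j, b)" using that by (cases e) (auto simp: Tv.simps links_local_def)
    ultimately show ?thesis using dem[of "(e, j, b)"] unfolding inst_Inl by (simp add: Sv.simps)
  qed
  have join: "inst L r j j (idx (v, False), Inl (idx (v, True))) \<in> terminal_pairs r" if "joined j v" "j < N" for v j
  proof -
    have "is_demand (Jn v, j, False)" using that by (simp add: is_demand.simps)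
    then show ?thesis using dem[of "(Jn v, j, False)"] unfolding inst_Inl by (simp add: Sv.simps Tv.simps)
  qed
  have st: "inst L r j j (idx (v, b), Inr s) \<in> terminal_pairs r"
    if "is_vertex v" "j < N" "Stub s \<in> set (ports (v, j, b))" "s < r" for v j b s
  proof -
    have "(num (v, j, b), s) \<in> stubs" using that stubs_iff[of "(v, j, b)" s] by (simp add: verts_def)
    then show ?thesis using that(4) unfolding inst_Inr terminal_pairs_def by force
  qed
  from \<open>x \<in> ?A \<union> ?B \<union> ?D\<close> consider (A) j t where "x = inst L r j j t" "j < N" "t \<in> tm_local r"
    | (B) j q t where "x = inst L r j ((j + ov q) mod N) t" "j < N" "t \<in> tm_cross q"
    | (D) j sl t where "x = inst L r j j t" "j < N" "sl < 2" "t \<in> tm_block r sl {\<theta>. blk sl j \<theta>}"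
    by blast
  then show "x \<in> terminal_pairs r"
  proof cases
    case A
    from A(3) consider e b where "t = (idx (src e, b), Inl (idx (tgt e, b)))" "e \<in> links_local"
      | v where "t = (idx (v, False), Inl (idx (v, True)))" "always_joined v"
      | v s b where "t = (idx (v, b), Inr s)" "is_vertex v" "s \<in> stubs_of v" "s < r"
      unfolding tm_local_def by auto
    then show ?thesis
    proof cases
      case 1
      show ?thesis unfolding A(1) 1(1) by (rule link[OF 1(2) A(2)])
    next
      case 2
      have "joined j v" using 2(2) unfolding joined_iff by blast
      then show ?thesis unfolding A(1) 2(1) by (rule join[OF _ A(2)])
    next
      case 3
      have "Stub s \<in> set (ports (v, j, b))" using 3(3) unfolding stub_ports_iff[OF 3(2)] by blast
      then show ?thesis unfolding A(1) 3(1) by (rule st[OF 3(2) A(2) _ 3(4)])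
    qed
  next
    case B
    from B(3) obtain c b where t: "t = (idx (R c, b), Inl (idx (U (tc c) (3 * c + 1), b)))" "c < C" "q = oc c"
      unfolding tm_cross_def by auto
    have "is_demand (Gt c, j, b)" using t B by (simp add: is_demand.simps)
    from dem[OF this] show ?thesis unfolding B(1) t inst_Inl by (simp add: Sv.simps Tv.simps)
  next
    case D
    from D(4) consider \<theta> where "t = (idx (U \<theta> (3 * (C + sl) + 1), False), Inl (idx (U \<theta> (3 * (C + sl) + 1), True)))"
        "\<theta> < m" "\<not> blk sl j \<theta>"
      | \<theta> b where "t = (idx (U \<theta> (3 * (C + sl) + 1), b), Inr 2)" "\<theta> < m" "blk sl j \<theta>" "2 < r"
      unfolding tm_block_def by auto
    then show ?thesis
    proof cases
      case 1
      then show ?thesis using join[of j] joined_iff D(2,3) unfolding D(1) by blast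
    next
      case 2
      have v: "is_vertex (U \<theta> (3 * (C + sl) + 1))" using 2 block_stage(1)[OF D(3)] by simp
      have "blocked j \<theta> (3 * (C + sl) + 1)" using 2 blocked_iff block_stage(1)[OF D(3)] D(3) by blast
      then have "Stub 2 \<in> set (ports (U \<theta> (3 * (C + sl) + 1), j, b))" using stub_ports_iff[OF v] by blast
      then show ?thesis using st[OF v D(2)] 2 unfolding D(1) by blast
    qed
  qed
qed

theorem EDP_iff_tiling:
  assumes "set ps = terminal_pairs 3"
  shows "EDP (hub_instance 3 (L * N) ps) \<longleftrightarrow> (\<exists>sel. tiling sel)"
proof -
  have "EDP (hub_instance 3 (L * N) ps) \<longleftrightarrow> (\<exists>col. proper col)"
    unfolding EDP_def hub_instance_simps assms
    by (rule routable_iff_proper) (rule hub_instance_capacity)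
  then show ?thesis by (simp add: proper_iff_good good_iff_tiling)
qed

text \<open>There are \<open>L * N\<close> leaves and, by \<open>card_low_stubs\<close>,
  \<open>2 * low_stubs * N\<close> stubs of colour below 2; half of
  \<open>2 * L * N + 2 * low_stubs * N\<close> is the threshold.\<close>

theorem MaxEDP_iff_tiling:
  assumes "set ps = terminal_pairs 2"
  shows "MaxEDP (hub_instance 2 (L * N) ps, (L + low_stubs) * N) \<longleftrightarrow> (\<exists>sel. tiling sel)"
proof -
  have "MaxEDP (hub_instance 2 (L * N) ps, (L + low_stubs) * N) \<longleftrightarrow> (\<exists>col. proper col)"
    unfolding MaxEDP_def prod.case hub_instance_simps assms
    by (rule max_routable_iff_proper) (rule hub_instance_capacity, simp_all add: card_low_stubs algebra_simps)
  then show ?thesis by (simp add: proper_iff_good good_iff_tiling)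
qed

end

section \<open>Accepting runs of a nondeterministic machine as tilings\<close>

type_synonym tau = "nat \<times> nat list \<times> nat \<times> (nat \<times> int) list"

text \<open>The tile \<open>Norm \<tau> ss hs\<close> describes a position of all tapes at some time: \<open>\<tau>\<close> is the transition taken
  at that time, \<open>ss\<close> lists the tape symbols at the position, and \<open>hs\<close> tells which heads are there.\<close>

datatype tile = Hash | Dollar | Norm tau "nat list" "bool list"

locale ntm =
  fixes M :: tm
  assumes wf: "wf_tm M"
begin

text \<open>A halted accepting configuration may idle by a transition that changes nothing, which
  pads accepting runs to the height of the grid. A halted configuration in any other state has no
  continuation, so it cannot be padded.\<close>

definition taus :: "tau set" where
  "taus = {(q, rs, q', as). q < states M \<and> length rs = tapes M \<and> set rs \<subseteq> {..<symbols M} \<and>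
     ((q', as) \<in> trans M q rs \<or> q = accept M \<and> q' = accept M \<and> trans M q rs = {} \<and> as = stays rs)}"

definition accepting :: "tau \<Rightarrow> bool" where
  "accepting = (\<lambda>(q, rs, q', as). q = accept M \<and> trans M q rs = {})"

definition tiles :: "tile set" where
  "tiles = {Hash, Dollar} \<union> {Norm (q, rs, q', as) ss hs | q rs q' as ss hs.
     (q, rs, q', as) \<in> taus \<and> length ss = tapes M \<and> set ss \<subseteq> {..<symbols M} \<and> length hs = tapes M \<and>
     (\<forall>k<tapes M. hs ! k \<longrightarrow> ss ! k = rs ! k)}"

text \<open>Relation 1 is between a cell and its right neighbour; relations 2, 3, 4 are between a cell
  and the cells below it to the left, straight, and to the right.\<close>

fun compat :: "nat \<Rightarrow> tile \<Rightarrow> tile \<Rightarrow> bool" where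
  "compat r (Norm (q, rs, q', as) ss hs) (Norm \<tau> ss' hs') \<longleftrightarrow>
     (if r = 1 then (q, rs, q', as) = \<tau>
      else (\<forall>k<tapes M. snd (as ! k) = int r - 3 \<longrightarrow> hs' ! k = hs ! k) \<and>
        (r = 3 \<longrightarrow> q' = fst \<tau> \<and> (\<forall>k<tapes M. ss' ! k = (if hs ! k then fst (as ! k) else ss ! k))))"
| "compat r Hash (Norm \<tau> ss hs) \<longleftrightarrow> r = 1 \<or> (\<forall>k<tapes M. \<not> hs ! k)"
| "compat r (Norm \<tau> ss hs) Dollar \<longleftrightarrow> (r = 3 \<longrightarrow> accepting \<tau>)"
| "compat r _ _ \<longleftrightarrow> True"

definition kind :: "nat \<Rightarrow> nat \<Rightarrow> nat \<Rightarrow> nat" where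
  "kind T t i = (if t = T then 0 else if i = 0 then 1 else if t \<noteq> 0 then 4 else if i = T + 1 then 2 else 3)"

fun kind_ok :: "nat \<Rightarrow> tile \<Rightarrow> bool" where
  "kind_ok \<kappa> Dollar \<longleftrightarrow> \<kappa> = 0"
| "kind_ok \<kappa> Hash \<longleftrightarrow> \<kappa> = 1"
| "kind_ok \<kappa> (Norm \<tau> ss hs) \<longleftrightarrow>
     \<kappa> = 4 \<or> (\<kappa> = 2 \<or> \<kappa> = 3) \<and> fst \<tau> = start M \<and> (\<forall>k<tapes M. hs ! k \<longleftrightarrow> \<kappa> = 2)"

text \<open>Kept apart from \<open>kind\<close>, since only the initial symbols depend on the bits
  of the input. The two constraints occupy the two blocking slots.\<close>

definition sym_class :: "bool list \<Rightarrow> nat \<Rightarrow> nat \<Rightarrow> nat \<Rightarrow> nat option" where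
  "sym_class x T t i = (if t = 0 \<and> i \<noteq> 0 then Some (string_content x (int i - int (T + 1))) else None)"

fun sym_ok :: "nat option \<Rightarrow> tile \<Rightarrow> bool" where
  "sym_ok None \<theta> \<longleftrightarrow> True"
| "sym_ok (Some s) (Norm \<tau> ss hs) \<longleftrightarrow> ss = s # replicate (tapes M - 1) 0"
| "sym_ok (Some s) _ \<longleftrightarrow> False"

text \<open>With cells numbered row by row, neighbours lie at constant distances. A step to the
  right from the last column ends in the \<open>Hash\<close> of the next row, where it is harmless.
  From the \<open>Hash\<close> of a row, relation 2 leads to the last cell of the same row and
  relation 4 to the second cell of the next row; forbidding heads there closes the grid on both
  sides. Class 0 stands for pairs within one cell.\<close>

definition ov :: "nat \<Rightarrow> nat \<Rightarrow> nat" where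
  "ov P r = (if r = 1 then 1 else if r = 2 then P - 1 else if r = 3 then P else if r = 4 then P + 1 else 0)"

text \<open>One column for \<open>Hash\<close> and the positions from \<open>- T\<close> to
  \<open>T + length x + 1\<close>. Position 0 is column \<open>T + 1\<close>. Fewer than
  \<open>T\<close> moves keep the heads away from both ends.\<close>

definition wd :: "bool list \<Rightarrow> nat \<Rightarrow> nat" where
  "wd x T = 2 * T + length x + 3"

definition grid :: "bool list \<Rightarrow> nat \<Rightarrow> (nat \<Rightarrow> tile) \<Rightarrow> bool" where
  "grid x T \<sigma> \<longleftrightarrow> (\<forall>j<(T + 1) * wd x T. \<sigma> j \<in> tiles \<and>
     kind_ok (kind T (j div wd x T) (j mod wd x T)) (\<sigma> j) \<and>
     sym_ok (sym_class x T (j div wd x T) (j mod wd x T)) (\<sigma> j) \<and>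
     (\<forall>r\<in>{1..4}. compat r (\<sigma> j) (\<sigma> ((j + ov (wd x T) r) mod ((T + 1) * wd x T)))))"

lemma tapes_pos: "0 < tapes M" "3 \<le> symbols M" "start M < states M" "accept M < states M"
  using wf by (auto simp: wf_tm_def)

lemma wf_trans:
  assumes "q < states M" "length ss = tapes M" "set ss \<subseteq> {..<symbols M}" "(q', as) \<in> trans M q ss"
  shows "q' < states M" "length as = tapes M" "set as \<subseteq> {..<symbols M} \<times> {-1, 0, 1}"
  using wf assms unfolding wf_tm_def by blast+

lemma taus_wf:
  assumes "(q, rs, q', as) \<in> taus"
  shows "q < states M" "q' < states M" "length rs = tapes M" "set rs \<subseteq> {..<symbols M}"
    "length as = tapes M" "set as \<subseteq> {..<symbols M} \<times> {-1, 0, 1}"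
proof -
  have *: "q < states M" "length rs = tapes M" "set rs \<subseteq> {..<symbols M}"
    "(q', as) \<in> trans M q rs \<or> q = accept M \<and> q' = accept M \<and> trans M q rs = {} \<and> as = stays rs"
    using assms by (auto simp: taus_def)
  then show "q < states M" "length rs = tapes M" "set rs \<subseteq> {..<symbols M}" by auto
  show "q' < states M" "length as = tapes M" "set as \<subseteq> {..<symbols M} \<times> {-1, 0, 1}"
    using *(4) wf_trans[OF *(1,2,3), of q' as] * by auto
qed

lemma finite_taus: "finite taus"
proof (rule finite_subset)
  let ?S = "{..<symbols M}"
  show "taus \<subseteq> {..<states M} \<times> {xs. set xs \<subseteq> ?S \<and> length xs = tapes M} \<times> {..<states M} \<times>
    {xs. set xs \<subseteq> ?S \<times> {-1, 0, 1} \<and> length xs = tapes M}"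
  proof
    fix \<tau> assume "\<tau> \<in> taus"
    moreover obtain q rs q' as where "\<tau> = (q, rs, q', as)" by (cases \<tau>)
    ultimately show "\<tau> \<in> {..<states M} \<times> {xs. set xs \<subseteq> ?S \<and> length xs = tapes M} \<times> {..<states M} \<times>
      {xs. set xs \<subseteq> ?S \<times> {-1, 0, 1} \<and> length xs = tapes M}"
      using taus_wf[of q rs q' as] by simp
  qed
  show "finite ({..<states M} \<times> {xs. set xs \<subseteq> ?S \<and> length xs = tapes M} \<times> {..<states M} \<times>
    {xs. set xs \<subseteq> ?S \<times> {-1, 0, 1 :: int} \<and> length xs = tapes M})"
    by (intro finite_cartesian_product finite_lists_length_eq) auto
qed

lemma finite_tiles: "finite tiles"
proof (rule finite_subset)
  let ?A = "taus \<times> {xs. set xs \<subseteq> {..<symbols M} \<and> length xs = tapes M} \<times>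
    {xs. set xs \<subseteq> (UNIV :: bool set) \<and> length xs = tapes M}"
  show "tiles \<subseteq> {Hash, Dollar} \<union> (\<lambda>(\<tau>, ss, hs). Norm \<tau> ss hs) ` ?A"
  proof
    fix \<theta> assume \<theta>: "\<theta> \<in> tiles"
    show "\<theta> \<in> {Hash, Dollar} \<union> (\<lambda>(\<tau>, ss, hs). Norm \<tau> ss hs) ` ?A"
    proof (cases \<theta>)
      case (Norm \<tau> ss hs)
      then have "(\<tau>, ss, hs) \<in> ?A" using \<theta> by (auto simp: tiles_def)
      then show ?thesis using Norm by (intro UnI2 image_eqI[of _ _ "(\<tau>, ss, hs)"]) simp_all
    qed simp_all
  qed
  show "finite ({Hash, Dollar} \<union> (\<lambda>(\<tau>, ss, hs). Norm \<tau> ss hs) ` ?A)"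
    using finite_taus finite_lists_length_eq[of "UNIV :: bool set" "tapes M"]
      finite_lists_length_eq[of "{..<symbols M}" "tapes M"]
    by (intro finite_UnI finite_imageI finite_cartesian_product) auto
qed

lemma tilesD:
  assumes "Norm (q, rs, q', as) ss hs \<in> tiles"
  shows "(q, rs, q', as) \<in> taus" "length ss = tapes M" "\<And>k. k < tapes M \<Longrightarrow> hs ! k \<Longrightarrow> ss ! k = rs ! k"
  using assms by (auto simp: tiles_def)

definition conf_ok :: "nat \<Rightarrow> config \<Rightarrow> bool" where
  "conf_ok t c \<longleftrightarrow> fst c < states M \<and> length (snd c) = tapes M \<and>
     (\<forall>tp\<in>set (snd c). (\<forall>i. fst tp i < symbols M) \<and> \<bar>snd tp\<bar> \<le> int t)"

lemma conf_ok_scan: "conf_ok t c \<Longrightarrow> set (map scan (snd c)) \<subseteq> {..<symbols M}"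
  by (auto simp: conf_ok_def scan_def)

lemma conf_ok_init: "conf_ok 0 (init_config M x)"
  using tapes_pos by (auto simp: conf_ok_def init_config_def string_content_def)

lemma conf_ok_step:
  assumes c: "conf_ok t c" and \<tau>: "(fst c, map scan (snd c), q', as) \<in> taus"
  shows "conf_ok (Suc t) (q', map2 act as (snd c))"
proof -
  note w = taus_wf[OF \<tau>]
  have "(\<forall>i. fst tp i < symbols M) \<and> \<bar>snd tp\<bar> \<le> int (Suc t)" if tp: "tp \<in> set (map2 act as (snd c))" for tp
  proof -
    obtain a tq where tq: "tp = act a tq" "(a, tq) \<in> set (zip as (snd c))" using tp by auto
    then have "a \<in> {..<symbols M} \<times> {-1, 0, 1}" "tq \<in> set (snd c)"
      using w(6) by (auto dest: set_zip_leftD set_zip_rightD)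
    moreover from this have "\<forall>i. fst tq i < symbols M" "\<bar>snd tq\<bar> \<le> int t" using c by (auto simp: conf_ok_def)
    ultimately show ?thesis unfolding tq(1) act_def by auto
  qed
  then show ?thesis using c w(2,5) by (simp add: conf_ok_def)
qed

lemma stay_act: "map2 act (stays (map scan ts)) ts = ts"
  by (rule nth_equalityI) (auto simp: act_stay)

lemma div_mod_cell: "i < P \<Longrightarrow> (t * P + i) div P = t \<and> (t * P + i) mod P = i" for t i P :: nat
  by simp

text \<open>The space-time diagram of the run, prolonged by idling. In row \<open>t\<close> the
  heads are within distance \<open>t\<close> of the origin, so above row \<open>T\<close> they never
  reach the outermost proper columns and the border constraints hold.\<close>

lemma grid_if_accepts:
  assumes run: "(step M ^^ t0) (init_config M x) c" and hlt: "halted M c" and acc: "fst c = accept M" and t0: "t0 < T"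
  shows "\<exists>\<sigma>. grid x T \<sigma>"
proof -
  obtain f0 where f0: "f0 0 = init_config M x" "f0 t0 = c" "\<And>t. t < t0 \<Longrightarrow> step M (f0 t) (f0 (Suc t))"
    using run unfolding relpowp_fun_conv by blast
  \<comment> \<open>\<open>min\<close> freezes the configuration once the machine has
    halted.\<close>
  define f where "f t = f0 (min t t0)" for t
  have nxt: "\<exists>q' as. (conf_ok t (f t) \<longrightarrow> (fst (f t), map scan (snd (f t)), q', as) \<in> taus) \<and> f (Suc t) = (q', map2 act as (snd (f t))) \<and>
      (t0 \<le> t \<longrightarrow> accepting (fst (f t), map scan (snd (f t)), q', as))" for t
  proof (cases "t < t0")
    case True
    then have "step M (f t) (f (Suc t))" using f0(3)[of t] by (simp add: f_def min_def)
    then obtain q' as where s: "(q', as) \<in> trans M (fst (f t)) (map scan (snd (f t)))" "f (Suc t) = (q', map2 act as (snd (f t)))"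
      unfolding step_def by blast
    have "conf_ok t (f t) \<longrightarrow> (fst (f t), map scan (snd (f t)), q', as) \<in> taus"
      using s(1) conf_ok_scan[of t "f t"] by (auto simp: taus_def conf_ok_def)
    then show ?thesis using s True by auto
  next
    case False
    then have ft: "f t = c" "f (Suc t) = c" using f0(2) by (simp_all add: f_def min_def)
    have tr: "trans M (accept M) (map scan (snd c)) = {}"
      using hlt acc unfolding halted_def step_def by auto
    have "f (Suc t) = (accept M, map2 act (stays (map scan (snd (f t)))) (snd (f t)))"
      unfolding ft stay_act using acc by (metis prod.collapse)
    moreover have "conf_ok t (f t) \<longrightarrow> (fst (f t), map scan (snd (f t)), accept M, stays (map scan (snd (f t)))) \<in> taus"
      using tr acc conf_ok_scan[of t c] by (auto simp: taus_def conf_ok_def ft)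
    moreover have "accepting (fst (f t), map scan (snd (f t)), accept M, stays (map scan (snd (f t))))"
      using tr acc by (simp add: accepting_def ft)
    ultimately show ?thesis by blast
  qed
  then obtain q' as where nx: "\<And>t. conf_ok t (f t) \<Longrightarrow> (fst (f t), map scan (snd (f t)), q' t, as t) \<in> taus"
    "\<And>t. f (Suc t) = (q' t, map2 act (as t) (snd (f t)))"
    "\<And>t. t0 \<le> t \<Longrightarrow> accepting (fst (f t), map scan (snd (f t)), q' t, as t)" by metis
  have ok: "conf_ok t (f t)" for t
  proof (induction t)
    case 0
    then show ?case using conf_ok_init f0(1) by (simp add: f_def)
  next
    case (Suc t)
    then show ?case using conf_ok_step[OF Suc nx(1)[OF Suc]] nx(2) by simp
  qed
  define \<tau> where "\<tau> t = (fst (f t), map scan (snd (f t)), q' t, as t)" for t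
  have \<tau>: "\<tau> t \<in> taus" for t using nx(1)[OF ok] by (simp add: \<tau>_def)
  have len: "length (snd (f t)) = tapes M" for t using ok[of t] by (simp add: conf_ok_def)
  have lena: "length (as t) = tapes M" for t using taus_wf(5)[OF nx(1)[OF ok]] by simp
  have headb: "\<bar>snd (snd (f t) ! k)\<bar> \<le> int t" if "k < tapes M" for t k
    using ok[of t] that by (simp add: conf_ok_def)
  let ?P = "wd x T"
  let ?N = "(T + 1) * ?P"
  have P: "0 < ?P" "T + 1 < ?P" by (simp_all add: wd_def)
  have P3: "?P = 2 * T + length x + 3" by (simp add: wd_def)
  define pos where "pos i = int i - int (T + 1)" for i
  define ss where "ss t i = map (\<lambda>tp. fst tp (pos i)) (snd (f t))" for t i
  define hs where "hs t i = map (\<lambda>tp. snd tp = pos i) (snd (f t))" for t i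
  define g where "g t i = (if t = T then Dollar else if i = 0 then Hash else Norm (\<tau> t) (ss t i) (hs t i))" for t i
  define \<sigma> where "\<sigma> j = g (j div ?P) (j mod ?P)" for j
  have \<sigma>: "\<sigma> (t * ?P + i) = g t i" if "i < ?P" for t i using div_mod_cell[OF that] by (simp add: \<sigma>_def)
  have g_tiles: "g t i \<in> tiles" for t i
  proof -
    have "set (ss t i) \<subseteq> {..<symbols M}" using ok[of t] by (auto simp: ss_def conf_ok_def)
    then show ?thesis using \<tau>[of t] len[of t]
      by (auto simp: g_def tiles_def \<tau>_def ss_def hs_def scan_def)
  qed
  have nextsym: "ss (Suc t) i ! k = (if hs t i ! k then fst (as t ! k) else ss t i ! k)"
    and nexthead: "hs (Suc t) i ! k \<longleftrightarrow> snd (snd (f t) ! k) + snd (as t ! k) = pos i" if "k < tapes M" for t i k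
    using that len[of t] len[of "Suc t"] lena[of t] nx(2)[of t] by (auto simp: ss_def hs_def act_def)
  have nohead: "\<not> hs t i ! k" if "k < tapes M" "i = 1 \<or> i = ?P - 1" "t < T" for t i k
    using headb[OF that(1), of t] that len[of t] P3 by (auto simp: hs_def pos_def)
  have "kind_ok (kind T t i) (g t i)" for t i
    using len[of 0] t0 f0(1)
    by (auto simp: g_def kind_def \<tau>_def hs_def pos_def f_def init_config_def nth_Cons')
  moreover have "sym_ok (sym_class x T t i) (g t i)" for t i
    using t0 f0(1)
    by (auto simp: g_def sym_class_def ss_def pos_def f_def init_config_def string_content_def[of "[]"])
  moreover have "compat r (\<sigma> j) (\<sigma> ((j + ov ?P r) mod ?N))" if j: "j < ?N" and r: "r \<in> {1..4}" for j r
  proof -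
    define t i where "t = j div ?P" and "i = j mod ?P"
    have ji: "j = t * ?P + i" "i < ?P" using P by (simp_all add: t_def i_def div_mult_mod_eq)
    have "t < T + 1" using j by (simp add: t_def less_mult_imp_div_less)
    show ?thesis
    proof (cases "t = T")
      case True
      then show ?thesis using \<sigma>[OF ji(2), of t] ji(1) by (simp add: g_def)
    next
      case False
      then have t: "t < T" using \<open>t < T + 1\<close> by simp
      have sj: "\<sigma> j = g t i" using \<sigma>[OF ji(2)] ji(1) by simp
      have to: "\<sigma> ((j + ov ?P r) mod ?N) = g t' i'" if "j + ov ?P r = t' * ?P + i'" "i' < ?P" "t' \<le> T" for t' i'
      proof -
        have "t' * ?P \<le> T * ?P" by (rule mult_le_mono1[OF that(3)])
        then have "t' * ?P + i' < T * ?P + ?P" using that(2) by linarith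
        then have "t' * ?P + i' < (T + 1) * ?P" by (simp add: algebra_simps)
        then have "(j + ov ?P r) mod ?N = t' * ?P + i'" using that(1) by simp
        then show ?thesis using \<sigma>[OF that(2)] by simp
      qed
      \<comment> \<open>The first column holds \<open>Hash\<close>, or \<open>Dollar\<close> in row
        \<open>T\<close>; a \<open>Dollar\<close> restricts only the proper tile straight above
        it.\<close>
      have hash: "compat r (g t i) (g t' 0)" if "r \<noteq> 3 \<or> i = 0" for t'
        using that t by (cases "\<tau> t") (auto simp: g_def)
      consider "r = 1" | "r = 2" | "r = 3" | "r = 4" using r by fastforce
      then show ?thesis
      proof cases
        case 1
        show ?thesis
        proof (cases "i + 1 < ?P")
          case True
          have s': "\<sigma> ((j + ov ?P r) mod ?N) = g t (i + 1)" by (rule to) (use 1 ji t True in \<open>auto simp: ov_def\<close>)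
          show ?thesis unfolding sj s' using 1 t by (cases "\<tau> t") (auto simp: g_def)
        next
          case False
          then have i: "i + 1 = ?P" using ji by simp
          have s': "\<sigma> ((j + ov ?P r) mod ?N) = g (Suc t) 0" by (rule to) (use 1 ji t i P in \<open>auto simp: ov_def\<close>)
          show ?thesis unfolding sj s' by (rule hash) (use 1 in simp)
        qed
      next
        case 2
        show ?thesis
        proof (cases "i = 0")
          case True
          have s': "\<sigma> ((j + ov ?P r) mod ?N) = g t (?P - 1)" by (rule to) (use 2 ji t True P in \<open>auto simp: ov_def\<close>)
          show ?thesis unfolding sj s' using 2 True t nohead[of _ "?P - 1" t] by (auto simp: g_def)
        next
          case False
          have s': "\<sigma> ((j + ov ?P r) mod ?N) = g (Suc t) (i - 1)" by (rule to) (use 2 ji t False P in \<open>auto simp: ov_def\<close>)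
          have "hs (Suc t) (i - 1) ! k = hs t i ! k" if "k < tapes M" "snd (as t ! k) = -1" for k
            using nexthead[OF that(1), of t "i - 1"] that False len[of t] by (auto simp: hs_def pos_def)
          then show ?thesis unfolding sj s' using 2 False t by (auto simp: g_def \<tau>_def)
        qed
      next
        case 3
        have s': "\<sigma> ((j + ov ?P r) mod ?N) = g (Suc t) i" by (rule to) (use 3 ji t P in \<open>auto simp: ov_def\<close>)
        have "hs (Suc t) i ! k = hs t i ! k" if "k < tapes M" "snd (as t ! k) = 0" for k
          using nexthead[OF that(1), of t i] that len[of t] by (auto simp: hs_def pos_def)
        moreover have "accepting (\<tau> t)" if "Suc t = T" using nx(3)[of t] that t0 by (simp add: \<tau>_def)
        moreover have "q' t = fst (f (Suc t))" using nx(2) by simp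
        ultimately show ?thesis unfolding sj s' using 3 t nextsym[of _ t i] by (auto simp: g_def \<tau>_def)
      next
        case 4
        show ?thesis
        proof (cases "i + 1 < ?P")
          case True
          have s': "\<sigma> ((j + ov ?P r) mod ?N) = g (Suc t) (i + 1)" by (rule to) (use 4 ji t True P in \<open>auto simp: ov_def\<close>)
          have "hs (Suc t) (i + 1) ! k = hs t i ! k" if "k < tapes M" "snd (as t ! k) = 1" for k
            using nexthead[OF that(1), of t "i + 1"] that len[of t] by (auto simp: hs_def pos_def)
          moreover have "\<not> hs (Suc t) (i + 1) ! k" if "k < tapes M" "i = 0" "Suc t \<noteq> T" for k
            using nohead[of k 1 "Suc t"] that t by simp
          ultimately show ?thesis unfolding sj s' using 4 t by (auto simp: g_def \<tau>_def)
        next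
          case False
          then have i: "i + 1 = ?P" using ji by simp
          \<comment> \<open>From the last column, relation 4 reaches the border two rows below, or
            wraps around to cell 0 if that row does not exist.\<close>
          have eq: "j + ov ?P r = (t + 2) * ?P" using 4 ji(1) i by (simp add: ov_def algebra_simps)
          show ?thesis
          proof (cases "t + 2 \<le> T")
            case True
            have s': "\<sigma> ((j + ov ?P r) mod ?N) = g (t + 2) 0" by (rule to) (use eq P True in auto)
            show ?thesis unfolding sj s' by (rule hash) (use 4 in simp)
          next
            case False
            then have "t + 2 = T + 1" using t by simp
            then have "(j + ov ?P r) mod ?N = 0" using eq by simp
            then have s': "\<sigma> ((j + ov ?P r) mod ?N) = g 0 0" using \<sigma>[of 0 0] P by simp
            show ?thesis unfolding sj s' by (rule hash) (use 4 in simp)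
          qed
        qed
      qed
    qed
  qed
  ultimately have "grid x T \<sigma>" unfolding grid_def \<sigma>_def using g_tiles by simp
  then show ?thesis by blast
qed

lemma compat_row: "compat 1 (Norm \<tau> ss hs) (Norm \<tau>' ss' hs') \<longleftrightarrow> \<tau> = \<tau>'"
  by (cases \<tau>) simp

text \<open>Each row above the last encodes a configuration in the sense of \<open>rep\<close>.
  Relation 1 makes the transition common to the row, and the tiles at the heads make it read the
  scanned symbols. Relation 3 transports the state and the symbols, relations 2 to 4 the heads, and
  the border keeps heads from entering. The final row requires the last transition to be
  accepting.\<close>

lemma accepts_if_grid:
  assumes grid: "grid x T \<sigma>" and T: "0 < T"
  shows "\<exists>t c. (step M ^^ t) (init_config M x) c \<and> halted M c \<and> fst c = accept M"
proof -
  let ?P = "wd x T"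
  let ?N = "(T + 1) * ?P"
  have P3: "?P = 2 * T + length x + 3" by (simp add: wd_def)
  have P: "1 < ?P" "T + 1 < ?P" by (simp_all add: wd_def)
  define pos where "pos i = int i - int (T + 1)" for i
  define g where "g t i = \<sigma> (t * ?P + i)" for t i
  have lt: "t * ?P + i < ?N" if "t \<le> T" "i < ?P" for t i
  proof -
    have "t * ?P \<le> T * ?P" by (rule mult_le_mono1[OF that(1)])
    then have "t * ?P + i < T * ?P + ?P" using that(2) by linarith
    then show ?thesis by (simp add: algebra_simps)
  qed
  have cell: "g t i \<in> tiles" "kind_ok (kind T t i) (g t i)" "sym_ok (sym_class x T t i) (g t i)"
    if "t \<le> T" "i < ?P" for t i
    using grid lt[OF that] div_mod_cell[OF that(2), of t] unfolding grid_def g_def by metis+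
  have comp: "compat r (g t i) (g t' i')"
    if "t \<le> T" "i < ?P" "t' \<le> T" "i' < ?P" "r \<in> {1..4}" "t * ?P + i + ov ?P r = t' * ?P + i'" for r t i t' i'
  proof -
    have "compat r (\<sigma> (t * ?P + i)) (\<sigma> ((t * ?P + i + ov ?P r) mod ?N))"
      using grid lt[OF that(1,2)] that(5) unfolding grid_def by blast
    moreover have "(t * ?P + i + ov ?P r) mod ?N = t' * ?P + i'" using that(6) lt[OF that(3,4)] by simp
    ultimately show ?thesis by (simp add: g_def)
  qed
  have dollar: "g T i = Dollar" if "i < ?P" for i
    using cell(2)[of T i] that by (cases "g T i") (auto simp: kind_def)
  have hash: "g t 0 = Hash" if "t < T" for t
    using cell(2)[of t 0] that P by (cases "g t 0") (auto simp: kind_def)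
  have "\<exists>\<tau> ss hs. g t i = Norm \<tau> ss hs" if "t < T" "0 < i" "i < ?P" for t i
    using cell(2)[of t i] that by (cases "g t i") (auto simp: kind_def split: if_splits)
  then obtain TT S H where g0: "\<And>t i. t < T \<Longrightarrow> 0 < i \<Longrightarrow> i < ?P \<Longrightarrow> g t i = Norm (TT t i) (S t i) (H t i)" by metis
  have row: "TT t i = TT t 1" if t: "t < T" and i: "0 < i" "i < ?P" for t i
    using i
  proof (induction i)
    case (Suc i)
    show ?case
    proof (cases "i = 0")
      case False
      have "compat 1 (g t i) (g t (Suc i))" by (rule comp) (use Suc t in \<open>auto simp: ov_def\<close>)
      then have "TT t i = TT t (Suc i)" using g0[of t i] g0[of t "Suc i"] Suc t False compat_row by simp
      then show ?thesis using Suc False by simp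
    qed simp
  qed simp
  have "\<exists>q rs q' as. TT t 1 = (q, rs, q', as)" for t by (cases "TT t 1") auto
  then obtain q rs q' as where TT: "\<And>t. TT t 1 = (q t, rs t, q' t, as t)" by metis
  have gN: "g t i = Norm (q t, rs t, q' t, as t) (S t i) (H t i)" if "t < T" "0 < i" "i < ?P" for t i
    using g0[OF that] row[OF that] TT by simp
  have tau: "(q t, rs t, q' t, as t) \<in> taus" if "t < T" for t
    using cell(1)[of t 1] gN[of t 1] that P tilesD(1) by simp
  have HS: "S t i ! k = rs t ! k" if "t < T" "0 < i" "i < ?P" "k < tapes M" "H t i ! k" for t i k
    using cell(1)[of t i] gN[of t i] that tilesD(3) by simp
  have row0: "q 0 = start M" "0 < i \<Longrightarrow> i < ?P \<Longrightarrow> k < tapes M \<Longrightarrow> H 0 i ! k \<longleftrightarrow> i = T + 1"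
    "0 < i \<Longrightarrow> i < ?P \<Longrightarrow> S 0 i = string_content x (pos i) # replicate (tapes M - 1) 0" for i k
  proof -
    show "q 0 = start M" using cell(2)[of 0 1] gN[of 0 1] T P by (simp add: kind_def split: if_splits)
    show "0 < i \<Longrightarrow> i < ?P \<Longrightarrow> k < tapes M \<Longrightarrow> H 0 i ! k \<longleftrightarrow> i = T + 1"
      using cell(2)[of 0 i] gN[of 0 i] T by (simp add: kind_def split: if_splits)
    show "0 < i \<Longrightarrow> i < ?P \<Longrightarrow> S 0 i = string_content x (pos i) # replicate (tapes M - 1) 0"
      using cell(3)[of 0 i] gN[of 0 i] T by (simp add: sym_class_def pos_def)
  qed
  define rep where "rep t c \<longleftrightarrow> fst c = q t \<and> length (snd c) = tapes M \<and> (\<forall>k<tapes M.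
     \<bar>snd (snd c ! k)\<bar> \<le> int t \<and> (\<forall>i. 0 < i \<longrightarrow> i < ?P \<longrightarrow>
       S t i ! k = fst (snd c ! k) (pos i) \<and> (H t i ! k \<longleftrightarrow> snd (snd c ! k) = pos i)))" for t c
  have scan: "map scan (snd c) = rs t" if r: "rep t c" and t: "t < T" for t c
  proof (rule nth_equalityI)
    show "length (map scan (snd c)) = length (rs t)" using r taus_wf(3)[OF tau[OF t]] by (simp add: rep_def)
    fix k assume "k < length (map scan (snd c))"
    then have k: "k < tapes M" "k < length (snd c)" using r by (simp_all add: rep_def)
    define h where "h = snd (snd c ! k)"
    define i where "i = nat (h + int (T + 1))"
    have h: "\<bar>h\<bar> \<le> int t" using r k by (simp add: rep_def h_def)
    then have i: "0 < i" "i < ?P" "pos i = h" using t P3 by (auto simp: i_def pos_def)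
    then have "H t i ! k" "S t i ! k = fst (snd c ! k) h" using r k by (auto simp: rep_def h_def)
    then show "map scan (snd c) ! k = rs t ! k" using HS[OF t i(1,2) k(1)] k by (simp add: scan_def h_def)
  qed
  have inv: "t < T \<Longrightarrow> \<exists>t' c. (step M ^^ t') (init_config M x) c \<and> rep t c" for t
  proof (induction t)
    case 0
    have "rep 0 (init_config M x)"
      unfolding rep_def
    proof (intro conjI allI impI)
      show "fst (init_config M x) = q 0" using row0(1) by (simp add: init_config_def)
      show "length (snd (init_config M x)) = tapes M" using tapes_pos(1) by (simp add: init_config_def)
      fix k assume k: "k < tapes M"
      show "\<bar>snd (snd (init_config M x) ! k)\<bar> \<le> int 0" using k by (auto simp: init_config_def nth_Cons')
      fix i assume i: "0 < i" "i < ?P"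
      show "S 0 i ! k = fst (snd (init_config M x) ! k) (pos i)"
        using row0(3)[OF i] k by (auto simp: init_config_def nth_Cons' string_content_def[of "[]"])
      show "H 0 i ! k \<longleftrightarrow> snd (snd (init_config M x) ! k) = pos i"
        using row0(2)[OF i k] k by (auto simp: init_config_def nth_Cons' pos_def)
    qed
    then show ?case by (intro exI[of _ 0] exI[of _ "init_config M x"]) auto
  next
    case (Suc t)
    then have t: "t < T" by simp
    from Suc.IH[OF t] obtain t' c where c: "(step M ^^ t') (init_config M x) c" "rep t c" by blast
    note sc = scan[OF c(2) t]
    let ?c = "(q' t, map2 act (as t) (snd c))"
    note tw = taus_wf[OF tau[OF t]]
    have fc: "fst c = q t" "length (snd c) = tapes M" using c(2) by (simp_all add: rep_def)
    \<comment> \<open>An idle transition reproduces the configuration, so the machine may have made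
      fewer steps than there are rows.\<close>
    have "\<exists>t''. (step M ^^ t'') (init_config M x) ?c"
    proof (cases "(q' t, as t) \<in> trans M (q t) (rs t)")
      case True
      then have "step M c ?c" unfolding step_def using fc(1) sc by auto
      then show ?thesis using c(1) by (intro exI[of _ "Suc t'"]) auto
    next
      case False
      then have st: "q t = accept M" "q' t = accept M" "as t = stays (rs t)"
        using tau[OF t] by (auto simp: taus_def)
      have "?c = c" using stay_act[of "snd c"] fc(1) unfolding st(2,3) sc[symmetric] st(1)
        by (metis prod.collapse st(1))
      then show ?thesis using c(1) by metis
    qed
    moreover have "rep (Suc t) ?c"
      unfolding rep_def
    proof (intro conjI allI impI)
      have "compat 3 (g t 1) (g (Suc t) 1)" by (rule comp) (use Suc P in \<open>auto simp: ov_def\<close>)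
      then show "fst ?c = q (Suc t)" using gN[of t 1] gN[of "Suc t" 1] Suc.prems P by simp
      show "length (snd ?c) = tapes M" using fc tw by simp
      fix k assume k: "k < tapes M"
      define h where "h = snd (snd c ! k)"
      define d where "d = snd (as t ! k)"
      have "as t ! k \<in> set (as t)" using k tw(5) by simp
      then have "as t ! k \<in> {..<symbols M} \<times> {-1, 0, 1}" using tw(6) by blast
      then have d: "d = -1 \<or> d = 0 \<or> d = 1" unfolding d_def by (cases "as t ! k") auto
      have h: "\<bar>h\<bar> \<le> int t" using c(2) k by (simp add: rep_def h_def)
      have tk: "snd ?c ! k = ((fst (snd c ! k))(h := fst (as t ! k)), h + d)"
        using k fc tw(5) by (simp add: act_def h_def d_def)
      show "\<bar>snd (snd ?c ! k)\<bar> \<le> int (Suc t)" unfolding tk using h d by auto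
      fix i assume i: "0 < i" "i < ?P"
      have old: "S t i' ! k = fst (snd c ! k) (pos i')" "H t i' ! k \<longleftrightarrow> h = pos i'" if "0 < i'" "i' < ?P" for i'
        using c(2) k that by (auto simp: rep_def h_def)
      have c3: "compat 3 (g t i) (g (Suc t) i)" by (rule comp) (use Suc i in \<open>auto simp: ov_def\<close>)
      have "S (Suc t) i ! k = (if H t i ! k then fst (as t ! k) else S t i ! k)"
        using c3 gN[of t i] gN[of "Suc t" i] Suc.prems i k by simp
      then show "S (Suc t) i ! k = fst (snd ?c ! k) (pos i)" unfolding tk using old[OF i] by auto
      \<comment> \<open>The movement \<open>d\<close> selects the relation that decides about the
        head, namely the one from the cell it would come from. If that cell lies outside the proper
        columns, the \<open>Hash\<close> excludes a head instead, in agreement with the bound on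
        \<open>h\<close>.\<close>
      have "H (Suc t) i ! k \<longleftrightarrow> h + d = pos i"
        using d
      proof (elim disjE)
        assume d0: "d = 0"
        then have "H (Suc t) i ! k = H t i ! k"
          using c3 gN[of t i] gN[of "Suc t" i] Suc.prems i k by (simp add: d_def)
        then show ?thesis using d0 old[OF i] by simp
      next
        assume d1: "d = 1"
        have c4: "compat 4 (g t (i - 1)) (g (Suc t) i)" by (rule comp) (use Suc i in \<open>auto simp: ov_def\<close>)
        show ?thesis
        proof (cases "i = 1")
          case True
          then have "\<not> H (Suc t) i ! k" using c4 hash[OF t] gN[of "Suc t" i] Suc.prems i k by simp
          moreover have "h + d \<noteq> pos i" using True d1 h Suc.prems by (auto simp: pos_def)
          ultimately show ?thesis by simp
        next
          case False
          then have i': "0 < i - 1" "i - 1 < ?P" using i by auto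
          have "H (Suc t) i ! k = H t (i - 1) ! k"
            using c4 gN[OF t i'] gN[of "Suc t" i] Suc.prems i k d1 by (simp add: d_def)
          moreover have "pos (i - 1) + 1 = pos i" using i by (simp add: pos_def)
          ultimately show ?thesis using d1 old(2)[OF i'] by auto
        qed
      next
        assume d1: "d = -1"
        show ?thesis
        proof (cases "i + 1 < ?P")
          case True
          have c2: "compat 2 (g t (i + 1)) (g (Suc t) i)" by (rule comp) (use Suc i True in \<open>auto simp: ov_def\<close>)
          have "H (Suc t) i ! k = H t (i + 1) ! k"
            using c2 gN[of t "i + 1"] gN[of "Suc t" i] Suc.prems i k d1 True by (simp add: d_def)
          moreover have "pos (i + 1) - 1 = pos i" by (simp add: pos_def)
          ultimately show ?thesis using d1 old(2)[of "i + 1"] True by auto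
        next
          case False
          then have iP: "i = ?P - 1" using i by simp
          have c2: "compat 2 (g (Suc t) 0) (g (Suc t) i)" by (rule comp) (use Suc i iP in \<open>auto simp: ov_def\<close>)
          then have "\<not> H (Suc t) i ! k" using hash[of "Suc t"] gN[of "Suc t" i] Suc.prems i k by simp
          moreover have "h + d \<noteq> pos i" using iP d1 h Suc.prems P3 by (auto simp: pos_def)
          ultimately show ?thesis by simp
        qed
      qed
      then show "H (Suc t) i ! k \<longleftrightarrow> snd (snd ?c ! k) = pos i" unfolding tk by simp
    qed
    ultimately show ?case by blast
  qed
  have t: "T - 1 < T" using T by simp
  then obtain t' c where c: "(step M ^^ t') (init_config M x) c" "rep (T - 1) c" using inv by blast
  have "(T - 1) * p + p = T * p" for p using T by (cases T) auto
  from this[of ?P] have "compat 3 (g (T - 1) 1) (g T 1)" using P by (intro comp) (auto simp: ov_def)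
  then have "accepting (q (T - 1), rs (T - 1), q' (T - 1), as (T - 1))"
    using gN[OF t, of 1] dollar[of 1] P by simp
  then have "q (T - 1) = accept M" "trans M (accept M) (rs (T - 1)) = {}" by (auto simp: accepting_def)
  moreover have "fst c = q (T - 1)" using c(2) by (simp add: rep_def)
  ultimately have "fst c = accept M" "halted M c"
    using scan[OF c(2) t] by (auto simp: halted_def step_def)
  then show ?thesis using c(1) by blast
qed

end

section \<open>Listing the terminal pairs without repetition\<close>

definition el :: "'a set \<Rightarrow> 'a list" where
  "el A = (SOME l. distinct l \<and> set l = A)"

lemma el: "finite A \<Longrightarrow> distinct (el A) \<and> set (el A) = A"
  unfolding el_def by (rule someI_ex) (use finite_distinct_list in blast)

text \<open>Terminal pairs are recorded as triples of cell, offset class and template, for which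
  distinctness is visible; an injective map then yields the pairs themselves.\<close>

definition tag :: "nat \<Rightarrow> (nat list \<times> 'a list) list \<Rightarrow> (nat \<times> nat \<times> 'a) list" where
  "tag q bl = concat (map (\<lambda>(js, ts). concat (map (\<lambda>j. map (\<lambda>t. (j, q, t)) ts) js)) bl)"

lemma set_tag: "set (tag q bl) = {(j, q, t) | j t. \<exists>(js, ts)\<in>set bl. j \<in> set js \<and> t \<in> set ts}"
  by (fastforce simp: tag_def)

lemma distinct_tag:
  assumes "distinct (concat (map fst bl))" "\<And>js ts. (js, ts) \<in> set bl \<Longrightarrow> distinct ts"
  shows "distinct (tag q bl)"
  using assms
proof (induction bl)
  case Nil
  then show ?case by (simp add: tag_def)
next
  case (Cons b bl)
  obtain js ts where b: "b = (js, ts)" by (cases b)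
  have ts: "distinct ts" and js: "distinct js" "set js \<inter> set (concat (map fst bl)) = {}"
    using Cons.prems b by auto
  have "distinct (concat (map (\<lambda>j. map (\<lambda>t. (j, q, t)) ts) js))"
    using js(1)
  proof (induction js)
    case (Cons j js)
    then show ?case using ts by (auto simp: distinct_map inj_on_def)
  qed simp
  moreover have "distinct (tag q bl)"
    by (rule Cons.IH) (use Cons.prems in auto)
  moreover have "set (concat (map (\<lambda>j. map (\<lambda>t. (j, q, t)) ts) js)) \<inter> set (tag q bl) = {}"
    using js(2) by (fastforce simp: set_tag)
  ultimately show ?case by (simp add: tag_def b)
qed

text \<open>Everything fixed by the machine and its time bound, for all inputs at once: tiles are
  represented by positions in \<open>tl\<close>, the conflicts enumerate the incompatible pairs of
  each relation, and \<open>ep\<close> is \<open>p\<close> as an expression in the input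
  length.\<close>

locale reduction = ntm M + numbered_shape m C sc tc oc idx L
  for M :: tm and m C :: nat and sc tc oc :: "nat \<Rightarrow> nat" and idx :: "lv \<times> bool \<Rightarrow> nat" and L :: nat +
  fixes tl :: "tile list" and p :: "nat poly" and ep :: exp
  assumes set_tl: "set tl = tiles" and length_tl: "length tl = m"
    and oc_range: "c < C \<Longrightarrow> oc c \<in> {1..4}"
    and conflicts: "r \<in> {1..4} \<Longrightarrow> a < m \<Longrightarrow> b < m \<Longrightarrow>
      (\<exists>c<C. oc c = r \<and> sc c = a \<and> tc c = b) \<longleftrightarrow> \<not> compat r (tl ! a) (tl ! b)"
    and eval_ep: "\<And>\<sigma>. eval ep \<sigma> = poly p (\<sigma> 0)" and vars_ep: "vars ep \<subseteq> {0}"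
begin

text \<open>One more than the time bound, since a run has to end strictly above the last row to
  leave room for an accepting idle transition.\<close>

definition rows :: "nat \<Rightarrow> nat" where
  "rows n = poly p n + 1"

definition cols :: "nat \<Rightarrow> nat" where
  "cols n = 2 * rows n + n + 3"

definition ncells :: "nat \<Rightarrow> nat" where
  "ncells n = (rows n + 1) * cols n"

definition bad_kind :: "nat \<Rightarrow> nat set" where
  "bad_kind \<kappa> = {\<theta>. \<not> kind_ok \<kappa> (tl ! \<theta>)}"

definition bad_sym :: "nat option \<Rightarrow> nat set" where
  "bad_sym s = {\<theta>. \<not> sym_ok s (tl ! \<theta>)}"

definition ckind :: "nat \<Rightarrow> nat \<Rightarrow> nat" where
  "ckind n j = kind (rows n) (j div cols n) (j mod cols n)"

definition csym :: "bool list \<Rightarrow> nat \<Rightarrow> nat option" where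
  "csym x j = sym_class x (rows (length x)) (j div cols (length x)) (j mod cols (length x))"

definition blkf :: "bool list \<Rightarrow> nat \<Rightarrow> nat \<Rightarrow> nat \<Rightarrow> bool" where
  "blkf x sl j \<theta> \<longleftrightarrow> (if sl = 0 then \<theta> \<in> bad_kind (ckind (length x) j) else \<theta> \<in> bad_sym (csym x j))"

lemma wd_cols: "wd x (rows (length x)) = cols (length x)"
  by (simp add: wd_def cols_def)

lemma cols_ge: "3 \<le> cols n" "1 \<le> rows n"
  by (simp_all add: cols_def rows_def)

lemma ov_less: "ov (cols n) q < ncells n"
proof -
  have "cols n + cols n \<le> ncells n" using cols_ge[of n] by (simp add: ncells_def rows_def)
  then show ?thesis using cols_ge[of n] by (auto simp: ov_def)
qed

lemma numbered: "numbered_gadget m C sc tc oc idx L (ncells (length x)) (ov (cols (length x)))"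
proof unfold_locales
  show "0 < ncells (length x)" using cols_ge by (simp add: ncells_def cols_def)
qed (rule ov_less)

text \<open>Tile numbers and tiles correspond through \<open>tl\<close>; slot 0 expresses the kinds,
  slot 1 the symbols, and the conflicts of class \<open>r\<close> express \<open>compat r\<close> at
  the offset of relation \<open>r\<close>.\<close>

lemma tiling_iff_grid:
  fixes x
  defines "N \<equiv> ncells (length x)" and "o' \<equiv> (\<lambda>c. ov (cols (length x)) (oc c))"
  shows "(\<exists>sel. gadget.tiling m C sc tc N o' (blkf x) sel) \<longleftrightarrow> (\<exists>\<sigma>. grid x (rows (length x)) \<sigma>)"
proof -
  interpret G: numbered_gadget m C sc tc oc idx L N "ov (cols (length x))" "blkf x"
    unfolding N_def by (rule numbered)
  have tl: "\<And>a. a < m \<Longrightarrow> tl ! a \<in> tiles" using set_tl length_tl nth_mem by metis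
  have NN: "(rows (length x) + 1) * wd x (rows (length x)) = N" by (simp add: N_def ncells_def wd_cols)
  have blk: "(\<forall>b<2. \<not> blkf x b j a) \<longleftrightarrow> kind_ok (ckind (length x) j) (tl ! a) \<and> sym_ok (csym x j) (tl ! a)" for j a
    by (auto simp: blkf_def bad_kind_def bad_sym_def less_2_cases_iff)
  have grid_eq: "grid x (rows (length x)) \<sigma> \<longleftrightarrow> (\<forall>j<N. \<sigma> j \<in> tiles \<and> kind_ok (ckind (length x) j) (\<sigma> j) \<and>
     sym_ok (csym x j) (\<sigma> j) \<and> (\<forall>r\<in>{1..4}. compat r (\<sigma> j) (\<sigma> ((j + ov (cols (length x)) r) mod N))))" for \<sigma>
    unfolding grid_def wd_cols N_def ncells_def ckind_def csym_def ..
  have main: "G.tiling sel \<longleftrightarrow> (\<forall>j<N. sel j < m) \<and> grid x (rows (length x)) (\<lambda>j. tl ! sel j)" for sel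
  proof (cases "\<forall>j<N. sel j < m")
    case True
    have "(\<forall>c<C. \<not> (sel j = sc c \<and> sel ((j + o' c) mod N) = tc c)) \<longleftrightarrow>
        (\<forall>r\<in>{1..4}. compat r (tl ! sel j) (tl ! sel ((j + ov (cols (length x)) r) mod N)))" if j: "j < N" for j
    proof -
      have j': "(j + k) mod N < N" for k using j by simp
      have c: "(\<exists>c<C. oc c = r \<and> sc c = sel j \<and> tc c = sel ((j + ov (cols (length x)) r) mod N)) \<longleftrightarrow>
        \<not> compat r (tl ! sel j) (tl ! sel ((j + ov (cols (length x)) r) mod N))" if "r \<in> {1..4}" for r
        by (rule conflicts[OF that]) (use True j j' in auto)
      show ?thesis unfolding o'_def using c oc_range by (metis (no_types, lifting))
    qed
    note X = this[unfolded o'_def]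
    have "G.tiling sel \<longleftrightarrow> (\<forall>j<N. sel j < m \<and> (kind_ok (ckind (length x) j) (tl ! sel j) \<and> sym_ok (csym x j) (tl ! sel j)) \<and>
      (\<forall>r\<in>{1..4}. compat r (tl ! sel j) (tl ! sel ((j + ov (cols (length x)) r) mod N))))"
      unfolding G.tiling_def blk by (intro all_cong1 imp_cong refl) (use X in simp)
    then show ?thesis using True tl unfolding grid_eq by auto
  next
    case False
    then show ?thesis unfolding G.tiling_def by blast
  qed
  have "\<exists>sel. (\<forall>j<N. sel j < m) \<and> grid x (rows (length x)) (\<lambda>j. tl ! sel j)" if g: "grid x (rows (length x)) \<sigma>" for \<sigma>
  proof -
    have "\<exists>a. a < m \<and> tl ! a = \<sigma> j" if "j < N" for j
    proof -
      have "\<sigma> j \<in> set tl" using g that unfolding grid_def NN set_tl by blast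
      then show ?thesis using length_tl by (metis in_set_conv_nth)
    qed
    then obtain sel where sel: "\<And>j. j < N \<Longrightarrow> sel j < m \<and> tl ! sel j = \<sigma> j" by metis
    have "grid x (rows (length x)) (\<lambda>j. tl ! sel j) \<longleftrightarrow> grid x (rows (length x)) \<sigma>"
      unfolding grid_def NN by (intro all_cong1 imp_cong refl) (use sel in simp)
    then show ?thesis using g sel by blast
  qed
  then show ?thesis using main unfolding o'_def by blast
qed

text \<open>The cells visited by two nested loops. Variable 0 is the input length and variables 1
  and 2 are the loop indices, from which \<open>ce\<close> computes a cell and \<open>ce'\<close>
  its partner.\<close>

definition bcells :: "nat \<Rightarrow> exp \<times> exp \<times> exp \<times> exp \<Rightarrow> (nat \<times> nat) list" where
  "bcells n = (\<lambda>(e1, e2, ce, ce'). concat (map (\<lambda>u. map (\<lambda>w.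
     (eval ce ((\<lambda>_. n)(1 := u, 2 := w)), eval ce' ((\<lambda>_. n)(1 := u, 2 := w)))) [0..<eval e2 (\<lambda>_. n)]) [0..<eval e1 (\<lambda>_. n)]))"

definition eT :: exp where "eT = Add ep (Num 1)"
text \<open>Expressions know no subtraction, so \<open>cols n - 1\<close> needs an expression of its
  own; for \<open>rows n - 1\<close> there is \<open>ep\<close>.\<close>

definition eW1 :: exp where "eW1 = Add (Mul (Num 2) eT) (Add (Var 0) (Num 2))"
definition eW :: exp where "eW = Add eW1 (Num 1)"
definition eN :: exp where "eN = Mul (Add eT (Num 1)) eW"

definition eOff :: "nat \<Rightarrow> exp" where
  "eOff q = (if q = 1 then Num 1 else if q = 2 then eW1 else if q = 3 then eW else Add eW (Num 1))"

text \<open>The number of cells minus \<open>eOff q\<close>.\<close>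

definition eRest :: "nat \<Rightarrow> exp" where
  "eRest q = (if q = 1 then Add (Mul eT eW) eW1 else if q = 2 then Add (Mul eT eW) (Num 1)
     else if q = 3 then Mul eT eW else Add (Mul ep eW) eW1)"

definition reg :: "exp \<Rightarrow> exp \<Rightarrow> exp \<Rightarrow> exp \<times> exp \<times> exp \<times> exp" where
  "reg e1 e2 ce = (e1, e2, ce, ce)"

text \<open>Each region is a rectangle of the grid: \<open>rHash\<close> is the border column,
  \<open>rDollar\<close> the last row, and \<open>rMid\<close> the inside of the rows in between.
  The rest of the first row is cut twice: for the kinds at the start cell of the heads, into
  \<open>rLeft\<close>, \<open>rHead\<close> and \<open>rRight\<close>; for the symbols around the
  input, with \<open>rLeft\<close> before and \<open>rTail\<close> after it.\<close>

definition rAll where "rAll = reg (Add eT (Num 1)) eW (Add (Mul (Var 1) eW) (Var 2))"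
definition rHash where "rHash = reg eT (Num 1) (Mul (Var 1) eW)"
definition rDollar where "rDollar = reg eW (Num 1) (Add (Mul eT eW) (Var 1))"
definition rMid where "rMid = reg ep eW1 (Add (Mul (Add (Var 1) (Num 1)) eW) (Add (Num 1) (Var 2)))"
definition rLeft where "rLeft = reg eT (Num 1) (Add (Num 1) (Var 1))"
definition rHead where "rHead = reg (Num 1) (Num 1) (Add eT (Num 1))"
definition rRight where "rRight = reg (Add eT (Add (Var 0) (Num 1))) (Num 1) (Add eT (Add (Num 2) (Var 1)))"
definition rTail where "rTail = reg (Add eT (Num 2)) (Num 1) (Add eT (Add (Num 1) (Add (Var 0) (Var 1))))"

lemma evals:
  "eval eT \<sigma> = rows (\<sigma> 0)" "eval eW1 \<sigma> = cols (\<sigma> 0) - 1" "eval eW \<sigma> = cols (\<sigma> 0)" "eval eN \<sigma> = ncells (\<sigma> 0)"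
  "eval ep \<sigma> = rows (\<sigma> 0) - 1"
  by (simp_all add: eT_def eW1_def eW_def eN_def eval_ep rows_def cols_def ncells_def algebra_simps)

lemma upt_0_1: "[0..<Suc 0] = [0]"
  by simp

lemma cells_list:
  "map fst (bcells n rAll) = concat (map (\<lambda>u. map (\<lambda>w. u * cols n + w) [0..<cols n]) [0..<rows n + 1])"
  "map fst (bcells n rHash) = map (\<lambda>u. u * cols n) [0..<rows n]"
  "map fst (bcells n rDollar) = map (\<lambda>u. rows n * cols n + u) [0..<cols n]"
  "map fst (bcells n rMid) = concat (map (\<lambda>u. map (\<lambda>w. (u + 1) * cols n + (1 + w)) [0..<cols n - 1]) [0..<rows n - 1])"
  "map fst (bcells n rLeft) = map (\<lambda>u. 1 + u) [0..<rows n]"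
  "map fst (bcells n rHead) = [rows n + 1]"
  "map fst (bcells n rRight) = map (\<lambda>u. rows n + (2 + u)) [0..<rows n + (n + 1)]"
  "map fst (bcells n rTail) = map (\<lambda>u. rows n + (1 + (n + u))) [0..<rows n + 2]"
  by (simp_all add: rAll_def rHash_def rDollar_def rMid_def rLeft_def rHead_def rRight_def rTail_def reg_def
      bcells_def evals map_concat o_def upt_0_1 del: upt_Suc)

lemma all_cells: "map fst (bcells n rAll) = [0..<ncells n]"
proof -
  have "concat (map (\<lambda>u. map (\<lambda>w. u * c + w) [0..<c]) [0..<k]) = [0..<k * c]" for k c :: nat
  proof (induction k)
    case (Suc k)
    have "map (\<lambda>w. k * c + w) [0..<c] = [k * c..<k * c + c]"
      using map_add_upt[of "k * c" c] by (simp add: add.commute)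
    then show ?case using Suc upt_add_eq_append[of 0 "k * c" c] by (simp add: add.commute)
  qed simp
  then show ?thesis unfolding cells_list ncells_def by blast
qed

text \<open>A cyclic shift without taking remainders: the first cells, as many as
  \<open>eRest q\<close> says, move on by \<open>eOff q\<close>, and the remaining ones return to
  the beginning.\<close>

lemma cross_cells:
  assumes "q \<in> {1..4}"
  shows "map fst (bcells n (eRest q, Num 1, Var 1, Add (Var 1) (eOff q))) @
      map fst (bcells n (eOff q, Num 1, Add (Var 1) (eRest q), Var 1)) = [0..<ncells n]"
    "(j, j') \<in> set (bcells n (eRest q, Num 1, Var 1, Add (Var 1) (eOff q))) \<union>
      set (bcells n (eOff q, Num 1, Add (Var 1) (eRest q), Var 1)) \<Longrightarrow> j' = (j + ov (cols n) q) mod ncells n"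
proof -
  define r where "r = eval (eRest q) (\<lambda>_. n)"
  let ?o = "eval (eOff q) (\<lambda>_. n)"
  have q: "q = 1 \<or> q = 2 \<or> q = 3 \<or> q = 4" using assms by auto
  obtain k where k: "rows n = Suc k" using cols_ge[of n] by (cases "rows n") auto
  obtain l where l: "cols n = Suc l" using cols_ge[of n] by (cases "cols n") auto
  have o: "eval (eOff q) \<sigma> = ov (cols n) q" "eval (eRest q) \<sigma> + ov (cols n) q = ncells n" if "\<sigma> 0 = n" for \<sigma>
    using q that by (auto simp: eOff_def eRest_def evals ov_def ncells_def k l algebra_simps)
  have o': "eval (eRest q) \<sigma> = r" if "\<sigma> 0 = n" for \<sigma> using o(2)[of \<sigma>] that o(2)[of "\<lambda>_. n"] by (simp add: r_def)
  have m1: "bcells n (eRest q, Num 1, Var 1, Add (Var 1) (eOff q)) = map (\<lambda>u. (u, u + ov (cols n) q)) [0..<r]"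
    by (simp add: bcells_def o r_def)
  have m2: "bcells n (eOff q, Num 1, Add (Var 1) (eRest q), Var 1) = map (\<lambda>u. (u + r, u)) [0..<?o]"
    by (simp add: bcells_def o')
  have "map (\<lambda>u. u + r) [0..<?o] = [r..<r + ?o]" using map_add_upt[of r ?o] by (simp add: add.commute)
  then show "map fst (bcells n (eRest q, Num 1, Var 1, Add (Var 1) (eOff q))) @
      map fst (bcells n (eOff q, Num 1, Add (Var 1) (eRest q), Var 1)) = [0..<ncells n]"
    unfolding m1 m2 using upt_add_eq_append[of 0 r ?o] o[of "\<lambda>_. n"] r_def by (simp add: o_def)
  show "j' = (j + ov (cols n) q) mod ncells n"
    if "(j, j') \<in> set (bcells n (eRest q, Num 1, Var 1, Add (Var 1) (eOff q))) \<union>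
      set (bcells n (eOff q, Num 1, Add (Var 1) (eRest q), Var 1))"
  proof -
    from that consider "j < r" "j' = j + ov (cols n) q" | "j = j' + r" "j' < ?o" unfolding m1 m2 by auto
    then show ?thesis
    proof cases
      case 1
      then show ?thesis using o[of "\<lambda>_. n"] r_def by simp
    next
      case 2
      have "j + ov (cols n) q = j' + ncells n" using 2 o[of "\<lambda>_. n"] r_def by simp
      moreover have "j' < ncells n" using 2 o[of "\<lambda>_. n"] r_def by simp
      ultimately show ?thesis by simp
    qed
  qed
qed

lemma ckind_cell: "i < cols n \<Longrightarrow> ckind n (t * cols n + i) = kind (rows n) t i"
  using div_mod_cell[of i "cols n" t] by (simp add: ckind_def)

lemma csym_cell: "i < cols (length x) \<Longrightarrow> csym x (t * cols (length x) + i) = sym_class x (rows (length x)) t i"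
  using div_mod_cell[of i "cols (length x)" t] by (simp add: csym_def)

lemma cell_less: "t \<le> rows n \<Longrightarrow> i < cols n \<Longrightarrow> t * cols n + i < ncells n"
proof -
  assume *: "t \<le> rows n" "i < cols n"
  have "t * cols n \<le> rows n * cols n" by (rule mult_le_mono1[OF *(1)])
  moreover have "ncells n = rows n * cols n + cols n" by (simp add: ncells_def)
  ultimately show ?thesis using *(2) by linarith
qed

lemma cell_obtain:
  assumes "j < ncells n"
  obtains t i where "j = t * cols n + i" "i < cols n" "t \<le> rows n"
proof
  have "0 < cols n" using cols_ge[of n] by simp
  then show "j mod cols n < cols n" by simp
  show "j = (j div cols n) * cols n + j mod cols n" by (rule div_mult_mod_eq[symmetric])
  have "j div cols n < rows n + 1" using assms by (simp add: ncells_def less_mult_imp_div_less)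
  then show "j div cols n \<le> rows n" by simp
qed

lemma mod_cell_cases:
  assumes "t \<le> rows n" "i < cols n"
  obtains "t = rows n" | "t < rows n" "i = 0" | "0 < t" "t < rows n" "0 < i"
    | "t = 0" "0 < i" "i \<le> rows n" | "t = 0" "i = rows n + 1" | "t = 0" "rows n + 2 \<le> i"
proof -
  have "t = rows n \<or> t < rows n \<and> i = 0 \<or> 0 < t \<and> t < rows n \<and> 0 < i \<or> t = 0 \<and> 0 < i \<and> i \<le> rows n \<or>
    t = 0 \<and> i = rows n + 1 \<or> t = 0 \<and> rows n + 2 \<le> i" using assms by linarith
  then show thesis using that by blast
qed

definition slot0 :: "((exp \<times> exp \<times> exp \<times> exp) \<times> nat) list" where
  "slot0 = [(rHash, 1), (rDollar, 0), (rMid, 4), (rLeft, 3), (rHead, 2), (rRight, 3)]"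

text \<open>The cells of the input word are missing: their class depends on a bit, so they are
  listed during the second pass.\<close>

definition slot1 :: "((exp \<times> exp \<times> exp \<times> exp) \<times> nat option) list" where
  "slot1 = [(rHash, None), (rDollar, None), (rMid, None), (rLeft, Some 0), (rTail, Some 0)]"

lemma mid_cell: "j \<in> set (map fst (bcells n rMid)) \<longleftrightarrow> (\<exists>t i. j = t * cols n + i \<and> 0 < t \<and> t < rows n \<and> 0 < i \<and> i < cols n)"
proof
  assume "j \<in> set (map fst (bcells n rMid))"
  then obtain u w where "j = (u + 1) * cols n + (1 + w)" "u < rows n - 1" "w < cols n - 1"
    unfolding cells_list by auto
  then show "\<exists>t i. j = t * cols n + i \<and> 0 < t \<and> t < rows n \<and> 0 < i \<and> i < cols n"
    by (intro exI[of _ "u + 1"] exI[of _ "1 + w"]) auto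
next
  assume "\<exists>t i. j = t * cols n + i \<and> 0 < t \<and> t < rows n \<and> 0 < i \<and> i < cols n"
  then obtain t i where ti: "j = t * cols n + i" "0 < t" "t < rows n" "0 < i" "i < cols n" by blast
  then have "j = (t - 1 + 1) * cols n + (1 + (i - 1))" "t - 1 < rows n - 1" "i - 1 < cols n - 1" by auto
  then show "j \<in> set (map fst (bcells n rMid))" unfolding cells_list set_concat set_map image_image
    by (intro UN_I[of "t - 1"] image_eqI[of _ _ "i - 1"]) auto
qed

lemma slot0_cells:
  "(B, \<kappa>) \<in> set slot0 \<Longrightarrow> j \<in> set (map fst (bcells n B)) \<Longrightarrow> j < ncells n \<and> ckind n j = \<kappa>"
proof -
  assume B: "(B, \<kappa>) \<in> set slot0" and j: "j \<in> set (map fst (bcells n B))"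
  have *: ?thesis if "j = t * cols n + i" "t \<le> rows n" "i < cols n" "kind (rows n) t i = \<kappa>" for t i
    using that cell_less ckind_cell by simp
  note c = cols_def[of n]
  from B consider "B = rHash" "\<kappa> = 1" | "B = rDollar" "\<kappa> = 0" | "B = rMid" "\<kappa> = 4" | "B = rLeft" "\<kappa> = 3"
    | "B = rHead" "\<kappa> = 2" | "B = rRight" "\<kappa> = 3" unfolding slot0_def by auto
  then show ?thesis
  proof cases
    case 1
    with j obtain u where "j = u * cols n" "u < rows n" unfolding 1 cells_list set_map set_upt by (metis atLeastLessThan_iff imageE)
    then show ?thesis using 1 c by (intro *[of u 0]) (auto simp: kind_def)
  next
    case 2
    with j obtain u where "j = rows n * cols n + u" "u < cols n" unfolding 2 cells_list set_map set_upt by (metis atLeastLessThan_iff imageE)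
    then show ?thesis using 2 by (intro *[of "rows n" u]) (auto simp: kind_def)
  next
    case 3
    with j obtain t i where "j = t * cols n + i" "0 < t" "t < rows n" "0 < i" "i < cols n" unfolding 3 mid_cell by blast
    then show ?thesis using 3 by (intro *[of t i]) (auto simp: kind_def)
  next
    case 4
    with j obtain u where "j = 1 + u" "u < rows n" unfolding 4 cells_list set_map set_upt by (metis atLeastLessThan_iff imageE)
    then show ?thesis using 4 c by (intro *[of 0 "1 + u"]) (auto simp: kind_def)
  next
    case 5
    with j have "j = rows n + 1" unfolding 5 cells_list by auto
    then show ?thesis using 5 c cols_ge(2)[of n] by (intro *[of 0 j]) (auto simp: kind_def)
  next
    case 6
    with j obtain u where "j = rows n + (2 + u)" "u < rows n + (n + 1)" unfolding 6 cells_list by auto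
    then show ?thesis using 6 c cols_ge(2)[of n] by (intro *[of 0 "rows n + (2 + u)"]) (auto simp: kind_def)
  qed
qed

lemma slot0_complete:
  assumes "j < ncells n"
  shows "\<exists>B. (B, ckind n j) \<in> set slot0 \<and> j \<in> set (map fst (bcells n B))"
proof -
  obtain t i where ti: "j = t * cols n + i" "i < cols n" "t \<le> rows n" using cell_obtain[OF assms] .
  have k: "ckind n j = kind (rows n) t i" using ckind_cell ti by simp
  from ti(3,2) show ?thesis
  proof (cases rule: mod_cell_cases)
    case 1
    then have "(rDollar, ckind n j) \<in> set slot0" "j \<in> set (map fst (bcells n rDollar))"
      unfolding k cells_list using ti by (auto simp: slot0_def kind_def)
    then show ?thesis by blast
  next
    case 2
    then have "(rHash, ckind n j) \<in> set slot0" "j \<in> set (map fst (bcells n rHash))"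
      unfolding k cells_list using ti by (auto simp: slot0_def kind_def)
    then show ?thesis by blast
  next
    case 3
    then have "(rMid, ckind n j) \<in> set slot0" "j \<in> set (map fst (bcells n rMid))"
      unfolding k mid_cell using ti by (auto simp: slot0_def kind_def)
    then show ?thesis by blast
  next
    case 4
    then have "i = 1 + (i - 1)" "i - 1 < rows n" by auto
    then have "j \<in> set (map fst (bcells n rLeft))" unfolding cells_list using ti 4 by (auto simp del: One_nat_def)
    moreover have "(rLeft, ckind n j) \<in> set slot0" unfolding k using 4 by (auto simp: slot0_def kind_def)
    ultimately show ?thesis by blast
  next
    case 5
    then have "(rHead, ckind n j) \<in> set slot0" "j \<in> set (map fst (bcells n rHead))"
      unfolding k cells_list using ti cols_ge(2)[of n] by (auto simp: slot0_def kind_def)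
    then show ?thesis by blast
  next
    case 6
    then have "i = rows n + (2 + (i - rows n - 2))" "i - rows n - 2 < rows n + (n + 1)" using ti(2) by (auto simp: cols_def)
    then have "j \<in> set (map fst (bcells n rRight))" unfolding cells_list set_map using ti(1) 6(1)
      by (intro image_eqI[of _ _ "i - rows n - 2"]) auto
    moreover have "(rRight, ckind n j) \<in> set slot0" unfolding k using 6 cols_ge(2)[of n] by (auto simp: slot0_def kind_def)
    ultimately show ?thesis by blast
  qed
qed

lemma slot1_cells:
  "(B, s) \<in> set slot1 \<Longrightarrow> j \<in> set (map fst (bcells (length x) B)) \<Longrightarrow> j < ncells (length x) \<and> csym x j = s"
proof -
  let ?n = "length x"
  assume B: "(B, s) \<in> set slot1" and j: "j \<in> set (map fst (bcells ?n B))"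
  have *: ?thesis if "j = t * cols ?n + i" "t \<le> rows ?n" "i < cols ?n" "sym_class x (rows ?n) t i = s" for t i
    using that cell_less csym_cell by simp
  note c = cols_def[of ?n]
  from B consider "B = rHash" "s = None" | "B = rDollar" "s = None" | "B = rMid" "s = None" | "B = rLeft" "s = Some 0"
    | "B = rTail" "s = Some 0" unfolding slot1_def by auto
  then show ?thesis
  proof cases
    case 1
    with j obtain u where "j = u * cols ?n" "u < rows ?n" unfolding 1 cells_list set_map set_upt by (metis atLeastLessThan_iff imageE)
    then show ?thesis using 1 c by (intro *[of u 0]) (auto simp: sym_class_def)
  next
    case 2
    with j obtain u where "j = rows ?n * cols ?n + u" "u < cols ?n" unfolding 2 cells_list set_map set_upt by (metis atLeastLessThan_iff imageE)
    then show ?thesis using 2 cols_ge(2)[of ?n] by (intro *[of "rows ?n" u]) (auto simp: sym_class_def)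
  next
    case 3
    with j obtain t i where "j = t * cols ?n + i" "0 < t" "t < rows ?n" "0 < i" "i < cols ?n" unfolding 3 mid_cell by blast
    then show ?thesis using 3 by (intro *[of t i]) (auto simp: sym_class_def)
  next
    case 4
    with j obtain u where "j = 1 + u" "u < rows ?n" unfolding 4 cells_list set_map set_upt by (metis atLeastLessThan_iff imageE)
    then show ?thesis using 4 c by (intro *[of 0 "1 + u"]) (auto simp: sym_class_def string_content_def)
  next
    case 5
    with j obtain u where "j = rows ?n + (1 + (?n + u))" "u < rows ?n + 2" unfolding 5 cells_list by auto
    then show ?thesis using 5 c by (intro *[of 0 "rows ?n + (1 + (?n + u))"]) (auto simp: sym_class_def string_content_def)
  qed
qed

lemma input_cell:
  assumes "i < length x"
  shows "rows (length x) + 1 + i < ncells (length x)"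
    "csym x (rows (length x) + 1 + i) = Some (if x ! i then 2 else 1)"
proof -
  let ?n = "length x"
  have "rows ?n + 1 + i < cols ?n" using assms by (simp add: cols_def)
  then show "rows ?n + 1 + i < ncells ?n" "csym x (rows ?n + 1 + i) = Some (if x ! i then 2 else 1)"
    using cell_less[of 0 ?n "rows ?n + 1 + i"] csym_cell[of "rows ?n + 1 + i" x 0] assms
    by (auto simp: sym_class_def string_content_def)
qed

lemma slot1_complete:
  assumes "j < ncells (length x)"
  shows "(\<exists>B. (B, csym x j) \<in> set slot1 \<and> j \<in> set (map fst (bcells (length x) B))) \<or>
    (\<exists>i<length x. j = rows (length x) + 1 + i)"
proof -
  let ?n = "length x"
  obtain t i where ti: "j = t * cols ?n + i" "i < cols ?n" "t \<le> rows ?n" using cell_obtain[OF assms] .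
  have k: "csym x j = sym_class x (rows ?n) t i" using csym_cell ti by simp
  have right: ?thesis if t: "t = 0" and i: "rows ?n + 1 \<le> i"
  proof (cases "i < rows ?n + 1 + ?n")
    case True
    then show ?thesis using ti t i by (intro disjI2 exI[of _ "i - rows ?n - 1"]) auto
  next
    case False
    then have "i = rows ?n + (1 + (?n + (i - rows ?n - 1 - ?n)))" "i - rows ?n - 1 - ?n < rows ?n + 2"
      using ti(2) by (auto simp: cols_def)
    then have "j \<in> set (map fst (bcells ?n rTail))" unfolding cells_list set_map using ti(1) t
      by (intro image_eqI[of _ _ "i - rows ?n - 1 - ?n"]) auto
    moreover have "(rTail, csym x j) \<in> set slot1" unfolding k using False t by (auto simp: slot1_def sym_class_def string_content_def)
    ultimately show ?thesis by blast
  qed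
  from ti(3,2) show ?thesis
  proof (cases rule: mod_cell_cases)
    case 1
    then have "(rDollar, csym x j) \<in> set slot1" "j \<in> set (map fst (bcells ?n rDollar))"
      unfolding k cells_list using ti cols_ge(2)[of ?n] by (auto simp: slot1_def sym_class_def)
    then show ?thesis by blast
  next
    case 2
    then have "(rHash, csym x j) \<in> set slot1" "j \<in> set (map fst (bcells ?n rHash))"
      unfolding k cells_list using ti by (auto simp: slot1_def sym_class_def)
    then show ?thesis by blast
  next
    case 3
    then have "(rMid, csym x j) \<in> set slot1" "j \<in> set (map fst (bcells ?n rMid))"
      unfolding k mid_cell using ti by (auto simp: slot1_def sym_class_def)
    then show ?thesis by blast
  next
    case 4
    then have "i = 1 + (i - 1)" "i - 1 < rows ?n" by auto
    then have "j \<in> set (map fst (bcells ?n rLeft))" unfolding cells_list using ti 4 by (auto simp del: One_nat_def)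
    moreover have "(rLeft, csym x j) \<in> set slot1" unfolding k using 4 by (auto simp: slot1_def sym_class_def string_content_def)
    ultimately show ?thesis by blast
  qed (use right in auto)
qed

lemma length_mid: "length (concat (map (\<lambda>u. map (f u) [0..<b]) [0..<a])) = a * b"
  by (induction a) auto

text \<open>The regions cover all cells, so this count makes them disjoint by
  \<open>distinct_if_covers\<close>, without comparing any two of them.\<close>

lemma slot0_length: "length (concat (map (\<lambda>(B, \<kappa>). map fst (bcells n B)) slot0)) = ncells n"
proof -
  obtain k where k: "rows n = Suc k" using cols_ge[of n] by (cases "rows n") auto
  have c: "cols n = Suc (2 * k + n + 4)" by (simp add: cols_def k)
  show ?thesis unfolding slot0_def by (simp add: cells_list length_mid ncells_def k c algebra_simps del: upt_Suc)
qed

lemma slot1_length: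
  "length (concat (map (\<lambda>(B, \<kappa>). map fst (bcells n B)) slot1) @ map (\<lambda>i. rows n + 1 + i) [0..<n]) = ncells n"
proof -
  obtain k where k: "rows n = Suc k" using cols_ge[of n] by (cases "rows n") auto
  have c: "cols n = Suc (2 * k + n + 4)" by (simp add: cols_def k)
  show ?thesis unfolding slot1_def by (simp add: cells_list length_mid ncells_def k c algebra_simps del: upt_Suc)
qed

end

context reduction
begin

definition F :: "nat \<Rightarrow> nat \<Rightarrow> nat \<times> nat \<times> template \<Rightarrow> nat \<times> nat" where
  "F r n = (\<lambda>(j, q, t). inst L r j ((j + ov (cols n) q) mod ncells n) t)"

definition ts_local where "ts_local r = el (tm_local r)"
definition ts_cross where "ts_cross q = el (tm_cross q)"
definition ts_kind where "ts_kind r \<kappa> = el (tm_block r 0 (bad_kind \<kappa>))"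
definition ts_sym where "ts_sym r s = el (tm_block r 1 (bad_sym s))"

lemma ts_simps:
  "distinct (ts_local r)" "set (ts_local r) = tm_local r" "distinct (ts_cross q)" "set (ts_cross q) = tm_cross q"
  "distinct (ts_kind r \<kappa>)" "set (ts_kind r \<kappa>) = tm_block r 0 (bad_kind \<kappa>)"
  "distinct (ts_sym r s)" "set (ts_sym r s) = tm_block r 1 (bad_sym s)"
  unfolding ts_local_def ts_cross_def ts_kind_def ts_sym_def by (simp_all add: el finite_templates)

definition crossA where "crossA q = (eRest q, Num 1, Var 1, Add (Var 1) (eOff q))"
definition crossB where "crossB q = (eOff q, Num 1, Add (Var 1) (eRest q), Var 1)"

definition blocks :: "nat \<Rightarrow> ((exp \<times> exp \<times> exp \<times> exp) \<times> template list) list" where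
  "blocks r = (rAll, ts_local r) # concat (map (\<lambda>q. [(crossA q, ts_cross q), (crossB q, ts_cross q)]) [1, 2, 3, 4]) @
     map (\<lambda>(B, \<kappa>). (B, ts_kind r \<kappa>)) slot0 @ map (\<lambda>(B, s). (B, ts_sym r s)) slot1"

definition pairs_of :: "nat \<Rightarrow> (nat \<times> nat) list \<Rightarrow> template list \<Rightarrow> (nat \<times> nat) list" where
  "pairs_of r cells ts = concat (map (\<lambda>(j, j'). map (inst L r j j') ts) cells)"

definition input_pairs :: "nat \<Rightarrow> nat \<Rightarrow> bool \<Rightarrow> nat \<Rightarrow> (nat \<times> nat) list" where
  "input_pairs r n b i = pairs_of r [(rows n + 1 + i, rows n + 1 + i)] (ts_sym r (Some (if b then 2 else 1)))"

text \<open>The order of printing: what depends on the length alone comes first, then the pairs of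
  the input cells, bit by bit.\<close>

definition plist :: "nat \<Rightarrow> bool list \<Rightarrow> (nat \<times> nat) list" where
  "plist r x = concat (map (\<lambda>(B, ts). pairs_of r (bcells (length x) B) ts) (blocks r)) @
     concat (map (\<lambda>i. input_pairs r (length x) (x ! i) i) [0..<length x])"

definition sym_blocks :: "nat \<Rightarrow> bool list \<Rightarrow> (nat list \<times> template list) list" where
  "sym_blocks r x = map (\<lambda>(B, s). (map fst (bcells (length x) B), ts_sym r s)) slot1 @
     map (\<lambda>i. ([rows (length x) + 1 + i], ts_sym r (Some (if x ! i then 2 else 1)))) [0..<length x]"

definition kind_blocks :: "nat \<Rightarrow> nat \<Rightarrow> (nat list \<times> template list) list" where
  "kind_blocks r n = map (\<lambda>(B, \<kappa>). (map fst (bcells n B), ts_kind r \<kappa>)) slot0"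

definition cross_blocks :: "nat \<Rightarrow> nat \<Rightarrow> (nat list \<times> template list) list" where
  "cross_blocks n q = [(map fst (bcells n (crossA q)), ts_cross q), (map fst (bcells n (crossB q)), ts_cross q)]"

definition tagged :: "nat \<Rightarrow> bool list \<Rightarrow> (nat \<times> nat \<times> template) list" where
  "tagged r x = tag 0 [(map fst (bcells (length x) rAll), ts_local r)] @
     concat (map (\<lambda>q. tag q (cross_blocks (length x) q)) [1, 2, 3, 4]) @
     tag 0 (kind_blocks r (length x)) @ tag 0 (sym_blocks r x)"

lemma tag_Cons: "tag q (b # bl) = tag q [b] @ tag q bl"
  by (simp add: tag_def)

lemma tag_append: "tag q (bl @ bl') = tag q bl @ tag q bl'"
  by (simp add: tag_def)

lemma tag_map: "tag q (map f xs) = concat (map (\<lambda>x. tag q [f x]) xs)"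
  by (induction xs) (simp_all add: tag_def)

lemma pairs_of_tag:
  assumes "\<And>j j'. (j, j') \<in> set cells \<Longrightarrow> j' = (j + ov (cols n) q) mod ncells n"
  shows "pairs_of r cells ts = map (F r n) (tag q [(map fst cells, ts)])"
proof -
  have eq: "map (\<lambda>(j, j'). map (inst L r j j') ts) cells = map (\<lambda>c. map (F r n) (map (\<lambda>t. (fst c, q, t)) ts)) cells"
    by (rule map_cong[OF refl]) (use assms in \<open>auto simp: F_def\<close>)
  show ?thesis unfolding pairs_of_def eq by (simp add: tag_def map_concat o_def)
qed

lemma reg_cells: "(j, j') \<in> set (bcells n (reg e1 e2 ce)) \<Longrightarrow> j' = j"
  by (auto simp: reg_def bcells_def)

lemma region_tag:
  assumes "B = reg e1 e2 ce" "\<And>j. j \<in> set (map fst (bcells n B)) \<Longrightarrow> j < ncells n"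
  shows "pairs_of r (bcells n B) ts = map (F r n) (tag 0 [(map fst (bcells n B), ts)])"
proof (rule pairs_of_tag)
  fix j j' assume jj: "(j, j') \<in> set (bcells n B)"
  then have "j < ncells n" using assms(2) by force
  then show "j' = (j + ov (cols n) 0) mod ncells n" using reg_cells jj assms(1) by (simp add: ov_def)
qed

lemma plist_tagged: "plist r x = map (F r (length x)) (tagged r x)"
proof -
  let ?n = "length x"
  have 1: "pairs_of r (bcells ?n rAll) (ts_local r) = map (F r ?n) (tag 0 [(map fst (bcells ?n rAll), ts_local r)])"
    by (rule region_tag[OF rAll_def]) (simp add: all_cells del: set_map)
  have 2: "pairs_of r (bcells ?n (crossA q)) ts @ pairs_of r (bcells ?n (crossB q)) ts = map (F r ?n)
     (tag q [(map fst (bcells ?n (crossA q)), ts), (map fst (bcells ?n (crossB q)), ts)])" if "q \<in> {1..4}" for q ts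
  proof -
    have "j' = (j + ov (cols ?n) q) mod ncells ?n"
      if "(j, j') \<in> set (bcells ?n (crossA q)) \<or> (j, j') \<in> set (bcells ?n (crossB q))" for j j'
      using cross_cells(2)[OF \<open>q \<in> {1..4}\<close>, of j j' ?n] that by (auto simp: crossA_def crossB_def)
    then show ?thesis
      using pairs_of_tag[of "bcells ?n (crossA q)" ?n q r ts] pairs_of_tag[of "bcells ?n (crossB q)" ?n q r ts]
      by (subst tag_Cons) simp
  qed
  have reg: "\<exists>e1 e2 ce. B = reg e1 e2 ce" if "B \<in> {rHash, rDollar, rMid, rLeft, rHead, rRight, rTail}" for B
    using that by (auto simp: rHash_def rDollar_def rMid_def rLeft_def rHead_def rRight_def rTail_def)
  have 3: "pairs_of r (bcells ?n B) ts = map (F r ?n) (tag 0 [(map fst (bcells ?n B), ts)])" if "(B, \<kappa>) \<in> set slot0" for B \<kappa> ts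
  proof -
    have "B \<in> {rHash, rDollar, rMid, rLeft, rHead, rRight, rTail}" using that unfolding slot0_def by auto
    then obtain e1 e2 ce where "B = reg e1 e2 ce" using reg by blast
    then show ?thesis by (rule region_tag) (use slot0_cells[OF that] in blast)
  qed
  have 4: "pairs_of r (bcells ?n B) ts = map (F r ?n) (tag 0 [(map fst (bcells ?n B), ts)])" if "(B, s) \<in> set slot1" for B s ts
  proof -
    have "B \<in> {rHash, rDollar, rMid, rLeft, rHead, rRight, rTail}" using that unfolding slot1_def by auto
    then obtain e1 e2 ce where "B = reg e1 e2 ce" using reg by blast
    then show ?thesis by (rule region_tag) (use slot1_cells[OF that] in blast)
  qed
  have 5: "input_pairs r ?n b i = map (F r ?n) (tag 0 [([rows ?n + 1 + i], ts_sym r (Some (if b then 2 else 1)))])"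
    if "i < ?n" for b i
  proof -
    have "input_pairs r ?n b i = map (F r ?n) (tag 0 [(map fst [(rows ?n + 1 + i, rows ?n + 1 + i)], ts_sym r (Some (if b then 2 else 1)))])"
      unfolding input_pairs_def by (rule pairs_of_tag) (use input_cell(1)[OF that] in \<open>auto simp: ov_def\<close>)
    then show ?thesis by simp
  qed
  have A: "concat (map (\<lambda>(B, ts). pairs_of r (bcells ?n B) ts) (concat (map (\<lambda>q. [(crossA q, ts_cross q), (crossB q, ts_cross q)]) [1, 2, 3, 4])))
     = map (F r ?n) (concat (map (\<lambda>q. tag q (cross_blocks ?n q)) [1, 2, 3, 4]))"
    using 2[of 1 "ts_cross 1"] 2[of 2 "ts_cross 2"] 2[of 3 "ts_cross 3"] 2[of 4 "ts_cross 4"]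
    by (simp add: cross_blocks_def)
  have B: "concat (map (\<lambda>(B, ts). pairs_of r (bcells ?n B) ts) (map (\<lambda>(B, \<kappa>). (B, ts_kind r \<kappa>)) slot0))
     = map (F r ?n) (tag 0 (kind_blocks r ?n))"
    unfolding kind_blocks_def tag_map map_concat map_map
    by (rule arg_cong[where f = concat], rule map_cong[OF refl]) (use 3 in auto)
  have C: "concat (map (\<lambda>(B, ts). pairs_of r (bcells ?n B) ts) (map (\<lambda>(B, s). (B, ts_sym r s)) slot1))
     = map (F r ?n) (tag 0 (map (\<lambda>(B, s). (map fst (bcells ?n B), ts_sym r s)) slot1))"
    unfolding tag_map map_concat map_map
    by (rule arg_cong[where f = concat], rule map_cong[OF refl]) (use 4 in auto)
  have D: "concat (map (\<lambda>i. input_pairs r ?n (x ! i) i) [0..<?n])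
     = map (F r ?n) (tag 0 (map (\<lambda>i. ([rows ?n + 1 + i], ts_sym r (Some (if x ! i then 2 else 1)))) [0..<?n]))"
    unfolding tag_map map_concat map_map
    by (rule arg_cong[where f = concat], rule map_cong[OF refl]) (use 5 in auto)
  show ?thesis unfolding plist_def blocks_def tagged_def sym_blocks_def tag_append
    using 1 A B C D by simp
qed

definition template_ok :: "nat \<Rightarrow> nat \<Rightarrow> template \<Rightarrow> bool" where
  "template_ok r q t \<longleftrightarrow> fst t < L \<and> (case snd t of Inl a' \<Rightarrow> a' < L | Inr s \<Rightarrow> s < r \<and> q = 0)"

lemma templates_ok:
  "t \<in> tm_local r \<Longrightarrow> template_ok r 0 t" "t \<in> tm_cross q \<Longrightarrow> template_ok r q t"
  "sl < 2 \<Longrightarrow> t \<in> tm_block r sl B \<Longrightarrow> template_ok r 0 t"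
proof -
  have st: "is_vertex (U \<theta> (3 * (C + sl) + 1))" if "\<theta> < m" "sl < 2" for \<theta> sl using that by (simp add: stages_def)
  have cr: "is_vertex (R c)" "is_vertex (U (tc c) (3 * c + 1))" if "c < C" for c
    using that tc_less by (auto simp: stages_def)
  show "t \<in> tm_local r \<Longrightarrow> template_ok r 0 t"
    unfolding tm_local_def template_ok_def links_local_def
    using idx_less is_link_vertex always_joined_vertex by auto
  show "t \<in> tm_cross q \<Longrightarrow> template_ok r q t"
    unfolding tm_cross_def template_ok_def using idx_less cr by auto
  show "sl < 2 \<Longrightarrow> t \<in> tm_block r sl B \<Longrightarrow> template_ok r 0 t"
    unfolding tm_block_def template_ok_def using idx_less st by auto
qed

text \<open>Blocking templates start at stages with \<open>may_block\<close>, which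
  \<open>always_joined\<close> avoids; the ordinary stub at these stages has colour 1 rather than 2;
  and links stay within one copy, whereas joins change it. The two slots use different
  stages.\<close>

lemma templates_disjoint:
  assumes "sl < 2"
  shows "t \<in> tm_local r \<Longrightarrow> t \<notin> tm_block r sl B"
    "t \<in> tm_block r 0 B \<Longrightarrow> t \<notin> tm_block r 1 B'"
proof -
  have st: "is_vertex (U \<theta> (3 * (C + sl) + 1))" if "\<theta> < m" "sl < 2" for \<theta> sl using that by (simp add: stages_def)
  have fst_block: "\<exists>\<theta> b. \<theta> < m \<and> fst t = idx (U \<theta> (3 * (C + sl) + 1), b) \<and>
      (snd t = Inr 2 \<or> \<not> b \<and> snd t = Inl (idx (U \<theta> (3 * (C + sl) + 1), True)))" if "t \<in> tm_block r sl B" for t sl B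
    using that unfolding tm_block_def by (auto; blast)
  show "t \<notin> tm_block r 1 B'" if t0: "t \<in> tm_block r 0 B"
  proof
    assume "t \<in> tm_block r 1 B'"
    from fst_block[OF this] obtain \<theta> b where 1: "\<theta> < m" "fst t = idx (U \<theta> (3 * (C + 1) + 1), b)" by blast
    obtain \<theta>' b' where 2: "\<theta>' < m" "fst t = idx (U \<theta>' (3 * (C + 0) + 1), b')" using fst_block[OF t0] by blast
    have "U \<theta> (3 * (C + 1) + 1) = U \<theta>' (3 * (C + 0) + 1)"
      using idx_inj[OF st[OF 1(1), of 1] st[OF 2(1), of 0], of b b'] 1(2) 2(2) by simp
    then show False by simp
  qed
  show "t \<notin> tm_block r sl B" if "t \<in> tm_local r"
  proof
    assume "t \<in> tm_block r sl B"
    from fst_block[OF this] obtain \<theta> b where t: "\<theta> < m" "fst t = idx (U \<theta> (3 * (C + sl) + 1), b)"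
      "snd t = Inr 2 \<or> \<not> b \<and> snd t = Inl (idx (U \<theta> (3 * (C + sl) + 1), True))" by blast
    note u = st[OF t(1) assms]
    from that consider d b' where "t = (idx (src d, b'), Inl (idx (tgt d, b')))" "is_link d"
      | v where "t = (idx (v, False), Inl (idx (v, True)))" "always_joined v"
      | v s b' where "t = (idx (v, b'), Inr s)" "is_vertex v" "s \<in> stubs_of v"
      unfolding tm_local_def links_local_def by auto
    then show False
    proof cases
      case 1
      then have "idx (src d, b') = idx (U \<theta> (3 * (C + sl) + 1), False)" "idx (tgt d, b') = idx (U \<theta> (3 * (C + sl) + 1), True)"
        using t by auto
      then have "\<not> b'" "b'" using idx_inj[OF _ u] is_link_vertex[OF 1(2)] by blast+
      then show False by simp
    next
      case 2
      then have "v = U \<theta> (3 * (C + sl) + 1)" using idx_inj[OF always_joined_vertex[OF 2(2)] u] t by auto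
      moreover have "may_block (3 * (C + sl) + 1)" by (simp add: may_block_def)
      ultimately show False using 2(2) by simp
    next
      case 3
      then have "v = U \<theta> (3 * (C + sl) + 1)" "s = 2" using idx_inj[OF 3(2) u] t by auto
      then show False using 3(3) by simp
    qed
  qed
qed

lemma distinct_if_covers:
  assumes "set xs = {..<k}" "length xs = k"
  shows "distinct xs"
  using assms by (intro card_distinct) simp

lemma mem_concat_cells:
  "j \<in> set (concat (map (\<lambda>(B, \<kappa>). f B) xs)) \<longleftrightarrow> (\<exists>B \<kappa>. (B, \<kappa>) \<in> set xs \<and> j \<in> set (f B))"
  by (induction xs) auto

lemma kind_cells_distinct:
  "set (concat (map fst (kind_blocks r n))) = {..<ncells n}" "distinct (concat (map fst (kind_blocks r n)))"
proof -
  have eq: "concat (map fst (kind_blocks r n)) = concat (map (\<lambda>(B, \<kappa>). map fst (bcells n B)) slot0)"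
    unfolding kind_blocks_def map_map by (rule arg_cong[where f = concat]) (auto intro: map_cong)
  show 1: "set (concat (map fst (kind_blocks r n))) = {..<ncells n}"
  proof (rule set_eqI)
    fix j
    show "j \<in> set (concat (map fst (kind_blocks r n))) \<longleftrightarrow> j \<in> {..<ncells n}"
      unfolding eq mem_concat_cells using slot0_cells slot0_complete by blast
  qed
  show "distinct (concat (map fst (kind_blocks r n)))"
    by (rule distinct_if_covers[OF 1]) (simp add: eq slot0_length)
qed

lemma sym_cells_distinct:
  "set (concat (map fst (sym_blocks r x))) = {..<ncells (length x)}" "distinct (concat (map fst (sym_blocks r x)))"
proof -
  let ?n = "length x"
  have eq: "concat (map fst (sym_blocks r x)) = concat (map (\<lambda>(B, \<kappa>). map fst (bcells ?n B)) slot1) @ map (\<lambda>i. rows ?n + 1 + i) [0..<?n]"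
  proof -
    have eq2: "map fst (map (\<lambda>(B, s). (map fst (bcells ?n B), ts_sym r s)) slot1) = map (\<lambda>(B, \<kappa>). map fst (bcells ?n B)) slot1"
      by (auto intro: map_cong)
    show ?thesis unfolding sym_blocks_def map_append concat_append eq2 by (simp add: o_def)
  qed
  show 1: "set (concat (map fst (sym_blocks r x))) = {..<ncells ?n}"
  proof (rule set_eqI)
    fix j
    have "j \<in> set (map (\<lambda>i. rows ?n + 1 + i) [0..<?n]) \<longleftrightarrow> (\<exists>i<?n. j = rows ?n + 1 + i)"
      unfolding set_map set_upt by force
    then show "j \<in> set (concat (map fst (sym_blocks r x))) \<longleftrightarrow> j \<in> {..<ncells ?n}"
      unfolding eq set_append Un_iff mem_concat_cells
      using slot1_cells[of _ _ j x] slot1_complete[of j x] input_cell(1)[of _ x] by blast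
  qed
  show "distinct (concat (map fst (sym_blocks r x)))"
    by (rule distinct_if_covers[OF 1]) (simp only: eq slot1_length)
qed

end

lemma terminal_pair_less:
  fixes S T :: "'d \<Rightarrow> nat" and St :: "(nat \<times> nat) set"
  assumes "(s, t) \<in> (\<lambda>d. (r + S d, r + T d)) ` D \<union> (\<lambda>(v, c). (r + v, c)) ` {(v, c) \<in> St. c < r}"
    and "\<And>d. d \<in> D \<Longrightarrow> S d < n" "\<And>d. d \<in> D \<Longrightarrow> T d < n" and "St \<subseteq> {..<n} \<times> {..<3}"
  shows "s < r + n \<and> t < r + n"
  using assms by auto

context reduction
begin

lemma mem_tag: "(j, q', t) \<in> set (tag q bl) \<longleftrightarrow> q' = q \<and> (\<exists>b\<in>set bl. j \<in> set (fst b) \<and> t \<in> set (snd b))"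
  unfolding set_tag by (auto simp: case_prod_unfold)

lemma mem_tag_map:
  "(j, q', t) \<in> set (tag q (map (\<lambda>(B, \<kappa>). (f B, g \<kappa>)) xs)) \<longleftrightarrow>
    q' = q \<and> (\<exists>B \<kappa>. (B, \<kappa>) \<in> set xs \<and> j \<in> set (f B) \<and> t \<in> set (g \<kappa>))"
proof -
  have "(\<exists>b\<in>set (map (\<lambda>(B, \<kappa>). (f B, g \<kappa>)) xs). j \<in> set (fst b) \<and> t \<in> set (snd b)) \<longleftrightarrow>
    (\<exists>B \<kappa>. (B, \<kappa>) \<in> set xs \<and> j \<in> set (f B) \<and> t \<in> set (g \<kappa>))"
    by (induction xs) (simp_all add: split_paired_Ex case_prod_unfold, metis prod.collapse fst_conv snd_conv)
  then show ?thesis unfolding mem_tag by blast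
qed

lemma mem_tag_single:
  "(j, q', t) \<in> set (tag q (map (\<lambda>i. ([c + i], g i)) xs)) \<longleftrightarrow> q' = q \<and> (\<exists>i\<in>set xs. j = c + i \<and> t \<in> set (g i))"
  unfolding mem_tag by simp

lemma kind_tagged:
  "(j, q, t) \<in> set (tag 0 (kind_blocks r n)) \<longleftrightarrow> q = 0 \<and> j < ncells n \<and> t \<in> tm_block r 0 (bad_kind (ckind n j))"
proof -
  have "(\<exists>B \<kappa>. (B, \<kappa>) \<in> set slot0 \<and> j \<in> set (map fst (bcells n B)) \<and> t \<in> tm_block r 0 (bad_kind \<kappa>)) \<longleftrightarrow>
    j < ncells n \<and> t \<in> tm_block r 0 (bad_kind (ckind n j))"
    using slot0_cells[of _ _ j n] slot0_complete[of j n] by blast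
  then show ?thesis unfolding kind_blocks_def mem_tag_map ts_simps by blast
qed

lemma sym_tagged:
  "(j, q, t) \<in> set (tag 0 (sym_blocks r x)) \<longleftrightarrow>
    q = 0 \<and> j < ncells (length x) \<and> t \<in> tm_block r 1 (bad_sym (csym x j))"
proof -
  let ?n = "length x"
  have "((\<exists>B s. (B, s) \<in> set slot1 \<and> j \<in> set (map fst (bcells ?n B)) \<and> t \<in> tm_block r 1 (bad_sym s)) \<or>
      (\<exists>i<?n. j = rows ?n + 1 + i \<and> t \<in> tm_block r 1 (bad_sym (csym x j)))) \<longleftrightarrow>
    j < ncells ?n \<and> t \<in> tm_block r 1 (bad_sym (csym x j))"
    using slot1_cells[of _ _ j x] slot1_complete[of j x] input_cell(1)[of _ x] by blast
  moreover have "(\<exists>i\<in>set [0..<?n]. j = rows ?n + 1 + i \<and> t \<in> tm_block r 1 (bad_sym (Some (if x ! i then 2 else 1)))) \<longleftrightarrow>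
      (\<exists>i<?n. j = rows ?n + 1 + i \<and> t \<in> tm_block r 1 (bad_sym (csym x j)))"
    using input_cell(2)[of _ x] by (simp only: set_upt) fastforce
  ultimately show ?thesis unfolding sym_blocks_def tag_append set_append Un_iff mem_tag_map mem_tag_single ts_simps by blast
qed

lemma cross_tagged:
  assumes "q' \<in> {1..4}"
  shows "(j, q, t) \<in> set (tag q' (cross_blocks n q')) \<longleftrightarrow> q = q' \<and> j < ncells n \<and> t \<in> tm_cross q'"
proof -
  have "set (map fst (bcells n (crossA q'))) \<union> set (map fst (bcells n (crossB q'))) = {0..<ncells n}"
    using arg_cong[OF cross_cells(1)[OF assms, of n], of set] unfolding crossA_def crossB_def by simp
  then have "j < ncells n \<longleftrightarrow> j \<in> set (map fst (bcells n (crossA q'))) \<or> j \<in> set (map fst (bcells n (crossB q')))"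
    by (metis Un_iff atLeastLessThan_iff zero_le)
  then show ?thesis unfolding mem_tag cross_blocks_def by (auto simp: ts_simps simp del: set_map)
qed

lemma local_tagged:
  "(j, q, t) \<in> set (tag 0 [(map fst (bcells n rAll), ts_local r)]) \<longleftrightarrow> q = 0 \<and> j < ncells n \<and> t \<in> tm_local r"
  unfolding mem_tag all_cells by (auto simp: ts_simps)

lemma set_tagged:
  "(j, q, t) \<in> set (tagged r x) \<longleftrightarrow> j < ncells (length x) \<and>
     (q = 0 \<and> t \<in> tm_local r \<or> q \<in> {1..4} \<and> t \<in> tm_cross q \<or>
      q = 0 \<and> t \<in> tm_block r 0 (bad_kind (ckind (length x) j)) \<or> q = 0 \<and> t \<in> tm_block r 1 (bad_sym (csym x j)))"
proof -
  have q: "q \<in> {1..4} \<longleftrightarrow> q = 1 \<or> q = 2 \<or> q = 3 \<or> q = 4" by auto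
  show ?thesis unfolding tagged_def set_append Un_iff local_tagged kind_tagged sym_tagged q
    using cross_tagged[of 1 j q t "length x"] cross_tagged[of 2 j q t "length x"]
      cross_tagged[of 3 j q t "length x"] cross_tagged[of 4 j q t "length x"] by auto
qed

lemma disjoint_triples:
  "(\<And>j q t. (j, q, t) \<in> A \<Longrightarrow> (j, q, t) \<in> B \<Longrightarrow> False) \<Longrightarrow> A \<inter> B = {}"
  by (auto simp: disjoint_iff)

lemma distinct_tagged: "distinct (tagged r x)"
proof -
  let ?n = "length x"
  have 1: "distinct (tag 0 [(map fst (bcells ?n rAll), ts_local r)])"
    by (rule distinct_tag) (simp_all add: all_cells ts_simps)
  have 2: "distinct (tag q (cross_blocks ?n q))" if "q \<in> {1..4}" for q
  proof (rule distinct_tag)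
    show "distinct (concat (map fst (cross_blocks ?n q)))"
      using arg_cong[OF cross_cells(1)[OF that, of ?n], of distinct] by (simp add: cross_blocks_def crossA_def crossB_def)
  qed (auto simp: cross_blocks_def ts_simps)
  have 3: "distinct (tag 0 (kind_blocks r ?n))"
    by (rule distinct_tag[OF kind_cells_distinct(2)]) (auto simp: kind_blocks_def ts_simps)
  have 4: "distinct (tag 0 (sym_blocks r x))"
    by (rule distinct_tag[OF sym_cells_distinct(2)]) (auto simp: sym_blocks_def ts_simps)
  let ?L = "tag 0 [(map fst (bcells ?n rAll), ts_local r)]" and ?K = "tag 0 (kind_blocks r ?n)" and ?S = "tag 0 (sym_blocks r x)"
  let ?X = "\<lambda>q. tag q (cross_blocks ?n q)"
  have d1: "set (?X q) \<inter> set (?X q') = {}" if "q \<noteq> q'" "q \<in> {1..4}" "q' \<in> {1..4}" for q q'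
    by (rule disjoint_triples) (use that(1) in \<open>simp add: cross_tagged[OF that(2)] cross_tagged[OF that(3)]\<close>)
  have d2: "set (?X q) \<inter> set ?L = {}" "set (?X q) \<inter> set ?K = {}" "set (?X q) \<inter> set ?S = {}" if "q \<in> {1..4}" for q
    by (rule disjoint_triples; use that in \<open>simp only: cross_tagged[OF that] local_tagged kind_tagged sym_tagged, force\<close>)+
  have d3: "set ?L \<inter> set ?K = {}" "set ?L \<inter> set ?S = {}" "set ?K \<inter> set ?S = {}"
    by (rule disjoint_triples; unfold local_tagged kind_tagged sym_tagged;
        use templates_disjoint[of 0] templates_disjoint[of 1] in \<open>metis one_less_numeral_iff semiring_norm(76) pos2\<close>)+
  have c: "concat (map ?X [1, 2, 3, 4]) = ?X 1 @ ?X 2 @ ?X 3 @ ?X 4" by simp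
  show ?thesis unfolding tagged_def c distinct_append set_append
    using 1 2[of 1] 2[of 2] 2[of 3] 2[of 4] 3 4 d1[of 1 2] d1[of 1 3] d1[of 1 4] d1[of 2 3] d1[of 2 4] d1[of 3 4]
      d2[of 1] d2[of 2] d2[of 3] d2[of 4] d3 by (simp add: Int_Un_distrib Int_Un_distrib2 Int_commute)
qed

lemma add_mult_inj: "a < L \<Longrightarrow> a' < L \<Longrightarrow> L * j + a = L * j' + a' \<Longrightarrow> j = j' \<and> a = a'" for a a' j j' :: nat
  by (rule numbered_gadget.mult_add_inj[OF numbered[of "[]"]])

lemma ov_inj: "q \<le> 4 \<Longrightarrow> q' \<le> 4 \<Longrightarrow> ov (cols n) q = ov (cols n) q' \<Longrightarrow> q = q'"
proof -
  assume q: "q \<le> 4" "q' \<le> 4" "ov (cols n) q = ov (cols n) q'"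
  have v: "ov c 0 = 0" "ov c 1 = 1" "ov c 2 = c - 1" "ov c 3 = c" "ov c 4 = c + 1" for c by (simp_all add: ov_def)
  have *: "p = 0 \<or> p = 1 \<or> p = 2 \<or> p = 3 \<or> p = 4" if "p \<le> 4" for p :: nat using that by linarith
  show ?thesis using *[OF q(1)] *[OF q(2)] q(3) cols_ge(1)[of n]
    by (elim disjE; simp only: v; linarith)
qed

text \<open>Leaf numbers within a cell are below \<open>L\<close>, so a leaf determines its cell and
  its number there. If the second end is a leaf, the offset class is recovered from the cyclic
  difference of the two cells, as the offsets are distinct and smaller than the number of cells. If
  it is a hub, the class is 0 by \<open>template_ok\<close>.\<close>

lemma inj_F: "inj_on (F r (length x)) (set (tagged r x))"
proof (rule inj_onI)
  let ?n = "length x"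
  let ?N = "ncells ?n"
  have ok: "j < ?N \<and> q \<le> 4 \<and> template_ok r q t" if "(j, q, t) \<in> set (tagged r x)" for j q t
    using that templates_ok(1)[of t r] templates_ok(2)[of t q r] templates_ok(3)[of 0 t r] templates_ok(3)[of 1 t r]
    unfolding set_tagged by auto
  fix y z assume yz: "y \<in> set (tagged r x)" "z \<in> set (tagged r x)" "F r ?n y = F r ?n z"
  obtain j q a u where y: "y = (j, q, a, u)" by (cases y)
  obtain j' q' a' u' where z: "z = (j', q', a', u')" by (cases z)
  have oky: "j < ?N" "q \<le> 4" "a < L" and okz: "j' < ?N" "q' \<le> 4" "a' < L"
    and tu: "case u of Inl a' \<Rightarrow> a' < L | Inr s \<Rightarrow> s < r \<and> q = 0" "case u' of Inl a' \<Rightarrow> a' < L | Inr s \<Rightarrow> s < r \<and> q' = 0"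
    using ok yz(1,2) by (auto simp: y z template_ok_def)
  have "L * j + a = L * j' + a'" using yz(3) by (simp add: F_def inst_def y z)
  then have ja: "j' = j" "a' = a" using add_mult_inj[OF oky(3) okz(3)] by auto
  have snd: "(case u of Inl b \<Rightarrow> r + (L * ((j + ov (cols ?n) q) mod ?N) + b) | Inr s \<Rightarrow> s) =
      (case u' of Inl b \<Rightarrow> r + (L * ((j + ov (cols ?n) q') mod ?N) + b) | Inr s \<Rightarrow> s)"
    using yz(3) by (simp add: F_def inst_def y z ja)
  show "y = z"
  proof (cases u)
    case (Inl b)
    then obtain b' where u': "u' = Inl b'" using snd tu(2) by (cases u') auto
    have bl: "b < L" "b' < L" using tu by (simp_all add: Inl u')
    have eqb: "L * ((j + ov (cols ?n) q) mod ?N) + b = L * ((j + ov (cols ?n) q') mod ?N) + b'"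
      using snd unfolding Inl u' sum.case by (rule add_left_imp_eq)
    have b: "(j + ov (cols ?n) q) mod ?N = (j + ov (cols ?n) q') mod ?N" "b = b'"
      using add_mult_inj[OF bl eqb] by simp_all
    have "ov (cols ?n) p = ((j + ov (cols ?n) p) mod ?N + (?N - j)) mod ?N" for p
    proof -
      have k: "(j + ov (cols ?n) p) mod ?N < ?N" using oky(1) by (intro mod_less_divisor) linarith
      show ?thesis by (rule iffD1[OF rotate_iff[OF oky(1) k ov_less[of ?n p]]]) (simp only: add.commute)
    qed
    then have "ov (cols ?n) q = ov (cols ?n) q'" using b(1) by metis
    then have "q = q'" using ov_inj oky(2) okz(2) by blast
    then show ?thesis by (simp add: y z ja Inl u' b)
  next
    case (Inr s)
    then obtain s' where u': "u' = Inr s'" using snd tu(1) by (cases u') auto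
    then show ?thesis using snd tu by (simp add: y z ja Inr)
  qed
qed

lemma distinct_plist: "distinct (plist r x)"
  unfolding plist_tagged distinct_map using distinct_tagged inj_F by blast

lemma L_pos: "0 < L"
  using idx_less[of "Z 0" False] m_pos by simp

theorem reduction_instance:
  fixes x
  defines "N \<equiv> ncells (length x)"
  shows "r \<le> 3 \<Longrightarrow> 2 \<le> r \<Longrightarrow> hub_instance r (L * N) (plist r x) \<in> unit_capacity_fvs (r - 1)"
    "EDP (hub_instance 3 (L * N) (plist 3 x)) \<longleftrightarrow> (\<exists>\<sigma>. grid x (rows (length x)) \<sigma>)"
    "MaxEDP (hub_instance 2 (L * N) (plist 2 x), (L + low_stubs) * N) \<longleftrightarrow> (\<exists>\<sigma>. grid x (rows (length x)) \<sigma>)"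
proof -
  interpret G: numbered_gadget m C sc tc oc idx L N "ov (cols (length x))" "blkf x"
    unfolding N_def by (rule numbered)
  have set_plist: "set (plist r x) = G.terminal_pairs r" for r
  proof -
    have b: "{\<theta>. blkf x 0 j \<theta>} = bad_kind (ckind (length x) j)" "{\<theta>. blkf x 1 j \<theta>} = bad_sym (csym x j)" for j
      by (auto simp: blkf_def)
    have ov0: "j < N \<Longrightarrow> (j + ov (cols (length x)) 0) mod N = j" for j by (simp add: ov_def)
    have cr: "q \<in> {1..4}" if "t \<in> tm_cross q" for q t
      using that oc_range unfolding tm_cross_def by auto
    have F: "F r (length x) (j, q, t) = inst L r j ((j + ov (cols (length x)) q) mod N) t" for j q t
      by (simp add: F_def N_def)
    show ?thesis unfolding plist_tagged set_map G.terminal_pairs_templates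
    proof (intro equalityI subsetI)
      fix y assume "y \<in> F r (length x) ` set (tagged r x)"
      then obtain w where w: "w \<in> set (tagged r x)" "y = F r (length x) w" by blast
      obtain j q t where "w = (j, q, t)" by (cases w)
      then have jqt: "(j, q, t) \<in> set (tagged r x)" "y = F r (length x) (j, q, t)" using w by simp_all
      then have j: "j < N" unfolding set_tagged N_def by blast
      from jqt(1) consider "q = 0" "t \<in> tm_local r" | "t \<in> tm_cross q" | "q = 0" "t \<in> tm_block r 0 {\<theta>. blkf x 0 j \<theta>}"
        | "q = 0" "t \<in> tm_block r 1 {\<theta>. blkf x 1 j \<theta>}" unfolding set_tagged b by blast
      then show "y \<in> {inst L r j j t |j t. j < N \<and> t \<in> tm_local r} \<union>
         {inst L r j ((j + ov (cols (length x)) q) mod N) t |j q t. j < N \<and> t \<in> tm_cross q} \<union>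
         {inst L r j j t |j sl t. j < N \<and> sl < 2 \<and> t \<in> tm_block r sl {\<theta>. blkf x sl j \<theta>}}"
      proof cases
        case 1
        have "y = inst L r j j t" unfolding jqt(2) F 1(1) ov0[OF j] ..
        then show ?thesis using 1(2) j by blast
      next
        case 2
        then show ?thesis unfolding jqt(2) F using j by blast
      next
        case 3
        have "y = inst L r j j t" "(0::nat) < 2" unfolding jqt(2) F 3(1) ov0[OF j] by simp_all
        then show ?thesis using 3(2) j by blast
      next
        case 4
        have "y = inst L r j j t" "(1::nat) < 2" unfolding jqt(2) F 4(1) ov0[OF j] by simp_all
        then show ?thesis using 4(2) j by blast
      qed
    next
      fix y assume "y \<in> {inst L r j j t |j t. j < N \<and> t \<in> tm_local r} \<union>
         {inst L r j ((j + ov (cols (length x)) q) mod N) t |j q t. j < N \<and> t \<in> tm_cross q} \<union>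
         {inst L r j j t |j sl t. j < N \<and> sl < 2 \<and> t \<in> tm_block r sl {\<theta>. blkf x sl j \<theta>}}"
      then consider j t where "y = inst L r j j t" "j < N" "t \<in> tm_local r"
        | j q t where "y = inst L r j ((j + ov (cols (length x)) q) mod N) t" "j < N" "t \<in> tm_cross q"
        | j sl t where "y = inst L r j j t" "j < N" "sl < 2" "t \<in> tm_block r sl {\<theta>. blkf x sl j \<theta>}" by blast
      then show "y \<in> F r (length x) ` set (tagged r x)"
      proof cases
        case 1
        have m: "(j, 0, t) \<in> set (tagged r x)" unfolding set_tagged N_def[symmetric] using 1 by blast
        have "y = F r (length x) (j, 0, t)" unfolding F ov0[OF 1(2)] by (rule 1(1))
        then show ?thesis by (rule image_eqI[OF _ m])
      next
        case 2
        have m: "(j, q, t) \<in> set (tagged r x)" unfolding set_tagged N_def[symmetric] using 2 cr[OF 2(3)] by blast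
        have "y = F r (length x) (j, q, t)" unfolding F by (rule 2(1))
        then show ?thesis by (rule image_eqI[OF _ m])
      next
        case 3
        have "sl = 0 \<or> sl = 1" using 3(3) by linarith
        then have "t \<in> tm_block r 0 (bad_kind (ckind (length x) j)) \<or> t \<in> tm_block r 1 (bad_sym (csym x j))"
        proof
          assume s: "sl = 0"
          show ?thesis using 3(4)[unfolded s b] by (rule disjI1)
        next
          assume s: "sl = 1"
          show ?thesis using 3(4)[unfolded s b] by (rule disjI2)
        qed
        then have m: "(j, 0, t) \<in> set (tagged r x)" unfolding set_tagged N_def[symmetric] using 3(2) by blast
        have "y = F r (length x) (j, 0, t)" unfolding F ov0[OF 3(2)] by (rule 3(1))
        then show ?thesis by (rule image_eqI[OF _ m])
      qed
    qed
  qed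
  have range: "s < r + L * N \<and> t < r + L * N" if "(s, t) \<in> set (plist r x)" for s t r
    by (rule terminal_pair_less[OF that[unfolded set_plist G.terminal_pairs_def] G.S_less G.T_less G.St_sub])
  \<comment> \<open>The formula for the feedback vertex number requires at least as many leaves as
    hubs.\<close>
  have "3 \<le> N" using cols_ge[of "length x"] by (simp add: N_def ncells_def)
  then have big: "3 \<le> L * N" using L_pos mult_le_mono[of 1 L 3 N] by simp
  show "r \<le> 3 \<Longrightarrow> 2 \<le> r \<Longrightarrow> hub_instance r (L * N) (plist r x) \<in> unit_capacity_fvs (r - 1)"
    using big by (intro hub_instance_unit_capacity_fvs distinct_plist range) simp_all
  have g: "(\<exists>sel. G.tiling sel) \<longleftrightarrow> (\<exists>\<sigma>. grid x (rows (length x)) \<sigma>)"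
    unfolding N_def by (rule tiling_iff_grid)
  show "EDP (hub_instance 3 (L * N) (plist 3 x)) \<longleftrightarrow> (\<exists>\<sigma>. grid x (rows (length x)) \<sigma>)"
    using G.EDP_iff_tiling[OF set_plist] g by simp
  show "MaxEDP (hub_instance 2 (L * N) (plist 2 x), (L + low_stubs) * N) \<longleftrightarrow> (\<exists>\<sigma>. grid x (rows (length x)) \<sigma>)"
    using G.MaxEDP_iff_tiling[OF set_plist] g by simp
qed

end

section \<open>Printing the instances in polynomial time\<close>

text \<open>The empty sequence is a loop that never runs.\<close>

primrec gseq :: "gen list \<Rightarrow> gen" where
  "gseq [] = For (Num 0) (Nat (Num 0))"
| "gseq (g # gs) = Then g (gseq gs)"

lemma nats_gseq: "nats d (gseq gs) \<sigma> = concat (map (\<lambda>g. nats d g \<sigma>) gs)"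
  by (induction gs) simp_all

lemma scoped_gseq: "scoped d (gseq gs) \<longleftrightarrow> (\<forall>g\<in>set gs. scoped d g)"
  by (induction gs) simp_all

definition flat :: "(nat \<times> nat) list \<Rightarrow> nat list" where
  "flat ps = concat (map (\<lambda>(s, t). [s, t]) ps)"

lemma flat_append: "flat (ps @ ps') = flat ps @ flat ps'"
  by (simp add: flat_def)

lemma flat_concat: "flat (concat pss) = concat (map flat pss)"
  by (induction pss) (simp_all add: flat_def)

context reduction
begin

definition gtm :: "nat \<Rightarrow> exp \<Rightarrow> exp \<Rightarrow> template \<Rightarrow> gen" where
  "gtm r ce ce' = (\<lambda>(a, u). Then (Nat (Add (Num r) (Add (Mul (Num L) ce) (Num a))))
     (Nat (case u of Inl a' \<Rightarrow> Add (Num r) (Add (Mul (Num L) ce') (Num a')) | Inr s \<Rightarrow> Num s)))"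

lemma nats_gtm: "nats d (gtm r ce ce' t) \<sigma> = (case inst L r (eval ce \<sigma>) (eval ce' \<sigma>) t of (x, y) \<Rightarrow> [x, y])"
  by (cases t) (simp add: gtm_def inst_def split: sum.split)

lemma scoped_gtm: "vars ce \<subseteq> {..<d} \<Longrightarrow> vars ce' \<subseteq> {..<d} \<Longrightarrow> scoped d (gtm r ce ce' t)"
  by (cases t) (simp add: gtm_def split: sum.split)

lemma nats_gtms:
  "nats d (gseq (map (gtm r ce ce') ts)) \<sigma> = flat (map (inst L r (eval ce \<sigma>) (eval ce' \<sigma>)) ts)"
  unfolding nats_gseq flat_def map_map o_def nats_gtm ..

fun gblk :: "nat \<Rightarrow> (exp \<times> exp \<times> exp \<times> exp) \<times> template list \<Rightarrow> gen" where
  "gblk r ((e1, e2, ce, ce'), ts) = For e1 (For e2 (gseq (map (gtm r ce ce') ts)))"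

text \<open>The inner bound may depend on the input length only, so both loops together range over a
  rectangle as in \<open>bcells\<close>.\<close>

lemma nats_gblk:
  assumes "vars e2 \<subseteq> {0}"
  shows "nats 1 (gblk r ((e1, e2, ce, ce'), ts)) (\<lambda>_. n) = flat (pairs_of r (bcells n (e1, e2, ce, ce')) ts)"
proof -
  have e2: "eval e2 ((\<lambda>_. n)(Suc 0 := k)) = eval e2 (\<lambda>_. n)" for k
    by (rule eval_cong) (use assms in auto)
  have cc: "concat (map (\<lambda>k. concat (h k)) ks) = concat (concat (map h ks))"
    for h :: "nat \<Rightarrow> nat list list" and ks
    by (induction ks) simp_all
  have e: "nats 1 (gblk r ((e1, e2, ce, ce'), ts)) (\<lambda>_. n) = concat (map (\<lambda>k. concat (map (\<lambda>w.
     flat (map (inst L r (eval ce ((\<lambda>_. n)(1 := k, 2 := w))) (eval ce' ((\<lambda>_. n)(1 := k, 2 := w)))) ts))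
       [0..<eval e2 (\<lambda>_. n)])) [0..<eval e1 (\<lambda>_. n)])"
    unfolding gblk.simps nats.simps nats_gtms numeral_2_eq_2 One_nat_def e2 ..
  show ?thesis
    unfolding e pairs_of_def bcells_def prod.case map_concat flat_concat map_map o_def
    by (simp add: flat_concat map_concat o_def cc)
qed

definition gedges :: "nat \<Rightarrow> gen" where
  "gedges r = For (Mul (Num L) eN)
     (gseq (map (\<lambda>h. Then (Nat (Num h)) (Then (Nat (Add (Num r) (Var 1))) (Nat (Num 1)))) [0..<r]))"

definition ginst :: "nat \<Rightarrow> gen" where
  "ginst r = Then (Nat (Add (Num r) (Mul (Num L) eN))) (Then (Nat (Mul (Mul (Num L) eN) (Num r)))
     (Then (gedges r) (gseq (map (gblk r) (blocks r)))))"

definition gin :: "nat \<Rightarrow> bool \<Rightarrow> gen" where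
  "gin r b = gseq (map (gtm r (Add eT (Add (Num 1) (Var 1))) (Add eT (Add (Num 1) (Var 1)))) (ts_sym r (Some (if b then 2 else 1))))"

lemma vars_e: "vars eT \<subseteq> {0}" "vars eW1 \<subseteq> {0}" "vars eW \<subseteq> {0}" "vars eN \<subseteq> {0}"
  "vars (eOff q) \<subseteq> {0}" "vars (eRest q) \<subseteq> {0}"
  using vars_ep by (auto simp: eT_def eW1_def eW_def eN_def eOff_def eRest_def)

lemma blocks_scoped:
  assumes "((e1, e2, ce, ce'), ts) \<in> set (blocks r)"
  shows "vars e1 \<subseteq> {0}" "vars e2 \<subseteq> {0}" "vars ce \<subseteq> {0, 1, 2}" "vars ce' \<subseteq> {0, 1, 2}"
proof -
  have v0: "vars eT \<subseteq> {0, 1, 2}" "vars eW \<subseteq> {0, 1, 2}" "vars (eOff q) \<subseteq> {0, 1, 2}" "vars (eRest q) \<subseteq> {0, 1, 2}" for q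
    using vars_e by blast+
  have "(e1, e2, ce, ce') \<in> {rAll, rHash, rDollar, rMid, rLeft, rHead, rRight, rTail} \<union>
      crossA ` {1, 2, 3, 4} \<union> crossB ` {1, 2, 3, 4}"
    using assms unfolding blocks_def slot0_def slot1_def by auto
  then have "vars e1 \<subseteq> {0} \<and> vars e2 \<subseteq> {0} \<and> vars ce \<subseteq> {0, 1, 2} \<and> vars ce' \<subseteq> {0, 1, 2}"
    using vars_e vars_ep v0
    unfolding rAll_def rHash_def rDollar_def rMid_def rLeft_def rHead_def rRight_def rTail_def reg_def crossA_def crossB_def
    by (elim UnE insertE emptyE imageE) simp_all
  then show "vars e1 \<subseteq> {0}" "vars e2 \<subseteq> {0}" "vars ce \<subseteq> {0, 1, 2}" "vars ce' \<subseteq> {0, 1, 2}" by auto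
qed

lemma three: "{..<Suc (Suc (Suc 0))} = {0, 1, 2 :: nat}"
  by auto

lemma scoped_ginst: "scoped 1 (ginst r)"
proof -
  have "scoped 1 (gblk r b)" if b: "b \<in> set (blocks r)" for b
  proof -
    obtain e1 e2 ce ce' ts where b': "b = ((e1, e2, ce, ce'), ts)" by (metis prod.exhaust)
    note s = blocks_scoped[OF b[unfolded b']]
    have "scoped (Suc (Suc (Suc 0))) (gtm r ce ce' t)" for t by (rule scoped_gtm) (use s three in auto)
    then show ?thesis using s by (auto simp: b' scoped_gseq)
  qed
  then show ?thesis using vars_e by (auto simp: ginst_def gedges_def scoped_gseq)
qed

lemma scoped_gin: "scoped 2 (gin r b)"
proof -
  have "vars (Add eT (Add (Num 1) (Var 1))) \<subseteq> {..<2}" using vars_e(1) by auto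
  then show ?thesis unfolding gin_def by (auto simp: scoped_gseq intro!: scoped_gtm)
qed

lemma nats_gin: "nats 2 (gin r b) (\<lambda>v. if v = 0 then n else i) = flat (input_pairs r n b i)"
  unfolding gin_def nats_gtms input_pairs_def pairs_of_def by (simp add: evals add.assoc)

text \<open>The encoding ends with the terminal pairs, and \<open>plist\<close> ends with those of
  the input cells. So everything that depends on input bits comes last, as
  \<open>gen_poly_time\<close> demands.\<close>

lemma nats_instance:
  "nats_of_instance (hub_instance r (L * ncells (length x)) (plist r x)) = nats 1 (ginst r) (\<lambda>_. length x) @
    concat (map (\<lambda>i. nats 2 (if x ! i then gin r True else gin r False) (\<lambda>v. if v = 0 then length x else i)) [0..<length x])"
proof -
  let ?n = "length x"
  have len: "length (concat (map (\<lambda>v. map (f v) [0..<r]) [0..<k])) = k * r" for f :: "nat \<Rightarrow> nat \<Rightarrow> nat \<times> nat \<times> nat" and k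
    by (induction k) auto
  have edges: "nats 1 (gedges r) (\<lambda>_. ?n) = concat (map (\<lambda>(u, v, c). [u, v, c])
      (concat (map (\<lambda>v. map (\<lambda>h. (h, r + v, 1)) [0..<r]) [0..<L * ncells ?n])))"
  proof -
    have c: "concat (map (\<lambda>v. concat (map (\<lambda>h. [h, r + v, 1]) [0..<r])) ks) =
        concat (map (\<lambda>(u, v, c). [u, v, c]) (concat (map (\<lambda>v. map (\<lambda>h. (h, r + v, 1)) [0..<r]) ks)))" for ks
      by (induction ks) (simp_all add: o_def)
    show ?thesis unfolding c[symmetric] gedges_def nats.simps nats_gseq map_map o_def by (simp add: evals)
  qed
  have blk: "concat (map (\<lambda>b. nats 1 (gblk r b) (\<lambda>_. ?n)) (blocks r)) =
      flat (concat (map (\<lambda>(B, ts). pairs_of r (bcells ?n B) ts) (blocks r)))"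
  proof -
    have "nats 1 (gblk r b) (\<lambda>_. ?n) = flat ((\<lambda>(B, ts). pairs_of r (bcells ?n B) ts) b)" if "b \<in> set (blocks r)" for b
    proof -
      obtain e1 e2 ce ce' ts where b': "b = ((e1, e2, ce, ce'), ts)" by (metis prod.exhaust)
      show ?thesis unfolding b' prod.case by (rule nats_gblk) (use blocks_scoped(2) that b' in blast)
    qed
    then show ?thesis unfolding flat_concat map_map o_def by (metis (no_types, lifting) map_cong)
  qed
  have inp: "concat (map (\<lambda>i. nats 2 (if x ! i then gin r True else gin r False) (\<lambda>v. if v = 0 then ?n else i)) [0..<?n]) =
      flat (concat (map (\<lambda>i. input_pairs r ?n (x ! i) i) [0..<?n]))"
  proof -
    have "nats 2 (if x ! i then gin r True else gin r False) (\<lambda>v. if v = 0 then ?n else i) = flat (input_pairs r ?n (x ! i) i)" for i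
      using nats_gin by (cases "x ! i") simp_all
    then show ?thesis unfolding flat_concat map_map o_def by simp
  qed
  show ?thesis
    unfolding ginst_def nats.simps nats_gseq map_map o_def blk inp edges nats_of_instance_def
    by (simp add: hub_instance_def plist_def flat_def[symmetric] flat_append len evals o_def)
qed

lemma poly_time_EDP: "poly_time_computable (\<lambda>x. encode_EDP (hub_instance r (L * ncells (length x)) (plist r x)))"
  unfolding encode_EDP_def nats_instance by (rule gen_poly_time[OF scoped_ginst scoped_gin scoped_gin])

lemma poly_time_MaxEDP:
  "poly_time_computable (\<lambda>x. encode_MaxEDP (hub_instance r (L * ncells (length x)) (plist r x), k * ncells (length x)))"
proof -
  have "scoped 1 (Then (Nat (Mul (Num k) eN)) (ginst r))" using scoped_ginst vars_e(4) by auto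
  from gen_poly_time[OF this scoped_gin[of r True] scoped_gin[of r False]] show ?thesis
    unfolding encode_MaxEDP_def prod.case nats_instance by (simp add: evals)
qed

end

text \<open>Horner's scheme.\<close>

lemma exp_of_poly: "\<exists>e. (\<forall>\<sigma>. eval e \<sigma> = poly p (\<sigma> 0)) \<and> vars e \<subseteq> {0}" for p :: "nat poly"
proof (induction p)
  case 0
  show ?case by (intro exI[of _ "Num 0"]) simp
next
  case (pCons a p)
  then obtain e where "\<forall>\<sigma>. eval e \<sigma> = poly p (\<sigma> 0)" "vars e \<subseteq> {0}" by blast
  then show ?case by (intro exI[of _ "Add (Num a) (Mul (Var 0) e)"]) auto
qed

text \<open>The tiles, the incompatible pairs and the leaves of a cell are finite sets determined by
  the machine alone, so arbitrary enumerations of them will do.\<close>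

lemma reduction_exists:
  fixes p :: "nat poly"
  assumes "wf_tm M"
  shows "\<exists>m C sc tc oc idx L tl ep. reduction M m C sc tc oc idx L tl p ep"
proof -
  interpret ntm M by unfold_locales (rule assms)
  obtain tl where tl: "set tl = tiles" using finite_list[OF finite_tiles] by blast
  define m where "m = length tl"
  have "Hash \<in> tiles" by (simp add: tiles_def)
  then have m: "0 < m" using tl unfolding m_def by (cases tl) auto
  define A where "A = {(r, a, b). r \<in> {1..4} \<and> a < m \<and> b < m \<and> \<not> compat r (tl ! a) (tl ! b)}"
  have "finite A" by (rule finite_subset[of _ "{1..4} \<times> {..<m} \<times> {..<m}"]) (auto simp: A_def)
  then obtain cl where cl: "set cl = A" using finite_list by blast
  define C sc tc oc where "C = length cl" and "sc c = fst (snd (cl ! c))" and "tc c = snd (snd (cl ! c))" and "oc c = fst (cl ! c)" for c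
  have inA: "c < C \<Longrightarrow> (oc c, sc c, tc c) \<in> A" for c using cl nth_mem[of c cl] by (simp add: C_def oc_def sc_def tc_def)
  interpret gadget_shape m C sc tc by unfold_locales (use m inA in \<open>auto simp: A_def\<close>)
  have "finite ({v. is_vertex v} \<times> (UNIV :: bool set))" using finite_is_vertex by simp
  then obtain idx where idx: "bij_betw idx ({v. is_vertex v} \<times> (UNIV :: bool set)) {..<card ({v. is_vertex v} \<times> (UNIV :: bool set))}"
    using ex_bij_betw_finite_nat atLeast0LessThan by metis
  obtain ep where ep: "\<And>\<sigma>. eval ep \<sigma> = poly p (\<sigma> 0)" "vars ep \<subseteq> {0}" using exp_of_poly by blast
  have "reduction M m C sc tc oc idx (card ({v. is_vertex v} \<times> (UNIV :: bool set))) tl p ep"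
  proof unfold_locales
    fix r a b assume r: "r \<in> {1..4 :: nat}" "a < m" "b < m"
    show "(\<exists>c<C. oc c = r \<and> sc c = a \<and> tc c = b) \<longleftrightarrow> \<not> compat r (tl ! a) (tl ! b)"
    proof
      assume "\<exists>c<C. oc c = r \<and> sc c = a \<and> tc c = b"
      then show "\<not> compat r (tl ! a) (tl ! b)" using inA by (auto simp: A_def)
    next
      assume "\<not> compat r (tl ! a) (tl ! b)"
      then have "(r, a, b) \<in> set cl" using r cl by (simp add: A_def)
      then obtain c where "c < length cl" "cl ! c = (r, a, b)" by (metis in_set_conv_nth)
      then show "\<exists>c<C. oc c = r \<and> sc c = a \<and> tc c = b" by (auto simp: C_def oc_def sc_def tc_def)
    qed
  qed (use idx tl ep inA in \<open>auto simp: m_def A_def\<close>)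
  then show ?thesis by blast
qed

theorem theorem5:
  "NP_hard_on encode_MaxEDP (unit_capacity_fvs 1 \<times> UNIV) MaxEDP \<and>
   NP_hard_on encode_EDP (unit_capacity_fvs 2) EDP"
proof -
  have main: "(\<exists>f. poly_time_computable f \<and> (\<forall>x. \<exists>i\<in>unit_capacity_fvs 1 \<times> UNIV. f x = encode_MaxEDP i \<and> (x \<in> A \<longleftrightarrow> MaxEDP i))) \<and>
    (\<exists>f. poly_time_computable f \<and> (\<forall>x. \<exists>i\<in>unit_capacity_fvs 2. f x = encode_EDP i \<and> (x \<in> A \<longleftrightarrow> EDP i)))"
    if A: "A \<in> NP" for A
  proof -
    from A obtain M and p :: "nat poly" where M: "wf_tm M"
      and time: "\<And>x t c. (step M ^^ t) (init_config M x) c \<Longrightarrow> t \<le> poly p (length x)"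
      and acc: "\<And>x. x \<in> A \<longleftrightarrow> (\<exists>t c. (step M ^^ t) (init_config M x) c \<and> halted M c \<and> fst c = accept M)"
      unfolding NP_def by blast
    obtain m C sc tc oc idx L tl ep where "reduction M m C sc tc oc idx L tl p ep"
      using reduction_exists[OF M] by blast
    then interpret reduction M m C sc tc oc idx L tl p ep .
    have grid: "x \<in> A \<longleftrightarrow> (\<exists>\<sigma>. grid x (rows (length x)) \<sigma>)" for x
    proof
      assume "x \<in> A"
      then obtain t c where "(step M ^^ t) (init_config M x) c" "halted M c" "fst c = accept M" using acc by blast
      \<comment> \<open>The time bound of the definition of \<open>NP\<close> applies to every run,
        in particular to the accepting one.\<close>
      moreover from this have "t < rows (length x)" using time[of t x c] by (simp add: rows_def)
      ultimately show "\<exists>\<sigma>. grid x (rows (length x)) \<sigma>" by (rule grid_if_accepts)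
    next
      assume "\<exists>\<sigma>. grid x (rows (length x)) \<sigma>"
      then show "x \<in> A" using accepts_if_grid[of x "rows (length x)"] acc by (auto simp: rows_def)
    qed
    \<comment> \<open>The same tilings serve both problems: two hubs and a threshold for MaxEDP,
      three hubs for EDP; the feedback vertex number is one less than the number of hubs.\<close>
    show ?thesis
    proof (intro conjI exI allI)
      show "poly_time_computable (\<lambda>x. encode_MaxEDP (hub_instance 2 (L * ncells (length x)) (plist 2 x), (L + low_stubs) * ncells (length x)))"
        by (rule poly_time_MaxEDP)
      show "poly_time_computable (\<lambda>x. encode_EDP (hub_instance 3 (L * ncells (length x)) (plist 3 x)))"
        by (rule poly_time_EDP)
      fix x
      show "\<exists>i\<in>unit_capacity_fvs 1 \<times> UNIV. encode_MaxEDP (hub_instance 2 (L * ncells (length x)) (plist 2 x), (L + low_stubs) * ncells (length x))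
          = encode_MaxEDP i \<and> (x \<in> A \<longleftrightarrow> MaxEDP i)"
        using reduction_instance(1)[of 2 x] reduction_instance(3)[of x] grid[of x]
        by (intro bexI[of _ "(hub_instance 2 (L * ncells (length x)) (plist 2 x), (L + low_stubs) * ncells (length x))"]) auto
      show "\<exists>i\<in>unit_capacity_fvs 2. encode_EDP (hub_instance 3 (L * ncells (length x)) (plist 3 x)) = encode_EDP i \<and> (x \<in> A \<longleftrightarrow> EDP i)"
        using reduction_instance(1)[of 3 x] reduction_instance(2)[of x] grid[of x]
        by (intro bexI[of _ "hub_instance 3 (L * ncells (length x)) (plist 3 x)"]) auto
    qed
  qed
  then show ?thesis unfolding NP_hard_on_def by blast
qed

end
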